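(* Let $F(y)\in\mathbb{K}[y]$ be monic irreducible of degree $s$ with $F(y)\ne y$, let $m$ be the number of irreducible factors of $F(x^n)$ in $R$, $\ell=n/m$, and let $f$ be a monic irreducible factor of $F(x^n)$ with $f\notin Z(R)$. Let $\rho\in\mathrm{Aut}(\mathbb{L})$, $\mathbb{K}'=\mathrm{Fix}_{\mathbb{L}}(\rho)\cap\mathbb{K}$, and assume $\mathbb{K}/\mathbb{K}'$ is a finite extension. Let $k<m$ be a positive integer. Then, for every $\eta\in\mathbb{L}$ such that $$\mathrm{N}_{\mathbb{L}/\mathbb{K}'}(\eta)\,\mathrm{N}_{\mathbb{K}/\mathbb{K}'}\big((-1)^{sk\ell(n-1)}F_0^{k\ell}\big)\neq1,$$ where $F_0$ is the constant coefficient of $F(x^n)$, the set $$S_{n,s\ell,k}(\eta,\rho,F)=\{a_0+a_1x+\dots+a_{sk\ell-1}x^{sk\ell-1}+\eta\rho(a_0)x^{sk\ell}+RF(x^n): a_i\in\mathbb{L}\}$$ is a $\mathbb{K}'$-linear MRD code in $R/RF(x^n)\cong M_m(\mathcal{E}(f))$ with minimum distance $m-k+1$.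
   Context: Let $\mathbb{K}$ be a field, $\mathbb{L}/\mathbb{K}$ a cyclic Galois extension of degree $n\ge2$, $\sigma$ a generator of $\mathrm{Gal}(\mathbb{L}/\mathbb{K})$, $R=\mathbb{L}[x;\sigma]$ the skew polynomial ring with $xa=\sigma(a)x$; $Z(R)=\mathbb{K}[x^n]$. For $F$ as in the claim, the eigenring $\mathcal{E}(f)=\{g\in R:\deg g<\deg f,\ fg\in Rf\}$ (multiplication mod $Rf$) is a central division algebra of degree $\ell$ over $E_F\cong\mathbb{K}[y]/(F(y))$ (so $[\mathcal{E}(f):\mathbb{K}]=s\ell^2$), and $R/RF(x^n)\cong M_m(\mathcal{E}(f))$ via $a\mapsto(b\mapsto ab\bmod_r f)$ on the $m$-dimensional right $\mathcal{E}(f)$-space $R/Rf$. Rank of $a\in R/RF(x^n)$ = rank of the corresponding matrix, equivalently $m-\frac{1}{s\ell}\deg\mathrm{gcrd}(a,F(x^n))$. The minimum distance of an additive code $C\subseteq M_m(D)$ ($D$ a division ring) is the minimum rank of its nonzero elements. For a subfield $\mathbb{K}'$ of the centre with $[D:\mathbb{K}']<\infty$, a $\mathbb{K}'$-linear code $C$ with minimum distance $d$ satisfies $\dim_{\mathbb{K}'}C\le m(m-d+1)[D:\mathbb{K}']$; $C$ is MRD if equality holds. *)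

theory Defs
  imports
    "HOL-Algebra.Embedded_Algebras"
    "HOL-Algebra.QuotRing"
    "HOL-Algebra.Ring_Divisibility"
    "HOL-Algebra.Algebraic_Closure_Type"
    "HOL-Computational_Algebra.Polynomial"
    "Jordan_Normal_Form.Determinant"
begin

section \<open>Field extensions inside a field type\<close>

text \<open>
  The big field is a type \<open>'l\<close> of class \<open>field\<close>; its subfields are sets of elements of \<open>'l\<close>.
\<close>

abbreviation ambient_field :: "'l::field ring"
  where "ambient_field \<equiv> ring_of_type_algebra"

definition galois_group :: "'l::field set \<Rightarrow> ('l \<Rightarrow> 'l) monoid" where
  "galois_group K =
    \<lparr>carrier = {\<tau> \<in> ring_iso ambient_field ambient_field. \<forall>a\<in>K. \<tau> a = a},
     monoid.mult = (\<circ>), one = id\<rparr>"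

definition cyclic_galois :: "'l::field set \<Rightarrow> nat \<Rightarrow> ('l \<Rightarrow> 'l) \<Rightarrow> bool" where
  "cyclic_galois K n \<sigma> \<longleftrightarrow>
     subfield K ambient_field \<and>
     ring.dimension ambient_field n K UNIV \<and>
     {a. \<forall>\<tau>\<in>carrier (galois_group K). \<tau> a = a} = K \<and>
     \<sigma> \<in> carrier (galois_group K) \<and>
     generate (galois_group K) {\<sigma>} = carrier (galois_group K)"

text \<open>
  The norm of \<open>E/F\<close> is the determinant of the \<open>F\<close>-linear map \<open>b \<mapsto> a b\<close> on \<open>E\<close>; the extension
  need not be Galois. The value does not depend on the chosen basis \<open>bs\<close>.
\<close>

definition field_norm :: "'l::field set \<Rightarrow> 'l set \<Rightarrow> 'l \<Rightarrow> 'l" where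
  "field_norm E F a =
    (THE d. \<exists>bs A.
       ring.independent ambient_field F bs \<and> ring.Span ambient_field F bs = E \<and>
       A \<in> carrier_mat (length bs) (length bs) \<and> elements_mat A \<subseteq> F \<and>
       (\<forall>j<length bs. a * bs ! j = (\<Sum>i<length bs. A $$ (i, j) * bs ! i)) \<and>
       d = det A)"

definition poly_ring_over :: "'l::field set \<Rightarrow> 'l poly ring" where
  "poly_ring_over K =
    \<lparr>carrier = {p. range (coeff p) \<subseteq> K}, monoid.mult = (*), one = 1, zero = 0, add = (+)\<rparr>"

section \<open>Skew polynomials\<close>

text \<open>
  A skew polynomial \<open>a\<^sub>0 + a\<^sub>1 x + \<dots>\<close>, with coefficients on the left, is stored as the
  polynomial with the same coefficients; only the multiplication changes,
  by \<open>(a x\<^sup>i) (b x\<^sup>j) = a \<sigma>\<^sup>i(b) x\<^sup>i\<^sup>+\<^sup>j\<close>.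
\<close>

definition skew_mult :: "('l::field \<Rightarrow> 'l) \<Rightarrow> 'l poly \<Rightarrow> 'l poly \<Rightarrow> 'l poly" where
  "skew_mult \<sigma> p q =
    (\<Sum>i\<le>degree p. \<Sum>j\<le>degree q. monom (coeff p i * (\<sigma> ^^ i) (coeff q j)) (i + j))"

definition skew_poly_ring :: "('l::field \<Rightarrow> 'l) \<Rightarrow> 'l poly ring" where
  "skew_poly_ring \<sigma> =
    \<lparr>carrier = UNIV, monoid.mult = skew_mult \<sigma>, one = 1, zero = 0, add = (+)\<rparr>"

definition skew_center :: "('l::field \<Rightarrow> 'l) \<Rightarrow> 'l poly set" where
  "skew_center \<sigma> = {p. \<forall>q. skew_mult \<sigma> p q = skew_mult \<sigma> q p}"

text \<open>
  The library's \<open>irreducible\<close> is phrased by one-sided divisibility and intended for commutative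
  monoids, so the two-sided notion is spelled out.
\<close>

definition skew_irreducible :: "('l::field \<Rightarrow> 'l) \<Rightarrow> 'l poly \<Rightarrow> bool" where
  "skew_irreducible \<sigma> f \<longleftrightarrow>
     f \<noteq> 0 \<and> f \<notin> Units (skew_poly_ring \<sigma>) \<and>
     (\<forall>g h. f = skew_mult \<sigma> g h \<longrightarrow>
        g \<in> Units (skew_poly_ring \<sigma>) \<or> h \<in> Units (skew_poly_ring \<sigma>))"

definition skew_factor :: "('l::field \<Rightarrow> 'l) \<Rightarrow> 'l poly \<Rightarrow> 'l poly \<Rightarrow> bool" where
  "skew_factor \<sigma> f p \<longleftrightarrow> (\<exists>g h. p = skew_mult \<sigma> (skew_mult \<sigma> g f) h)"

text \<open>
  The number of factors, counted with repetition, of a factorization into irreducibles.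
  It is the same for all factorizations of \<open>p\<close>, as the skew polynomial ring is a
  principal ideal domain on both sides.
\<close>

definition irreducible_factor_count :: "('l::field \<Rightarrow> 'l) \<Rightarrow> 'l poly \<Rightarrow> nat \<Rightarrow> bool" where
  "irreducible_factor_count \<sigma> p m \<longleftrightarrow>
     (\<exists>fs. length fs = m \<and> (\<forall>f\<in>set fs. skew_irreducible \<sigma> f) \<and>
           p = foldr (skew_mult \<sigma>) fs 1)"

definition subst_power :: "nat \<Rightarrow> 'l::field poly \<Rightarrow> 'l poly" where
  "subst_power n F = (\<Sum>i\<le>degree F. monom (coeff F i) (n * i))"

abbreviation skew_quotient :: "('l::field \<Rightarrow> 'l) \<Rightarrow> 'l poly \<Rightarrow> 'l poly set ring" where
  "skew_quotient \<sigma> P \<equiv> skew_poly_ring \<sigma> Quot (PIdl\<^bsub>skew_poly_ring \<sigma>\<^esub> P)"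

abbreviation skew_coset :: "('l::field \<Rightarrow> 'l) \<Rightarrow> 'l poly \<Rightarrow> 'l poly \<Rightarrow> 'l poly set" where
  "skew_coset \<sigma> P a \<equiv> (PIdl\<^bsub>skew_poly_ring \<sigma>\<^esub> P) +>\<^bsub>skew_poly_ring \<sigma>\<^esub> a"

section \<open>The eigenring and the module of remainders\<close>

definition remainders :: "'l::field poly \<Rightarrow> 'l poly set" where
  "remainders f = {b. b = 0 \<or> degree b < degree f}"

text \<open>\<open>skew_rmod \<sigma> a f\<close> is the remainder \<open>r\<close> in the right division \<open>a = q f + r\<close>.\<close>

definition skew_rmod :: "('l::field \<Rightarrow> 'l) \<Rightarrow> 'l poly \<Rightarrow> 'l poly \<Rightarrow> 'l poly" where
  "skew_rmod \<sigma> a f = (THE r. r \<in> remainders f \<and> (\<exists>q. a = skew_mult \<sigma> q f + r))"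

definition eigenring :: "('l::field \<Rightarrow> 'l) \<Rightarrow> 'l poly \<Rightarrow> 'l poly ring" where
  "eigenring \<sigma> f =
    \<lparr>carrier = {g \<in> remainders f. skew_mult \<sigma> f g \<in> PIdl\<^bsub>skew_poly_ring \<sigma>\<^esub> f},
     monoid.mult = (\<lambda>g h. skew_rmod \<sigma> (skew_mult \<sigma> g h) f), one = 1, zero = 0, add = (+)\<rparr>"

text \<open>
  \<open>R/Rf\<close> is represented by \<open>remainders f\<close>, a right vector space over the eigenring by
  \<open>b \<cdot> c = b c mod\<^sub>r f\<close>. \<open>eigen_dim \<sigma> f W d\<close> says that \<open>W\<close> has a right basis with \<open>d\<close> elements.
\<close>

definition eigen_comb :: "('l::field \<Rightarrow> 'l) \<Rightarrow> 'l poly \<Rightarrow> nat \<Rightarrow> (nat \<Rightarrow> 'l poly) \<Rightarrow> (nat \<Rightarrow> 'l poly) \<Rightarrow> 'l poly" where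
  "eigen_comb \<sigma> f d v c = (\<Sum>i<d. skew_rmod \<sigma> (skew_mult \<sigma> (v i) (c i)) f)"

definition eigen_dim :: "('l::field \<Rightarrow> 'l) \<Rightarrow> 'l poly \<Rightarrow> 'l poly set \<Rightarrow> nat \<Rightarrow> bool" where
  "eigen_dim \<sigma> f W d \<longleftrightarrow>
     (\<exists>v. (\<forall>i<d. v i \<in> remainders f) \<and>
          W = {eigen_comb \<sigma> f d v c | c. \<forall>i<d. c i \<in> carrier (eigenring \<sigma> f)} \<and>
          (\<forall>c. (\<forall>i<d. c i \<in> carrier (eigenring \<sigma> f)) \<and> eigen_comb \<sigma> f d v c = 0 \<longrightarrow>
               (\<forall>i<d. c i = 0)))"

text \<open>
  The endomorphism ring of the right eigenring-space \<open>R/Rf\<close>; for a space of dimension \<open>m\<close> this is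
  the \<open>m \<times> m\<close> matrix ring over the eigenring in coordinate-free form.
\<close>

definition eigen_End :: "('l::field \<Rightarrow> 'l) \<Rightarrow> 'l poly \<Rightarrow> ('l poly \<Rightarrow> 'l poly) ring" where
  "eigen_End \<sigma> f =
    \<lparr>carrier = {T \<in> remainders f \<rightarrow>\<^sub>E remainders f.
        (\<forall>b\<in>remainders f. \<forall>b'\<in>remainders f. T (b + b') = T b + T b') \<and>
        (\<forall>b\<in>remainders f. \<forall>c\<in>carrier (eigenring \<sigma> f).
           T (skew_rmod \<sigma> (skew_mult \<sigma> b c) f) = skew_rmod \<sigma> (skew_mult \<sigma> (T b) c) f)},
     monoid.mult = compose (remainders f),
     one = (\<lambda>b\<in>remainders f. b),
     zero = (\<lambda>b\<in>remainders f. 0),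
     add = (\<lambda>S T. \<lambda>b\<in>remainders f. S b + T b)\<rparr>"

text \<open>
  The action of a coset \<open>A = a + R F(x\<^sup>n)\<close> on \<open>R/Rf\<close> by \<open>b \<mapsto> a b mod\<^sub>r f\<close>; all
  representatives \<open>a \<in> A\<close> give the same map.
\<close>

definition coset_map :: "('l::field \<Rightarrow> 'l) \<Rightarrow> 'l poly \<Rightarrow> 'l poly set \<Rightarrow> 'l poly \<Rightarrow> 'l poly" where
  "coset_map \<sigma> f A =
     the_elem ((\<lambda>a. \<lambda>b\<in>remainders f. skew_rmod \<sigma> (skew_mult \<sigma> a b) f) ` A)"

section \<open>Rank-metric codes\<close>

definition coset_rank :: "('l::field \<Rightarrow> 'l) \<Rightarrow> 'l poly \<Rightarrow> 'l poly set \<Rightarrow> nat" where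
  "coset_rank \<sigma> f A = (THE d. eigen_dim \<sigma> f (coset_map \<sigma> f A ` remainders f) d)"

definition linear_code :: "('l::field \<Rightarrow> 'l) \<Rightarrow> 'l poly \<Rightarrow> 'l set \<Rightarrow> 'l poly set set \<Rightarrow> bool" where
  "linear_code \<sigma> P K' C \<longleftrightarrow>
     subgroup C (add_monoid (skew_quotient \<sigma> P)) \<and>
     (\<forall>c\<in>K'. \<forall>A\<in>C. skew_coset \<sigma> P [:c:] \<otimes>\<^bsub>skew_quotient \<sigma> P\<^esub> A \<in> C)"

definition min_distance :: "('l::field \<Rightarrow> 'l) \<Rightarrow> 'l poly \<Rightarrow> 'l poly \<Rightarrow> 'l poly set set \<Rightarrow> nat" where
  "min_distance \<sigma> f P C = Inf (coset_rank \<sigma> f ` (C - {\<zero>\<^bsub>skew_quotient \<sigma> P\<^esub>}))"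

text \<open>
  The scalars \<open>K'\<close> act on \<open>R/RF(x\<^sup>n)\<close> through the cosets of constants, and lie in the eigenring
  as constants. \<open>N\<close> is the dimension of the code and \<open>e\<close> that of the eigenring over \<open>K'\<close>.
\<close>

definition mrd_code ::
  "('l::field \<Rightarrow> 'l) \<Rightarrow> 'l poly \<Rightarrow> 'l poly \<Rightarrow> nat \<Rightarrow> 'l set \<Rightarrow> 'l poly set set \<Rightarrow> bool" where
  "mrd_code \<sigma> f P m K' C \<longleftrightarrow>
     linear_code \<sigma> P K' C \<and>
     (\<exists>N e.
        ring.dimension (skew_quotient \<sigma> P) N ((\<lambda>c. skew_coset \<sigma> P [:c:]) ` K') C \<and>
        ring.dimension (eigenring \<sigma> f) e ((\<lambda>c. [:c:]) ` K') (carrier (eigenring \<sigma> f)) \<and>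
        N = m * (m - min_distance \<sigma> f P C + 1) * e)"

text \<open>With \<open>t = s k \<ell>\<close> and \<open>P = F(x\<^sup>n)\<close> this is the code \<open>S\<^sub>n\<^sub>,\<^sub>s\<^sub>\<ell>\<^sub>,\<^sub>k(\<eta>, \<rho>, F)\<close>.\<close>

definition skew_code ::
  "('l::field \<Rightarrow> 'l) \<Rightarrow> 'l poly \<Rightarrow> nat \<Rightarrow> 'l \<Rightarrow> ('l \<Rightarrow> 'l) \<Rightarrow> 'l poly set set" where
  "skew_code \<sigma> P t \<eta> \<rho> =
     {skew_coset \<sigma> P ((\<Sum>i<t. monom (a i) i) + monom (\<eta> * \<rho> (a 0)) t) | a :: nat \<Rightarrow> 'l. True}"

end

theory Submission
  imports Defs
begin

text \<open>
  Let \<open>V = R/Rf\<close>, a simple left \<open>R\<close>-module with annihilator \<open>RP\<close>, and let \<open>D\<close> be the eigenring,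
  which acts on the right. By Jacobson density the polynomials killing \<open>d\<close> independent vectors
  of \<open>V\<close> form a left ideal \<open>Rg\<close> with \<open>deg g = d deg f\<close>, where \<open>g\<close> is a right divisor of \<open>P\<close>;
  hence \<open>V\<close> has dimension \<open>m\<close> and \<open>R/RP\<close> is the endomorphism ring of \<open>V\<close>.

  A codeword \<open>a\<close> of rank at most \<open>m - k\<close> kills \<open>k\<close> independent vectors, so \<open>a = c g\<close> with a constant
  \<open>c\<close> and \<open>deg g = t = k deg f\<close>. The reduced norm of \<open>g\<close>, the determinant of right multiplication by
  \<open>g\<close> on \<open>R\<close> over \<open>L[x\<^sup>n]\<close>, divides a power of \<open>P\<close> and is therefore itself a power of \<open>P\<close> up to sign. At
  \<open>x = 0\<close> this gives \<open>N\<^sub>L\<^sub>/\<^sub>K(g\<^sub>0) = (-1)\<^sup>t\<^sup>(\<^sup>n\<^sup>-\<^sup>1\<^sup>) P\<^sub>0\<^sup>k\<^sup>l\<close>. Since \<open>a\<^sub>0 = c g\<^sub>0\<close> and \<open>\<eta> \<rho>(a\<^sub>0) = c\<close>, taking norms to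
  \<open>K'\<close>, which are invariant under \<open>\<rho>\<close>, contradicts the hypothesis on \<open>\<eta>\<close>. So the minimum distance is at
  least \<open>m - k + 1\<close>; a codeword of the form \<open>(1 + b x\<^sup>j) g\<close> attains it, and the dimension
  of the code is then the Singleton bound.
\<close>

section \<open>Skew polynomial arithmetic\<close>

text \<open>\<open>L\<close> acts on \<open>V\<close> from the left and the eigenring from the
  right, so dimensions over the eigenring are not visible in coefficients. They are read off from
  degrees of annihilators instead: a degree is an \<open>L\<close>-dimension, and comparing degrees
  replaces the exchange lemma, the computation of the eigenring and the structure theory of simple
  rings. The reduced norm of \<open>g\<close> lies in \<open>K[x^n]\<close> because it is invariant
  under \<open>\<sigma>\<close> and only carries exponents divisible by \<open>n\<close>. There
  \<open>P\<close> is irreducible, so a divisor of a power of \<open>P\<close> is a power of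
  \<open>P\<close> up to a constant; the degree fixes the exponent and the leading coefficient fixes
  the sign, which comes from an \<open>n\<close>-cycle. Descending to \<open>K'\<close> is the other
  obstacle. \<open>K/K'\<close> is merely finite, so its norm is not a product of conjugates, and
  \<open>\<rho>\<close> may move \<open>K\<close>. Transitivity of the norm is therefore proved with
  block determinants, and invariance under \<open>\<rho>\<close> by transporting a
  \<open>K'\<close>-basis of \<open>L\<close>. The dimension of the eigenring over \<open>K'\<close>
  is found by counting \<open>V\<close> twice, as an \<open>L\<close>-space and as a right
  eigenring-space.\<close>

locale skew_poly =
  fixes \<sigma> :: "'l::field \<Rightarrow> 'l"
  assumes \<sigma>_add: "\<sigma> (a + b) = \<sigma> a + \<sigma> b"
    and \<sigma>_mult: "\<sigma> (a * b) = \<sigma> a * \<sigma> b"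
    and \<sigma>_one: "\<sigma> 1 = 1"
begin

abbreviation skew_times (infixl \<open>\<star>\<close> 70) where "p \<star> q \<equiv> skew_mult \<sigma> p q"

lemma \<sigma>_zero [simp]: "\<sigma> 0 = 0"
  using \<sigma>_add[of 0 0] by (metis add_0 add_cancel_right_left)

lemma funpow_add': "(\<sigma> ^^ i) (a + b) = (\<sigma> ^^ i) a + (\<sigma> ^^ i) b"
  by (induction i) (auto simp: \<sigma>_add)

lemma funpow_mult': "(\<sigma> ^^ i) (a * b) = (\<sigma> ^^ i) a * (\<sigma> ^^ i) b"
  by (induction i) (auto simp: \<sigma>_mult)

lemma funpow_zero [simp]: "(\<sigma> ^^ i) 0 = 0"
  by (induction i) auto

lemma funpow_one [simp]: "(\<sigma> ^^ i) 1 = 1"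
  by (induction i) (auto simp: \<sigma>_one)

lemma funpow_minus: "(\<sigma> ^^ i) (- a) = - (\<sigma> ^^ i) a"
  using funpow_add'[of i a "- a"] by (simp add: add_eq_0_iff)

lemma funpow_sum: "(\<sigma> ^^ i) (sum g A) = (\<Sum>x\<in>A. (\<sigma> ^^ i) (g x))"
  by (induction A rule: infinite_finite_induct) (auto simp: funpow_add')

text \<open>The image of an inverse is an inverse of the image. This injectivity makes degrees add
  and lets leading coefficients be divided.\<close>

lemma funpow_eq_0_iff [simp]: "(\<sigma> ^^ i) a = 0 \<longleftrightarrow> a = 0"
proof
  assume "(\<sigma> ^^ i) a = 0"
  moreover have "a \<noteq> 0 \<Longrightarrow> (\<sigma> ^^ i) a * (\<sigma> ^^ i) (inverse a) = 1"
    using funpow_mult'[of i a "inverse a"] by simp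
  ultimately show "a = 0" by auto
qed simp

text \<open>Coefficients beyond the degrees vanish, so both degree bounds of the definition can be
  traded for the single bound \<open>k\<close>. The ring laws become identities between finite
  sums.\<close>

lemma coeff_skew_mult: "coeff (p \<star> q) k = (\<Sum>i\<le>k. coeff p i * (\<sigma> ^^ i) (coeff q (k - i)))"
proof -
  have inner: "(\<Sum>j\<le>degree q. coeff (monom (coeff p i * (\<sigma> ^^ i) (coeff q j)) (i + j)) k)
    = (if i \<le> k then coeff p i * (\<sigma> ^^ i) (coeff q (k - i)) else 0)" for i
  proof -
    have "(\<Sum>j\<le>degree q. coeff (monom (coeff p i * (\<sigma> ^^ i) (coeff q j)) (i + j)) k)
      = (\<Sum>j\<le>degree q. if j = k - i then (if i \<le> k then coeff p i * (\<sigma> ^^ i) (coeff q j) else 0) else 0)"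
      by (intro sum.cong) auto
    also have "\<dots> = (if i \<le> k then coeff p i * (\<sigma> ^^ i) (coeff q (k - i)) else 0)"
      by (auto simp: sum.delta coeff_eq_0)
    finally show ?thesis .
  qed
  have "coeff (p \<star> q) k
    = (\<Sum>i\<le>degree p. if i \<le> k then coeff p i * (\<sigma> ^^ i) (coeff q (k - i)) else 0)"
    by (simp only: skew_mult_def coeff_sum inner)
  also have "\<dots> = (\<Sum>i\<in>{..degree p} \<inter> {..k}. coeff p i * (\<sigma> ^^ i) (coeff q (k - i)))"
    by (subst sum.inter_restrict) (auto intro: sum.cong)
  also have "\<dots> = (\<Sum>i\<le>k. coeff p i * (\<sigma> ^^ i) (coeff q (k - i)))"
    by (rule sum.mono_neutral_left) (auto simp: coeff_eq_0)
  finally show ?thesis .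
qed

lemma skew_mult_assoc: "(a \<star> b) \<star> c = a \<star> (b \<star> c)"
proof (rule poly_eqI)
  fix k
  have "coeff ((a \<star> b) \<star> c) k = (\<Sum>(i, j)\<in>(SIGMA i:{..k}. {..i}).
      coeff a j * (\<sigma> ^^ j) (coeff b (i - j)) * (\<sigma> ^^ i) (coeff c (k - i)))"
    by (simp add: coeff_skew_mult sum_distrib_right sum.Sigma)
  \<comment> \<open>Before the change of index \<open>i\<close> is the exponent taken by
    \<open>a\<close> and \<open>b\<close> together and \<open>j\<close> the share of
    \<open>a\<close>; afterwards the shares of \<open>a\<close> and \<open>b\<close> are listed
    separately.\<close>
  also have "\<dots> = (\<Sum>(i, j)\<in>(SIGMA i:{..k}. {..k - i}).
      coeff a i * ((\<sigma> ^^ i) (coeff b j) * (\<sigma> ^^ i) ((\<sigma> ^^ j) (coeff c (k - i - j)))))"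
    by (rule sum.reindex_bij_witness[of _ "\<lambda>(i, j). (i + j, i)" "\<lambda>(i, j). (j, i - j)"])
       (auto simp flip: funpow_add comp_apply[of "\<sigma> ^^ _" "\<sigma> ^^ _"])
  also have "\<dots> = coeff (a \<star> (b \<star> c)) k"
    by (simp add: coeff_skew_mult sum_distrib_left sum.Sigma funpow_sum funpow_mult')
  finally show "coeff ((a \<star> b) \<star> c) k = coeff (a \<star> (b \<star> c)) k" .
qed

lemma skew_mult_add_left: "(a + b) \<star> c = a \<star> c + b \<star> c"
  by (rule poly_eqI) (simp add: coeff_skew_mult distrib_right sum.distrib)

lemma skew_mult_add_right: "a \<star> (b + c) = a \<star> b + a \<star> c"
  by (rule poly_eqI) (simp add: coeff_skew_mult distrib_left sum.distrib funpow_add')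

lemma skew_mult_zero [simp]: "0 \<star> a = 0" "a \<star> 0 = 0"
  by (auto intro!: poly_eqI simp: coeff_skew_mult)

lemma skew_mult_minus: "(- a) \<star> b = - (a \<star> b)" "a \<star> (- b) = - (a \<star> b)"
  by (auto intro!: poly_eqI simp: coeff_skew_mult funpow_minus sum_negf)

lemma skew_mult_diff_left: "(a - b) \<star> c = a \<star> c - b \<star> c"
  using skew_mult_add_left[of a "- b" c] by (simp add: skew_mult_minus)

lemma skew_mult_diff_right: "a \<star> (b - c) = a \<star> b - a \<star> c"
  using skew_mult_add_right[of a b "- c"] by (simp add: skew_mult_minus)

lemmas skew_mult_distribs = skew_mult_add_left skew_mult_add_right skew_mult_diff_left
  skew_mult_diff_right skew_mult_minus

lemma skew_mult_sum_right: "b \<star> sum g A = (\<Sum>x\<in>A. b \<star> g x)"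
  by (induction A rule: infinite_finite_induct) (auto simp: skew_mult_distribs)

lemma const_skew_mult: "[:c:] \<star> p = smult c p"
proof (rule poly_eqI)
  fix k
  have "coeff ([:c:] \<star> p) k = (\<Sum>i\<in>{0}. coeff [:c:] i * (\<sigma> ^^ i) (coeff p (k - i)))"
    unfolding coeff_skew_mult by (rule sum.mono_neutral_right) (auto simp: coeff_pCons split: nat.splits)
  then show "coeff ([:c:] \<star> p) k = coeff (smult c p) k" by simp
qed

lemma skew_mult_one [simp]: "1 \<star> p = p" "p \<star> 1 = p"
proof -
  show "1 \<star> p = p" using const_skew_mult[of 1 p] by (simp add: one_pCons)
  show "p \<star> 1 = p"
  proof (rule poly_eqI)
    fix k
    have "coeff (p \<star> 1) k = (\<Sum>i\<in>{k}. coeff p i * (\<sigma> ^^ i) (coeff 1 (k - i)))"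
      unfolding coeff_skew_mult by (rule sum.mono_neutral_right) auto
    then show "coeff (p \<star> 1) k = coeff p k" by simp
  qed
qed

lemma smult_skew_mult: "smult c p \<star> q = smult c (p \<star> q)"
  by (simp flip: const_skew_mult add: skew_mult_assoc)

lemma monom_skew_mult: "coeff (monom c d \<star> p) k = (if d \<le> k then c * (\<sigma> ^^ d) (coeff p (k - d)) else 0)"
proof -
  have "coeff (monom c d \<star> p) k = (\<Sum>i\<le>k. if i = d then c * (\<sigma> ^^ d) (coeff p (k - d)) else 0)"
    unfolding coeff_skew_mult by (rule sum.cong) auto
  then show ?thesis by (simp add: sum.delta)
qed

lemma skew_mult_monom: "coeff (p \<star> monom c d) k = (if d \<le> k then coeff p (k - d) * (\<sigma> ^^ (k - d)) c else 0)"
proof -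
  have "coeff (p \<star> monom c d) k = (\<Sum>i\<le>k. if i = k - d then (if d \<le> k then coeff p (k - d) * (\<sigma> ^^ (k - d)) c else 0) else 0)"
    unfolding coeff_skew_mult by (rule sum.cong) auto
  then show ?thesis by (simp add: sum.delta)
qed

lemma coeff_skew_mult_degree_sum:
  "coeff (p \<star> q) (degree p + degree q) = lead_coeff p * (\<sigma> ^^ degree p) (lead_coeff q)"
proof -
  have "coeff (p \<star> q) (degree p + degree q) = (\<Sum>i\<in>{degree p}. coeff p i * (\<sigma> ^^ i) (coeff q (degree p + degree q - i)))"
    unfolding coeff_skew_mult
  proof (rule sum.mono_neutral_right)
    show "\<forall>i\<in>{..degree p + degree q} - {degree p}. coeff p i * (\<sigma> ^^ i) (coeff q (degree p + degree q - i)) = 0"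
    proof
      fix i assume "i \<in> {..degree p + degree q} - {degree p}"
      then consider "i > degree p" | "degree p + degree q - i > degree q" by force
      then show "coeff p i * (\<sigma> ^^ i) (coeff q (degree p + degree q - i)) = 0"
        by cases (auto simp: coeff_eq_0)
    qed
  qed auto
  then show ?thesis by simp
qed

lemma coeff_skew_mult_0: "coeff (p \<star> q) 0 = coeff p 0 * coeff q 0"
  by (simp add: coeff_skew_mult)

lemma skew_mult_eq_0_iff [simp]: "p \<star> q = 0 \<longleftrightarrow> p = 0 \<or> q = 0"
  using coeff_skew_mult_degree_sum[of p q] by auto

lemma degree_skew_mult: "p \<noteq> 0 \<Longrightarrow> q \<noteq> 0 \<Longrightarrow> degree (p \<star> q) = degree p + degree q"
proof (rule antisym)
  show "degree (p \<star> q) \<le> degree p + degree q"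
  proof (rule degree_le, intro allI impI)
    fix k assume k: "degree p + degree q < k"
    show "coeff (p \<star> q) k = 0"
      unfolding coeff_skew_mult
    proof (rule sum.neutral, rule ballI)
      fix i assume "i \<in> {..k}"
      then consider "i > degree p" | "k - i > degree q" using k by force
      then show "coeff p i * (\<sigma> ^^ i) (coeff q (k - i)) = 0"
        by cases (auto simp: coeff_eq_0)
    qed
  qed
  show "degree p + degree q \<le> degree (p \<star> q)" if "p \<noteq> 0" "q \<noteq> 0"
    using that by (intro le_degree) (simp add: coeff_skew_mult_degree_sum)
qed

lemma lead_coeff_skew_mult:
  "p \<noteq> 0 \<Longrightarrow> q \<noteq> 0 \<Longrightarrow> lead_coeff (p \<star> q) = lead_coeff p * (\<sigma> ^^ degree p) (lead_coeff q)"
  by (simp add: degree_skew_mult coeff_skew_mult_degree_sum)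

lemma skew_mult_cancel_left: "a \<noteq> 0 \<Longrightarrow> a \<star> b = a \<star> c \<Longrightarrow> b = c"
  using skew_mult_eq_0_iff[of a "b - c"] by (simp add: skew_mult_distribs)

section \<open>Right division and left ideals\<close>

lemma remainders_iff: "r \<in> remainders b \<longleftrightarrow> r = 0 \<or> degree r < degree b"
  by (simp add: remainders_def)

lemma remainders_coeff: "b \<noteq> 0 \<Longrightarrow> r \<in> remainders b \<longleftrightarrow> (\<forall>k\<ge>degree b. coeff r k = 0)"
  by (auto simp: remainders_def coeff_eq_0 intro: leading_coeff_0_iff[THEN iffD1] not_less[THEN iffD1])

lemma remainders_zero [simp]: "0 \<in> remainders b"
  by (simp add: remainders_def)

lemma remainders_add: "r \<in> remainders b \<Longrightarrow> r' \<in> remainders b \<Longrightarrow> r + r' \<in> remainders b"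
  by (auto simp: remainders_def intro: degree_add_less)

lemma remainders_minus: "r \<in> remainders b \<Longrightarrow> - r \<in> remainders b"
  by (auto simp: remainders_def)

lemma remainders_diff: "r \<in> remainders b \<Longrightarrow> r' \<in> remainders b \<Longrightarrow> r - r' \<in> remainders b"
  using remainders_add[of r b "- r'", OF _ remainders_minus] by simp

lemma remainders_smult: "r \<in> remainders b \<Longrightarrow> smult c r \<in> remainders b"
  by (auto simp: remainders_def)

text \<open>Membership of \<open>a\<close> in the left ideal \<open>R b\<close>, and so congruence
  modulo it. Left multiplication always respects it; right multiplication will be available for
  central \<open>b\<close> and for multipliers from the eigenring.\<close>

definition right_dvd :: "'l poly \<Rightarrow> 'l poly \<Rightarrow> bool" where
  "right_dvd b a \<longleftrightarrow> (\<exists>q. a = q \<star> b)"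

lemma right_dvdI: "right_dvd b (q \<star> b)"
  by (auto simp: right_dvd_def)

lemma right_dvd_zero [simp]: "right_dvd b 0"
  using right_dvdI[of b 0] by simp

lemma right_dvd_add: "right_dvd b a \<Longrightarrow> right_dvd b a' \<Longrightarrow> right_dvd b (a + a')"
  unfolding right_dvd_def by (metis skew_mult_add_left)

lemma right_dvd_minus: "right_dvd b a \<Longrightarrow> right_dvd b (- a)"
  unfolding right_dvd_def by (metis skew_mult_minus(1))

lemma right_dvd_diff: "right_dvd b a \<Longrightarrow> right_dvd b a' \<Longrightarrow> right_dvd b (a - a')"
  unfolding right_dvd_def by (metis skew_mult_diff_left)

lemma right_dvd_mult: "right_dvd b a \<Longrightarrow> right_dvd b (c \<star> a)"
  unfolding right_dvd_def by (metis skew_mult_assoc)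

lemma right_dvd_sum: "(\<And>x. x \<in> A \<Longrightarrow> right_dvd b (g x)) \<Longrightarrow> right_dvd b (sum g A)"
  by (induction A rule: infinite_finite_induct) (auto intro: right_dvd_add)

lemma right_dvd_diff_iff: "right_dvd b (a - a') \<Longrightarrow> right_dvd b a \<longleftrightarrow> right_dvd b a'"
  using right_dvd_diff[of b a "a - a'"] right_dvd_add[of b "a - a'" a'] by auto

lemma right_dvd_remainder: "r \<in> remainders b \<Longrightarrow> right_dvd b r \<Longrightarrow> r = 0"
proof -
  assume r: "r \<in> remainders b" and "right_dvd b r"
  then obtain q where q: "r = q \<star> b" by (auto simp: right_dvd_def)
  show "r = 0"
  proof (rule ccontr)
    assume "r \<noteq> 0"
    then have "q \<noteq> 0" "b \<noteq> 0" using q by auto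
    then show False using degree_skew_mult[of q b] r q by (simp add: remainders_def)
  qed
qed

lemma right_dvd_degree: "right_dvd b a \<Longrightarrow> a \<noteq> 0 \<Longrightarrow> degree b \<le> degree a"
  by (auto simp: right_dvd_def degree_skew_mult)

lemma right_division:
  assumes "b \<noteq> 0"
  shows "\<exists>q r. a = q \<star> b + r \<and> r \<in> remainders b"
\<comment> \<open>The measure ranks 0 strictly below the nonzero constants, so reaching 0 counts as
  progress even from degree 0.\<close>
proof (induction "if a = 0 then 0 else Suc (degree a)" arbitrary: a rule: less_induct)
  case less
  show ?case
  proof (cases "a = 0 \<or> degree a < degree b")
    case True
    then show ?thesis by (intro exI[of _ 0] exI[of _ a]) (auto simp: remainders_def)
  next
    case False
    define d where "d = degree a - degree b"
    \<comment> \<open>Moving \<open>x^d\<close> past the coefficients of \<open>b\<close> twists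
      them, so the leading coefficient to be cancelled is the twisted one.\<close>
    define c where "c = lead_coeff a / (\<sigma> ^^ d) (lead_coeff b)"
    define a' where "a' = a - monom c d \<star> b"
    have m: "monom c d \<noteq> 0" using False assms by (simp add: c_def)
    have dd: "degree (monom c d) = d" using m by (simp add: degree_monom_eq)
    have deg: "degree (monom c d \<star> b) = degree a"
      using False degree_skew_mult[OF m assms] dd by (simp add: d_def)
    have "lead_coeff (monom c d \<star> b) = lead_coeff a"
      unfolding lead_coeff_skew_mult[OF m assms] dd coeff_monom using assms by (simp add: c_def)
    then have c0: "coeff a' (degree a) = 0" by (simp add: a'_def deg)
    have le: "degree a' \<le> degree a" unfolding a'_def by (intro degree_diff_le) (auto simp: deg)
    have "a' = 0 \<or> degree a' < degree a"
      using c0 le leading_coeff_0_iff[of a'] by (metis le_neq_implies_less)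
    then have "\<exists>q r. a' = q \<star> b + r \<and> r \<in> remainders b"
      using less[of a'] False by (cases "a' = 0") auto
    then obtain q r where "a' = q \<star> b + r" "r \<in> remainders b" by blast
    then show ?thesis
      by (intro exI[of _ "q + monom c d"] exI[of _ r]) (auto simp: a'_def skew_mult_distribs algebra_simps)
  qed
qed

lemma skew_rmod_unique:
  assumes "r \<in> remainders b" "right_dvd b (a - r)"
  shows "skew_rmod \<sigma> a b = r"
  unfolding skew_rmod_def
proof (rule the_equality)
  obtain q where "a - r = q \<star> b" using assms(2) by (auto simp: right_dvd_def)
  then show "r \<in> remainders b \<and> (\<exists>q. a = q \<star> b + r)"
    using assms(1) by (auto intro!: exI[of _ q] simp: algebra_simps)
  fix r' assume r': "r' \<in> remainders b \<and> (\<exists>q. a = q \<star> b + r')"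
  then have "right_dvd b (a - r')" by (auto simp: right_dvd_def)
  then have "right_dvd b ((a - r') - (a - r))" using assms(2) by (rule right_dvd_diff)
  then have "right_dvd b (r - r')" by simp
  then have "r - r' = 0" using r' assms(1) by (intro right_dvd_remainder[of _ b] remainders_diff) auto
  then show "r' = r" by simp
qed

text \<open>Division by an element of least degree leaves remainder 0. Minimality is part of the
  conclusion because the study of two-sided ideals argues with an element of least degree.\<close>

lemma left_ideal_principal:
  assumes add: "\<And>u v. u \<in> J \<Longrightarrow> v \<in> J \<Longrightarrow> u + v \<in> J"
    and mult: "\<And>u v. v \<in> J \<Longrightarrow> u \<star> v \<in> J"
    and nz: "w \<in> J" "w \<noteq> 0"
  obtains g where "lead_coeff g = 1" "g \<in> J" "J = {a. right_dvd g a}"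
    "\<And>h. h \<in> J \<Longrightarrow> h \<noteq> 0 \<Longrightarrow> degree g \<le> degree h"
proof -
  define d where "d = (LEAST d. \<exists>g\<in>J. g \<noteq> 0 \<and> degree g = d)"
  have "\<exists>d. \<exists>g\<in>J. g \<noteq> 0 \<and> degree g = d" using nz by auto
  then have "\<exists>g\<in>J. g \<noteq> 0 \<and> degree g = d" unfolding d_def by (rule LeastI_ex)
  then obtain h where h: "h \<in> J" "h \<noteq> 0" "degree h = d" by auto
  have least: "d \<le> degree g" if "g \<in> J" "g \<noteq> 0" for g
    unfolding d_def using that by (intro Least_le) auto
  define g where "g = smult (inverse (lead_coeff h)) h"
  have g: "lead_coeff g = 1" "degree g = d" using h(2,3) leading_coeff_0_iff[of h]
    by (simp_all add: g_def)
  then have g0: "g \<noteq> 0" by auto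
  have gJ: "g \<in> J" unfolding g_def using mult[OF h(1), of "[:inverse (lead_coeff h):]"]
    by (simp add: const_skew_mult)
  have "J = {a. right_dvd g a}"
  proof (intro equalityI subsetI)
    fix a assume a: "a \<in> J"
    obtain q r where qr: "a = q \<star> g + r" "r \<in> remainders g" using right_division[OF g0] by blast
    \<comment> \<open>Written as a sum, the remainder is covered by closure under addition and left
      multiplication.\<close>
    have "r = a + (- q) \<star> g" using qr by (simp add: skew_mult_distribs)
    then have "r \<in> J" using a gJ add mult by auto
    then have "r = 0" using least[of r] qr(2) g(2) by (metis (mono_tags) remainders_iff not_less)
    then show "a \<in> {a. right_dvd g a}" using qr by (auto simp: right_dvd_def)
  next
    fix a assume "a \<in> {a. right_dvd g a}"
    then show "a \<in> J" using gJ mult by (auto simp: right_dvd_def)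
  qed
  then show ?thesis using that g gJ least by auto
qed

section \<open>The ring structure, its units and the arithmetic of remainders\<close>

lemma ring_skew_poly_ring: "ring (skew_poly_ring \<sigma>)"
proof (rule ringI)
  show "abelian_group (skew_poly_ring \<sigma>)"
    by (rule abelian_groupI) (auto simp: skew_poly_ring_def algebra_simps intro: exI[of _ "- _"])
  show "Group.monoid (skew_poly_ring \<sigma>)"
    by (rule monoidI) (auto simp: skew_poly_ring_def skew_mult_assoc)
qed (auto simp: skew_poly_ring_def skew_mult_distribs)

lemma Units_skew_poly_ring: "u \<in> Units (skew_poly_ring \<sigma>) \<longleftrightarrow> u \<noteq> 0 \<and> degree u = 0"
proof
  assume "u \<in> Units (skew_poly_ring \<sigma>)"
  then obtain v where v: "u \<star> v = 1" by (auto simp: Units_def skew_poly_ring_def)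
  then have "u \<noteq> 0" "v \<noteq> 0" by auto
  then show "u \<noteq> 0 \<and> degree u = 0" using degree_skew_mult[of u v] v by auto
next
  assume "u \<noteq> 0 \<and> degree u = 0"
  then obtain c where "u = [:c:]" "c \<noteq> 0" by (auto elim: degree_eq_zeroE)
  then show "u \<in> Units (skew_poly_ring \<sigma>)"
    by (auto simp: Units_def skew_poly_ring_def const_skew_mult one_pCons intro!: exI[of _ "[:inverse c:]"])
qed

lemma
  assumes "b \<noteq> 0"
  shows skew_rmod_remainder: "skew_rmod \<sigma> a b \<in> remainders b"
    and right_dvd_skew_rmod: "right_dvd b (a - skew_rmod \<sigma> a b)"
proof -
  obtain q r where "a = q \<star> b + r" "r \<in> remainders b" using right_division[OF assms] by blast
  then have "r \<in> remainders b" "right_dvd b (a - r)" by (auto simp: right_dvdI)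
  then show "skew_rmod \<sigma> a b \<in> remainders b" "right_dvd b (a - skew_rmod \<sigma> a b)"
    using skew_rmod_unique[of r b a] by auto
qed

lemma skew_rmod_cong:
  assumes "b \<noteq> 0" "right_dvd b (a - a')"
  shows "skew_rmod \<sigma> a b = skew_rmod \<sigma> a' b"
  using skew_rmod_unique[OF skew_rmod_remainder[OF assms(1), of a'], of a]
    right_dvd_add[OF assms(2) right_dvd_skew_rmod[OF assms(1), of a']] by simp

lemma skew_rmod_eq_iff:
  assumes "b \<noteq> 0"
  shows "skew_rmod \<sigma> a b = skew_rmod \<sigma> a' b \<longleftrightarrow> right_dvd b (a - a')"
proof
  assume "skew_rmod \<sigma> a b = skew_rmod \<sigma> a' b"
  then show "right_dvd b (a - a')"
    using right_dvd_diff[OF right_dvd_skew_rmod[OF assms, of a] right_dvd_skew_rmod[OF assms, of a']]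
    by simp
qed (rule skew_rmod_cong[OF assms])

lemma skew_rmod_self: "r \<in> remainders b \<Longrightarrow> skew_rmod \<sigma> r b = r"
  by (rule skew_rmod_unique) auto

lemma skew_rmod_eq_0_iff: "b \<noteq> 0 \<Longrightarrow> skew_rmod \<sigma> a b = 0 \<longleftrightarrow> right_dvd b a"
  using skew_rmod_eq_iff[of b a 0] skew_rmod_self[of 0 b] by simp

lemma skew_rmod_add:
  assumes "b \<noteq> 0"
  shows "skew_rmod \<sigma> (a + a') b = skew_rmod \<sigma> a b + skew_rmod \<sigma> a' b"
  using right_dvd_add[OF right_dvd_skew_rmod[OF assms, of a] right_dvd_skew_rmod[OF assms, of a']]
  by (intro skew_rmod_unique remainders_add skew_rmod_remainder[OF assms]) (simp add: algebra_simps)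

lemma skew_rmod_sum:
  assumes "b \<noteq> 0"
  shows "skew_rmod \<sigma> (sum g A) b = (\<Sum>x\<in>A. skew_rmod \<sigma> (g x) b)"
  by (induction A rule: infinite_finite_induct)
     (auto simp: skew_rmod_self skew_rmod_add[OF assms])

lemma skew_rmod_smult:
  assumes "b \<noteq> 0"
  shows "skew_rmod \<sigma> (smult c a) b = smult c (skew_rmod \<sigma> a b)"
  using right_dvd_mult[OF right_dvd_skew_rmod[OF assms, of a], of "[:c:]"]
  by (intro skew_rmod_unique remainders_smult skew_rmod_remainder[OF assms])
     (simp add: const_skew_mult smult_diff_right)

end

text \<open>Filled up with zero rows, the system has a square matrix of determinant zero, and a
  kernel vector solves it. It serves both to compare degrees and to find the order of
  \<open>\<sigma>\<close>.\<close>

lemma underdetermined_system: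
  fixes c :: "nat \<Rightarrow> nat \<Rightarrow> 'a::field"
  assumes "r < n"
  obtains x where "\<exists>j<n. x j \<noteq> 0" "\<And>i. i < r \<Longrightarrow> (\<Sum>j<n. c i j * x j) = 0"
proof -
  define A where "A = mat n n (\<lambda>(i, j). if i < r then c i j else 0)"
  have A: "A \<in> carrier_mat n n" by (simp add: A_def)
  have "det A = 0"
    unfolding det_def'[OF A]
  proof (rule sum.neutral, rule ballI)
    fix p assume "p \<in> {p. p permutes {0..<n}}"
    \<comment> \<open>Every product over a permutation passes through row \<open>r\<close>, which is
      zero.\<close>
    then have "p r < n" using assms permutes_in_image[of p "{0..<n}" r] by auto
    then have "A $$ (r, p r) = 0" using assms by (simp add: A_def)
    then have "(\<Prod>i = 0..<n. A $$ (i, p i)) = 0"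
      using assms by (intro prod_zero bexI[of _ r]) auto
    then show "signof p * (\<Prod>i = 0..<n. A $$ (i, p i)) = 0" by simp
  qed
  then obtain v where v: "v \<in> carrier_vec n" "v \<noteq> 0\<^sub>v n" "A *\<^sub>v v = 0\<^sub>v n"
    using det_0_iff_vec_prod_zero[OF A] by auto
  show ?thesis
  proof (rule that[of "\<lambda>j. v $ j"])
    show "\<exists>j<n. v $ j \<noteq> 0" using v(1,2) by (metis carrier_vecD eq_vecI index_zero_vec)
    fix i assume i: "i < r"
    then have "(\<Sum>j<n. c i j * v $ j) = (A *\<^sub>v v) $ i"
      using assms v(1) by (simp add: A_def scalar_prod_def atLeast0LessThan)
    then show "(\<Sum>j<n. c i j * v $ j) = 0" using v(3) i assms by simp
  qed
qed

context skew_poly begin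

text \<open>The monomials below \<open>degree a\<close> are an \<open>L\<close>-basis of
  \<open>remainders a\<close>, so a degree is a dimension and an injection compares
  dimensions.\<close>

lemma degree_le_of_inj_linear:
  assumes "b \<noteq> 0"
    and add: "\<And>u v. \<phi> (u + v) = \<phi> u + \<phi> v"
    and smult: "\<And>c u. \<phi> (smult c u) = smult c (\<phi> u)"
    and rem: "\<And>u. u \<in> remainders a \<Longrightarrow> \<phi> u \<in> remainders b"
    and inj: "\<And>u. u \<in> remainders a \<Longrightarrow> \<phi> u = 0 \<Longrightarrow> u = 0"
  shows "degree a \<le> degree b"
proof (rule ccontr)
  assume "\<not> degree a \<le> degree b"
  then obtain x where x: "\<exists>j<degree a. x j \<noteq> 0"
    and eq: "\<And>i. i < degree b \<Longrightarrow> (\<Sum>j<degree a. coeff (\<phi> (monom 1 j)) i * x j) = 0"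
    using underdetermined_system[of "degree b" "degree a" "\<lambda>i j. coeff (\<phi> (monom 1 j)) i"] by auto
  define u where "u = (\<Sum>j<degree a. smult (x j) (monom 1 j))"
  have phi0: "\<phi> 0 = 0" using smult[of 0 0] by simp
  have "\<phi> (sum g A) = (\<Sum>j\<in>A. \<phi> (g j))" for g and A :: "nat set"
    by (induction A rule: infinite_finite_induct) (auto simp: add phi0)
  then have phiu: "\<phi> u = (\<Sum>j<degree a. smult (x j) (\<phi> (monom 1 j)))" by (simp add: u_def smult)
  have coeffu: "coeff u k = (if k < degree a then x k else 0)" for k
  proof -
    have "coeff u k = (\<Sum>j<degree a. if j = k then x j else 0)"
      unfolding u_def coeff_sum by (intro sum.cong) auto
    then show ?thesis by (simp add: sum.delta)
  qed
  have "u \<noteq> 0" using x coeffu by (metis coeff_0)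
  moreover have ur: "u \<in> remainders a"
    using coeffu calculation leading_coeff_0_iff[of u] by (auto simp: remainders_def split: if_splits)
  moreover have "\<phi> u = 0"
  proof (rule poly_eqI)
    fix i
    show "coeff (\<phi> u) i = coeff 0 i"
    proof (cases "i < degree b")
      case True
      then show ?thesis using eq[OF True] by (simp add: phiu coeff_sum mult.commute)
    next
      case False
      then show ?thesis using rem[OF ur] remainders_coeff[OF \<open>b \<noteq> 0\<close>] by auto
    qed
  qed
  ultimately show False using inj by auto
qed

end

section \<open>The simple module of remainders\<close>

text \<open>
  The last assumption says that the annihilator of \<open>R/Rf\<close> is \<open>RP\<close>; it holds because \<open>R/RP\<close> is
  simple.
\<close>
locale skew_simple_module = skew_poly \<sigma> for \<sigma> :: "'l::field \<Rightarrow> 'l" +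
  fixes f P :: "'l poly"
  assumes f_irred: "skew_irreducible \<sigma> f"
    and P_central: "P \<star> q = q \<star> P"
    and P_nz: "P \<noteq> 0"
    and f_dvd_P: "right_dvd f P"
    and faithful: "(\<And>v. right_dvd f (u \<star> v)) \<Longrightarrow> right_dvd P u"
begin

lemma f_nz [simp]: "f \<noteq> 0"
  using f_irred by (simp add: skew_irreducible_def)

lemma degree_f_pos: "degree f > 0"
  using f_irred Units_skew_poly_ring by (auto simp: skew_irreducible_def)

abbreviation rem_f where "rem_f a \<equiv> skew_rmod \<sigma> a f"

abbreviation D where "D \<equiv> carrier (eigenring \<sigma> f)"

lemma one_mem_remainders: "1 \<in> remainders f"
  using degree_f_pos by (simp add: remainders_def)

lemma eigen_iff: "c \<in> D \<longleftrightarrow> c \<in> remainders f \<and> right_dvd f (f \<star> c)"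
  by (auto simp: eigenring_def cgenideal_def skew_poly_ring_def right_dvd_def)

lemma eigen_remainder: "c \<in> D \<Longrightarrow> c \<in> remainders f"
  by (simp add: eigen_iff)

text \<open>Since \<open>(q f) c = q (f c)\<close>, having \<open>f c\<close> in \<open>R f\<close>
  is exactly what makes right multiplication by \<open>c\<close> well defined on
  \<open>R/Rf\<close>.\<close>

lemma right_dvd_mult_eigen:
  assumes "right_dvd f a" "right_dvd f (f \<star> c)"
  shows "right_dvd f (a \<star> c)"
proof -
  obtain q where "a = q \<star> f" using assms(1) by (auto simp: right_dvd_def)
  then have "a \<star> c = q \<star> (f \<star> c)" by (simp add: skew_mult_assoc)
  then show ?thesis using assms(2) by (simp add: right_dvd_mult)
qed

lemma right_dvd_mult_D: "right_dvd f a \<Longrightarrow> c \<in> D \<Longrightarrow> right_dvd f (a \<star> c)"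
  by (simp add: right_dvd_mult_eigen eigen_iff)

lemma eigen_zero [simp]: "0 \<in> D"
  by (simp add: eigen_iff)

lemma eigen_one: "1 \<in> D"
  using right_dvdI[of f 1] by (simp add: eigen_iff one_mem_remainders)

lemma eigen_add: "c \<in> D \<Longrightarrow> d \<in> D \<Longrightarrow> c + d \<in> D"
  by (simp add: eigen_iff remainders_add skew_mult_add_right right_dvd_add)

lemma eigen_minus: "c \<in> D \<Longrightarrow> - c \<in> D"
  by (simp add: eigen_iff remainders_minus skew_mult_minus right_dvd_minus)

lemma eigen_rem:
  assumes "right_dvd f (f \<star> a)"
  shows "rem_f a \<in> D"
  unfolding eigen_iff
proof
  show "rem_f a \<in> remainders f" by (simp add: skew_rmod_remainder)
  have "right_dvd f (f \<star> (a - rem_f a))" by (intro right_dvd_mult right_dvd_skew_rmod) simp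
  then show "right_dvd f (f \<star> rem_f a)"
    using assms by (simp add: skew_mult_diff_right right_dvd_diff_iff)
qed

lemma eigen_mult: "c \<in> D \<Longrightarrow> d \<in> D \<Longrightarrow> rem_f (c \<star> d) \<in> D"
  by (rule eigen_rem) (simp flip: skew_mult_assoc add: right_dvd_mult_D eigen_iff right_dvd_mult_eigen)

lemma rem_cong: "right_dvd f (a - b) \<Longrightarrow> rem_f a = rem_f b"
  by (simp add: skew_rmod_cong)

lemma rem_diff_dvd: "right_dvd f (a - rem_f a)"
  by (simp add: right_dvd_skew_rmod)

lemma rem_mult_rem_left: "c \<in> D \<Longrightarrow> rem_f (rem_f a \<star> c) = rem_f (a \<star> c)"
  using right_dvd_minus[OF right_dvd_mult_D[OF rem_diff_dvd]]
  by (intro rem_cong) (simp add: skew_mult_distribs)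

lemma rem_mult_rem_right: "rem_f (a \<star> rem_f b) = rem_f (a \<star> b)"
  using right_dvd_minus[OF right_dvd_mult[OF rem_diff_dvd]]
  by (intro rem_cong) (simp add: skew_mult_distribs)

text \<open>The left ideal \<open>R w + R f\<close> is some \<open>R g\<close>, so
  \<open>f = h g\<close>. A unit \<open>h\<close> would put \<open>w\<close> into
  \<open>R f\<close>; irreducibility therefore makes \<open>g\<close> a unit, and the ideal is all
  of \<open>R\<close>.\<close>

lemma simple_module:
  assumes w: "\<not> right_dvd f w"
  shows "\<exists>u. right_dvd f (u \<star> w - v)"
proof -
  define J where "J = {a \<star> w + b \<star> f | a b. True}"
  have "f = 0 \<star> w + 1 \<star> f" "w = 1 \<star> w + 0 \<star> f" by simp_all
  then have "f \<in> J" "w \<in> J" unfolding J_def by blast+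
  moreover have "u + v \<in> J" if uv: "u \<in> J" "v \<in> J" for u v
  proof -
    obtain a b where u: "u = a \<star> w + b \<star> f" using uv(1) by (auto simp: J_def)
    obtain a' b' where v: "v = a' \<star> w + b' \<star> f" using uv(2) by (auto simp: J_def)
    have "u + v = (a + a') \<star> w + (b + b') \<star> f" by (simp add: u v skew_mult_distribs)
    then show ?thesis unfolding J_def by blast
  qed
  moreover have "u \<star> v \<in> J" if v: "v \<in> J" for u v
  proof -
    obtain a b where v: "v = a \<star> w + b \<star> f" using v by (auto simp: J_def)
    have "u \<star> v = (u \<star> a) \<star> w + (u \<star> b) \<star> f" by (simp add: v skew_mult_distribs skew_mult_assoc)
    then show ?thesis unfolding J_def by blast
  qed
  ultimately obtain g where g: "lead_coeff g = 1" "g \<in> J" "J = {a. right_dvd g a}"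
    using left_ideal_principal[of J f] f_nz by metis
  obtain h where h: "f = h \<star> g" using g(3) \<open>f \<in> J\<close> by (auto simp: right_dvd_def)
  obtain q where q: "w = q \<star> g" using g(3) \<open>w \<in> J\<close> by (auto simp: right_dvd_def)
  have "\<not> (h \<noteq> 0 \<and> degree h = 0)"
  proof
    assume "h \<noteq> 0 \<and> degree h = 0"
    then obtain c where c: "h = [:c:]" "c \<noteq> 0" by (auto elim: degree_eq_zeroE)
    then have "g = [:inverse c:] \<star> f" by (simp add: h const_skew_mult)
    then show False using w q by (metis right_dvdI skew_mult_assoc)
  qed
  then have "degree g = 0"
    using f_irred h unfolding skew_irreducible_def Units_skew_poly_ring by blast
  then have "g = 1" using g(1) by (auto elim!: degree_eq_zeroE simp: one_pCons)
  then obtain a b where "1 = a \<star> w + b \<star> f" using g(2) by (auto simp: J_def)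
  then have "v = v \<star> (a \<star> w) + v \<star> (b \<star> f)" by (metis skew_mult_add_right skew_mult_one(2))
  then have "(v \<star> a) \<star> w - v = - ((v \<star> b) \<star> f)" by (simp add: skew_mult_assoc algebra_simps)
  then have "right_dvd f ((v \<star> a) \<star> w - v)" by (simp add: right_dvd_minus right_dvdI)
  then show ?thesis ..
qed

text \<open>By simplicity \<open>u \<mapsto> u w\<close> maps \<open>R\<close> onto
  \<open>R/Rf\<close>, so \<open>R/Rg\<close> and \<open>R/Rf\<close> are isomorphic
  \<open>L\<close>-spaces. The two injections below give the two inequalities; \<open>u0\<close>,
  with \<open>u0 w\<close> congruent to 1, provides the map back.\<close>

lemma annihilator:
  assumes w: "\<not> right_dvd f w"
  obtains g where "lead_coeff g = 1" "degree g = degree f"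
    "\<And>u. right_dvd f (u \<star> w) \<longleftrightarrow> right_dvd g u"
proof -
  define J where "J = {u. right_dvd f (u \<star> w)}"
  \<comment> \<open>A nonzero annihilator is available because \<open>P w = w P\<close> lies in
    \<open>R f\<close>.\<close>
  have "P \<in> J" using right_dvd_mult[OF f_dvd_P, of w] by (simp add: J_def P_central)
  obtain g where g: "lead_coeff g = 1" "J = {a. right_dvd g a}"
    by (rule left_ideal_principal[of J P])
       (use \<open>P \<in> J\<close> P_nz in \<open>auto simp: J_def skew_mult_add_left skew_mult_assoc right_dvd_add right_dvd_mult\<close>)
  have g0: "g \<noteq> 0" using g by auto
  have iff: "right_dvd f (u \<star> w) \<longleftrightarrow> right_dvd g u" for u using g(2) by (auto simp: J_def)
  obtain u0 where u0: "right_dvd f (u0 \<star> w - 1)" using simple_module[OF w] by blast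
  have "degree g \<le> degree f"
  proof (rule degree_le_of_inj_linear[where \<phi> = "\<lambda>u. rem_f (u \<star> w)"])
    fix u assume "u \<in> remainders g" "rem_f (u \<star> w) = 0"
    then show "u = 0" using right_dvd_remainder[of u g] iff[of u] by (simp add: skew_rmod_eq_0_iff)
  qed (simp_all add: skew_mult_add_left skew_rmod_add smult_skew_mult skew_rmod_smult skew_rmod_remainder)
  moreover have "degree f \<le> degree g"
  proof (rule degree_le_of_inj_linear[where \<phi> = "\<lambda>v. skew_rmod \<sigma> (v \<star> u0) g"])
    fix v assume v: "v \<in> remainders f" and "skew_rmod \<sigma> (v \<star> u0) g = 0"
    then have "right_dvd f (v \<star> (u0 \<star> w))"
      using iff[of "v \<star> u0"] by (simp add: skew_rmod_eq_0_iff[OF g0] skew_mult_assoc)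
    moreover have "right_dvd f (v \<star> (u0 \<star> w) - v)"
      using right_dvd_mult[OF u0, of v] by (simp add: skew_mult_distribs)
    ultimately have "right_dvd f v" by (simp add: right_dvd_diff_iff)
    then show "v = 0" using right_dvd_remainder[OF v] by simp
  qed (simp_all add: g0 skew_mult_add_left skew_rmod_add smult_skew_mult skew_rmod_smult skew_rmod_remainder)
  ultimately show ?thesis using that g iff by auto
qed

section \<open>Independence over the eigenring and density\<close>

text \<open>Vectors of \<open>V\<close> are represented by arbitrary polynomials and relations are
  read modulo \<open>R f\<close>. Reduction to remainders is postponed, so computations take place
  in the associative ring \<open>R\<close>.\<close>

definition comb :: "nat \<Rightarrow> (nat \<Rightarrow> 'l poly) \<Rightarrow> (nat \<Rightarrow> 'l poly) \<Rightarrow> 'l poly" where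
  "comb d v c = (\<Sum>i<d. v i \<star> c i)"

definition indep :: "nat \<Rightarrow> (nat \<Rightarrow> 'l poly) \<Rightarrow> bool" where
  "indep d v \<longleftrightarrow> (\<forall>c. (\<forall>i<d. c i \<in> D) \<and> right_dvd f (comb d v c) \<longrightarrow> (\<forall>i<d. c i = 0))"

definition spans :: "nat \<Rightarrow> (nat \<Rightarrow> 'l poly) \<Rightarrow> 'l poly \<Rightarrow> bool" where
  "spans d v b \<longleftrightarrow> (\<exists>c. (\<forall>i<d. c i \<in> D) \<and> right_dvd f (b - comb d v c))"

definition annihilates :: "nat \<Rightarrow> (nat \<Rightarrow> 'l poly) \<Rightarrow> 'l poly \<Rightarrow> bool" where
  "annihilates d v u \<longleftrightarrow> (\<forall>i<d. right_dvd f (u \<star> v i))"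

lemma indepD: "indep d v \<Longrightarrow> (\<And>i. i < d \<Longrightarrow> c i \<in> D) \<Longrightarrow> right_dvd f (comb d v c) \<Longrightarrow> i < d \<Longrightarrow> c i = 0"
  by (auto simp: indep_def)

lemma comb_Suc: "comb (Suc d) v c = comb d v c + v d \<star> c d"
  by (simp add: comb_def)

lemma comb_cong: "(\<And>i. i < d \<Longrightarrow> v i = v' i) \<Longrightarrow> (\<And>i. i < d \<Longrightarrow> c i = c' i) \<Longrightarrow> comb d v c = comb d v' c'"
  by (simp add: comb_def)

lemma annihilates_comb:
  assumes "annihilates d v u" "\<And>i. i < d \<Longrightarrow> c i \<in> D"
  shows "right_dvd f (u \<star> comb d v c)"
  unfolding comb_def skew_mult_sum_right
  using assms by (intro right_dvd_sum) (simp flip: skew_mult_assoc add: annihilates_def right_dvd_mult_D)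

lemma annihilates_spans:
  assumes "annihilates d v u" "spans d v b"
  shows "right_dvd f (u \<star> b)"
proof -
  obtain c where c: "\<forall>i<d. c i \<in> D" "right_dvd f (b - comb d v c)"
    using assms(2) by (auto simp: spans_def)
  then have "right_dvd f (u \<star> b - u \<star> comb d v c)"
    using right_dvd_mult[OF c(2), of u] by (simp add: skew_mult_distribs)
  then show ?thesis using annihilates_comb[OF assms(1)] c(1) by (simp add: right_dvd_diff_iff)
qed

lemma annihilates_mult: "annihilates d v u \<Longrightarrow> annihilates d v (a \<star> u)"
  by (simp add: annihilates_def skew_mult_assoc right_dvd_mult)

lemma annihilates_Suc: "annihilates (Suc d) v u \<longleftrightarrow> annihilates d v u \<and> right_dvd f (u \<star> v d)"
  by (auto simp: annihilates_def less_Suc_eq)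

lemma indep_Suc_imp: 
  assumes "indep (Suc d) v"
  shows "indep d v"
  unfolding indep_def
proof (intro allI impI, elim conjE)
  fix c i assume c: "\<forall>i<d. c i \<in> D" "right_dvd f (comb d v c)" and i: "i < d"
  have "comb (Suc d) v (c(d := 0)) = comb d v c"
    by (simp add: comb_Suc) (auto intro: comb_cong)
  then have "right_dvd f (comb (Suc d) v (c(d := 0)))" using c(2) by simp
  then have "(c(d := 0)) i = 0"
    by (rule indepD[OF assms, rotated]) (use c i in \<open>auto simp: less_Suc_eq\<close>)
  then show "c i = 0" using i by simp
qed

lemma indep_Suc_not_spans:
  assumes "indep (Suc d) v"
  shows "\<not> spans d v (v d)"
proof
  assume "spans d v (v d)"
  then obtain c where c: "\<forall>i<d. c i \<in> D" "right_dvd f (v d - comb d v c)" by (auto simp: spans_def)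
  have "comb (Suc d) v (c(d := - 1)) = comb d v c - v d"
    by (simp add: comb_Suc skew_mult_minus) (auto intro: comb_cong)
  then have "right_dvd f (comb (Suc d) v (c(d := - 1)))"
    using right_dvd_minus[OF c(2)] by simp
  then have "(c(d := - 1)) d = 0"
    by (rule indepD[OF assms, rotated]) (use c eigen_minus[OF eigen_one] in \<open>auto simp: less_Suc_eq\<close>)
  then show False by simp
qed

text \<open>
  Jacobson density in quantitative form. In the step, a vector killed by the annihilator of
  \<open>v 0, \<dots>, v d\<close> defines an endomorphism of the simple module, which is right multiplication by
  some \<open>c \<in> D\<close>.
\<close>
lemma density:
  assumes "indep d v"
  shows "(\<exists>g. lead_coeff g = 1 \<and> degree g = d * degree f \<and> (\<forall>u. annihilates d v u \<longleftrightarrow> right_dvd g u)) \<and>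
         (\<forall>b. (\<forall>u. annihilates d v u \<longrightarrow> right_dvd f (u \<star> b)) \<longrightarrow> spans d v b)"
  using assms
proof (induction d)
  case 0
  have "right_dvd 1 u" for u using right_dvdI[of 1 u] by simp
  moreover have "spans 0 v b" if "\<forall>u. annihilates 0 v u \<longrightarrow> right_dvd f (u \<star> b)" for b
    using that[rule_format, of 1] by (simp add: annihilates_def spans_def comb_def)
  ultimately show ?case by (auto intro!: exI[of _ 1] simp: annihilates_def)
next
  case (Suc d)
  note IH = Suc.IH[OF indep_Suc_imp[OF Suc.prems]]
  obtain g where g: "lead_coeff g = 1" "degree g = d * degree f"
    "\<And>u. annihilates d v u \<longleftrightarrow> right_dvd g u" using IH by blast
  have g0: "g \<noteq> 0" using g(1) by auto
  \<comment> \<open>If \<open>g\<close> also killed \<open>v d\<close>, the span half of the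
    induction hypothesis would make \<open>v d\<close> depend on its predecessors.\<close>
  have "\<not> right_dvd f (g \<star> v d)"
  proof
    assume *: "right_dvd f (g \<star> v d)"
    have "right_dvd f (u \<star> v d)" if u: "annihilates d v u" for u
    proof -
      obtain q where "u = q \<star> g" using u g(3)[of u] unfolding right_dvd_def by blast
      then show ?thesis using * by (simp add: skew_mult_assoc right_dvd_mult)
    qed
    then have "spans d v (v d)" using IH by blast
    then show False using indep_Suc_not_spans[OF Suc.prems] by simp
  qed
  then obtain g' where g': "lead_coeff g' = 1" "degree g' = degree f"
    "\<And>u. right_dvd f (u \<star> (g \<star> v d)) \<longleftrightarrow> right_dvd g' u" using annihilator by blast
  have g'0: "g' \<noteq> 0" using g'(1) by auto
  have ann: "annihilates (Suc d) v u \<longleftrightarrow> right_dvd (g' \<star> g) u" for u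
  proof
    assume "annihilates (Suc d) v u"
    then have u: "right_dvd g u" "right_dvd f (u \<star> v d)" by (auto simp: annihilates_Suc g(3))
    then obtain q where q: "u = q \<star> g" by (auto simp: right_dvd_def)
    then obtain q' where "q = q' \<star> g'" using u(2) g'(3) by (auto simp: skew_mult_assoc right_dvd_def)
    then show "right_dvd (g' \<star> g) u" using q by (simp add: skew_mult_assoc right_dvdI)
  next
    assume "right_dvd (g' \<star> g) u"
    then obtain q where q: "u = q \<star> (g' \<star> g)" by (auto simp: right_dvd_def)
    then have "right_dvd g u" by (metis right_dvdI skew_mult_assoc)
    moreover have "right_dvd f ((q \<star> g') \<star> (g \<star> v d))" using g'(3) right_dvdI by blast
    ultimately show "annihilates (Suc d) v u" by (simp add: annihilates_Suc g(3) q skew_mult_assoc)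
  qed
  obtain a where a: "right_dvd f (a \<star> (g \<star> v d) - 1)"
    using simple_module[OF \<open>\<not> right_dvd f (g \<star> v d)\<close>] by blast
  define u0 where "u0 = a \<star> g"
  have u0: "annihilates d v u0" "right_dvd f (u0 \<star> v d - 1)"
    using a by (simp_all add: u0_def g(3) right_dvdI skew_mult_assoc)
  have "spans (Suc d) v b" if b: "\<And>u. annihilates (Suc d) v u \<Longrightarrow> right_dvd f (u \<star> b)" for b
  proof -
    \<comment> \<open>The endomorphism sends \<open>u v_d\<close> to \<open>u b\<close> for
      \<open>u\<close> killing the earlier vectors. As \<open>u0 v_d\<close> represents 1, it must
      be right multiplication by the class of \<open>u0 b\<close>.\<close>
    define c where "c = rem_f (u0 \<star> b)"
    have "right_dvd f (f \<star> (u0 \<star> v d))"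
      using right_dvd_add[OF right_dvd_mult[OF u0(2), of f] right_dvdI[of f 1]]
      by (simp add: skew_mult_distribs)
    \<comment> \<open>Since \<open>f u0\<close> kills all vectors of the family it kills
      \<open>b\<close>, which says that \<open>f c\<close> lies in \<open>R f\<close>, so
      \<open>c\<close> is in the eigenring.\<close>
    then have "annihilates (Suc d) v (f \<star> u0)"
      by (simp add: annihilates_Suc annihilates_mult[OF u0(1)] skew_mult_assoc)
    from b[OF this] have c: "c \<in> D" unfolding c_def by (intro eigen_rem) (simp add: skew_mult_assoc)
    have "right_dvd f (u \<star> (b - v d \<star> c))" if u: "annihilates d v u" for u
    proof -
      \<comment> \<open>Subtracting a multiple of \<open>u0\<close> corrects \<open>u\<close> so
        that it kills \<open>v d\<close> as well; then \<open>b\<close> may be tested against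
        it.\<close>
      define u' where "u' = u - (u \<star> v d) \<star> u0"
      have "annihilates d v u'"
        using u annihilates_mult[OF u0(1), of "u \<star> v d"]
        by (simp add: u'_def annihilates_def skew_mult_diff_left right_dvd_diff)
      moreover have "u' \<star> v d = - ((u \<star> v d) \<star> (u0 \<star> v d - 1))"
        by (simp add: u'_def skew_mult_distribs skew_mult_assoc)
      ultimately have "annihilates (Suc d) v u'"
        using right_dvd_minus[OF right_dvd_mult[OF u0(2)]] by (simp add: annihilates_Suc)
      from b[OF this] have "right_dvd f (u \<star> b - (u \<star> v d) \<star> (u0 \<star> b))"
        by (simp add: u'_def skew_mult_distribs skew_mult_assoc)
      moreover have "right_dvd f ((u \<star> v d) \<star> (u0 \<star> b - c))"
        unfolding c_def by (intro right_dvd_mult rem_diff_dvd)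
      ultimately have "right_dvd f ((u \<star> b - (u \<star> v d) \<star> (u0 \<star> b)) + (u \<star> v d) \<star> (u0 \<star> b - c))"
        by (rule right_dvd_add)
      then show ?thesis by (simp add: skew_mult_distribs skew_mult_assoc)
    qed
    then have "spans d v (b - v d \<star> c)" using IH by blast
    then obtain e where e: "\<forall>i<d. e i \<in> D" "right_dvd f (b - v d \<star> c - comb d v e)"
      by (auto simp: spans_def)
    have "comb (Suc d) v (e(d := c)) = comb d v e + v d \<star> c"
      by (simp add: comb_Suc) (auto intro: comb_cong)
    then have "right_dvd f (b - comb (Suc d) v (e(d := c)))" using e(2) by (simp add: algebra_simps)
    then show ?thesis unfolding spans_def using e(1) c by (intro exI[of _ "e(d := c)"]) (auto simp: less_Suc_eq)
  qed
  moreover have "lead_coeff (g' \<star> g) = 1" "degree (g' \<star> g) = Suc d * degree f"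
    using g(1,2) g'(1,2) lead_coeff_skew_mult[OF g'0 g0] by (simp_all add: degree_skew_mult[OF g'0 g0])
  ultimately show ?case using ann by blast
qed

lemma annihilator_generator:
  assumes "indep d v"
  obtains g where "lead_coeff g = 1" "degree g = d * degree f"
    "\<And>u. annihilates d v u \<longleftrightarrow> right_dvd g u"
  using density[OF assms] by blast

lemma spans_of_annihilators:
  "indep d v \<Longrightarrow> (\<And>u. annihilates d v u \<Longrightarrow> right_dvd f (u \<star> b)) \<Longrightarrow> spans d v b"
  using density by blast

lemma annihilator_unit:
  assumes "indep d v" "\<not> spans d v b"
  obtains u where "annihilates d v u" "right_dvd f (u \<star> b - 1)"
proof -
  obtain u where u: "annihilates d v u" "\<not> right_dvd f (u \<star> b)"
    using spans_of_annihilators[OF assms(1)] assms(2) by blast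
  obtain a where "right_dvd f (a \<star> (u \<star> b) - 1)" using simple_module[OF u(2)] by blast
  then show ?thesis using that[of "a \<star> u"] annihilates_mult[OF u(1)] by (simp add: skew_mult_assoc)
qed

text \<open>Newton interpolation: the value at a new vector is corrected by a multiple of a
  polynomial that kills the earlier vectors. It yields surjectivity onto the endomorphism
  ring.\<close>

lemma interpolation:
  assumes "indep d v"
  shows "\<exists>u. \<forall>i<d. right_dvd f (u \<star> v i - t i)"
  using assms
proof (induction d)
  case 0
  then show ?case by simp
next
  case (Suc d)
  note ind = indep_Suc_imp[OF Suc.prems]
  obtain u where u: "\<And>i. i < d \<Longrightarrow> right_dvd f (u \<star> v i - t i)" using Suc.IH[OF ind] by blast
  obtain u0 where u0: "annihilates d v u0" "right_dvd f (u0 \<star> v d - 1)"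
    using annihilator_unit[OF ind indep_Suc_not_spans[OF Suc.prems]] by blast
  define a where "a = t d - u \<star> v d"
  have "right_dvd f ((u + a \<star> u0) \<star> v i - t i)" if i: "i < Suc d" for i
  proof (cases "i = d")
    case True
    have "(u + a \<star> u0) \<star> v d - t d = a \<star> (u0 \<star> v d - 1)"
      by (simp add: a_def skew_mult_distribs skew_mult_assoc)
    then show ?thesis using True right_dvd_mult[OF u0(2)] by simp
  next
    case False
    then have i: "i < d" using i by simp
    have "(u + a \<star> u0) \<star> v i - t i = (u \<star> v i - t i) + a \<star> (u0 \<star> v i)"
      by (simp add: skew_mult_distribs skew_mult_assoc)
    moreover have "right_dvd f (a \<star> (u0 \<star> v i))" using u0(1) i by (simp add: annihilates_def right_dvd_mult)
    ultimately show ?thesis using right_dvd_add[OF u[OF i]] by metis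
  qed
  then show ?case by blast
qed

text \<open>\<open>P\<close> kills every vector, so the annihilator generator of the family divides
  it on the right. This a priori bound makes the extension to a basis terminate.\<close>

lemma indep_degree_le:
  assumes "indep d v"
  shows "d * degree f \<le> degree P"
proof -
  obtain g where g: "lead_coeff g = 1" "degree g = d * degree f"
    "\<And>u. annihilates d v u \<longleftrightarrow> right_dvd g u" using annihilator_generator[OF assms] by blast
  have "annihilates d v P"
    by (simp add: annihilates_def P_central right_dvd_mult f_dvd_P)
  then have "right_dvd g P" using g(3) by simp
  then show ?thesis using right_dvd_degree P_nz g(2) by metis
qed

lemma indep_extend:
  assumes "indep d v" "\<not> spans d v b"
  shows "indep (Suc d) (v(d := b))"
  unfolding indep_def
proof (intro allI impI, elim conjE)
  fix c i assume c: "\<forall>i<Suc d. c i \<in> D" "right_dvd f (comb (Suc d) (v(d := b)) c)" and i: "i < Suc d"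
  have comb: "comb (Suc d) (v(d := b)) c = comb d v c + b \<star> c d"
    unfolding comb_Suc by (auto intro: comb_cong)
  \<comment> \<open>Applying this \<open>u\<close> to a relation isolates the coefficient of the new
    vector.\<close>
  obtain u where u: "annihilates d v u" "right_dvd f (u \<star> b - 1)"
    using annihilator_unit[OF assms] by blast
  have "right_dvd f (u \<star> comb d v c)" using annihilates_comb[OF u(1)] c(1) by simp
  moreover have "right_dvd f (u \<star> (comb d v c + b \<star> c d))" using c(2) comb right_dvd_mult by metis
  ultimately have "right_dvd f (u \<star> (b \<star> c d))"
    using right_dvd_diff by (fastforce simp: skew_mult_add_right)
  moreover have "right_dvd f (u \<star> (b \<star> c d) - c d)"
    using right_dvd_mult_D[OF u(2), of "c d"] c(1) by (simp add: skew_mult_distribs skew_mult_assoc)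
  ultimately have "right_dvd f (c d)" by (simp add: right_dvd_diff_iff)
  then have cd: "c d = 0" using right_dvd_remainder eigen_remainder c(1) by blast
  then have "right_dvd f (comb d v c)" using c(2) comb by simp
  then have "c i = 0" if "i < d" for i using indepD[OF assms(1)] c(1) that by simp
  then show "c i = 0" using i cd by (cases "i = d") auto
qed

lemma exists_basis_extending:
  assumes "indep d v" "\<And>i. i < d \<Longrightarrow> v i \<in> W"
  shows "\<exists>d' v'. d \<le> d' \<and> indep d' v' \<and> (\<forall>i<d. v' i = v i) \<and> (\<forall>i<d'. v' i \<in> W) \<and> (\<forall>b\<in>W. spans d' v' b)"
  using assms
proof (induction "degree P - d" arbitrary: d v rule: less_induct)
  case less
  show ?case
  proof (cases "\<forall>b\<in>W. spans d v b")
    case True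
    then show ?thesis using less.prems by blast
  next
    case False
    then obtain b where b: "b \<in> W" "\<not> spans d v b" by blast
    note ind = indep_extend[OF less.prems(1) b(2)]
    \<comment> \<open>An independent family has at most \<open>degree P\<close> members, so the
      truncated difference in the measure really drops.\<close>
    have "Suc d * 1 \<le> Suc d * degree f" using degree_f_pos by (intro mult_le_mono2) simp
    also have "\<dots> \<le> degree P" by (rule indep_degree_le[OF ind])
    finally have "degree P - Suc d < degree P - d" by simp
    moreover have "(v(d := b)) i \<in> W" if "i < Suc d" for i
      using b(1) less.prems(2) that by (auto simp: less_Suc_eq)
    ultimately have "\<exists>d' v'. Suc d \<le> d' \<and> indep d' v' \<and> (\<forall>i<Suc d. v' i = (v(d := b)) i) \<and>
        (\<forall>i<d'. v' i \<in> W) \<and> (\<forall>b\<in>W. spans d' v' b)"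
      using less.hyps[OF _ ind] by blast
    then obtain d' v' where v': "Suc d \<le> d'" "indep d' v'"
      "\<forall>i<Suc d. v' i = (v(d := b)) i" "\<forall>i<d'. v' i \<in> W" "\<forall>b\<in>W. spans d' v' b"
      by blast
    then show ?thesis by (intro exI[of _ d'] exI[of _ v']) auto
  qed
qed

text \<open>Whatever kills a basis kills \<open>V\<close>, so by faithfulness the generator of its
  annihilator is a multiple of \<open>P\<close>.\<close>

lemma basis_degree:
  assumes "indep d v" "\<forall>b\<in>remainders f. spans d v b"
  shows "d * degree f = degree P"
proof (rule antisym[OF indep_degree_le[OF assms(1)]])
  obtain g where g: "lead_coeff g = 1" "degree g = d * degree f"
    "\<And>u. annihilates d v u \<longleftrightarrow> right_dvd g u" using annihilator_generator[OF assms(1)] by blast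
  have "annihilates d v g" using g(3) right_dvdI[of g 1] by simp
  have "right_dvd P g"
  proof (rule faithful)
    fix b
    have "right_dvd f (g \<star> rem_f b)"
      using annihilates_spans[OF \<open>annihilates d v g\<close>] assms(2) skew_rmod_remainder by simp
    moreover have "right_dvd f (g \<star> b - g \<star> rem_f b)"
      using right_dvd_mult[OF rem_diff_dvd, of g b] by (simp add: skew_mult_distribs)
    ultimately show "right_dvd f (g \<star> b)" by (simp add: right_dvd_diff_iff)
  qed
  then show "degree P \<le> d * degree f" using right_dvd_degree[of P g] g(1,2) by force
qed

lemma right_dvd_antisym_degree:
  "right_dvd a b \<Longrightarrow> right_dvd b a \<Longrightarrow> a \<noteq> 0 \<Longrightarrow> b \<noteq> 0 \<Longrightarrow> degree a = degree b"
  by (meson antisym right_dvd_degree)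

lemma eigen_comb_eq: "eigen_comb \<sigma> f d v c = rem_f (comb d v c)"
  by (simp add: eigen_comb_def comb_def skew_rmod_sum)

lemma eigen_dimI:
  assumes "\<And>i. i < d \<Longrightarrow> v i \<in> remainders f" "indep d v"
    "W = {rem_f (comb d v c) | c. \<forall>i<d. c i \<in> D}"
  shows "eigen_dim \<sigma> f W d"
  unfolding eigen_dim_def eigen_comb_eq
  using assms by (intro exI[of _ v]) (auto simp: indep_def skew_rmod_eq_0_iff)

text \<open>The left annihilator of \<open>W\<close> depends on \<open>W\<close> alone, and its
  monic generator has degree \<open>d * degree f\<close> for every basis with \<open>d\<close>
  elements.\<close>

lemma eigen_dim_unique:
  assumes "eigen_dim \<sigma> f W d" "eigen_dim \<sigma> f W d'"
  shows "d = d'"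
proof -
  have gen: "\<exists>g. lead_coeff g = 1 \<and> degree g = d * degree f \<and> (\<forall>u. (\<forall>b\<in>W. right_dvd f (u \<star> b)) \<longleftrightarrow> right_dvd g u)"
    if W: "eigen_dim \<sigma> f W d" for d
  proof -
    obtain v where v: "\<forall>i<d. v i \<in> remainders f" "W = {rem_f (comb d v c) | c. \<forall>i<d. c i \<in> D}"
      "indep d v"
      using W by (auto simp: eigen_dim_def eigen_comb_eq indep_def skew_rmod_eq_0_iff)
    obtain g where g: "lead_coeff g = 1" "degree g = d * degree f"
      "\<And>u. annihilates d v u \<longleftrightarrow> right_dvd g u" using annihilator_generator[OF v(3)] by blast
    have "(\<forall>b\<in>W. right_dvd f (u \<star> b)) \<longleftrightarrow> annihilates d v u" for u
    proof
      assume *: "\<forall>b\<in>W. right_dvd f (u \<star> b)"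
      show "annihilates d v u"
        unfolding annihilates_def
      proof (intro allI impI)
        fix i assume i: "i < d"
        have "comb d v (\<lambda>j. if j = i then 1 else 0) = (\<Sum>j<d. if j = i then v i else 0)"
          unfolding comb_def by (rule sum.cong) auto
        then have "comb d v (\<lambda>j. if j = i then 1 else 0) = v i" using i by (simp add: sum.delta)
        then have "rem_f (v i) \<in> W"
          unfolding v(2) using eigen_one by (auto intro!: exI[of _ "\<lambda>j. if j = i then 1 else 0"])
        then show "right_dvd f (u \<star> v i)" using * v(1) i by (simp add: skew_rmod_self)
      qed
    next
      assume *: "annihilates d v u"
      have "spans d v b" if b: "b \<in> W" for b
      proof -
        obtain c where c: "b = rem_f (comb d v c)" "\<forall>i<d. c i \<in> D" using b v(2) by auto
        have "right_dvd f (b - comb d v c)"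
          using right_dvd_minus[OF rem_diff_dvd[of "comb d v c"]] by (simp add: c(1))
        then show ?thesis using c(2) by (auto simp: spans_def)
      qed
      then show "\<forall>b\<in>W. right_dvd f (u \<star> b)" using annihilates_spans[OF *] by blast
    qed
    then show ?thesis using g by (intro exI[of _ g]) auto
  qed
  obtain g where g: "lead_coeff g = 1" "degree g = d * degree f"
    "\<And>u. (\<forall>b\<in>W. right_dvd f (u \<star> b)) \<longleftrightarrow> right_dvd g u" using gen[OF assms(1)] by blast
  obtain g' where g': "lead_coeff g' = 1" "degree g' = d' * degree f"
    "\<And>u. (\<forall>b\<in>W. right_dvd f (u \<star> b)) \<longleftrightarrow> right_dvd g' u" using gen[OF assms(2)] by blast
  have "right_dvd g g'" "right_dvd g' g"
    using g(3) g'(3) right_dvdI[of g 1] right_dvdI[of g' 1] by auto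
  then have "degree g = degree g'"
    using g(1) g'(1) by (intro right_dvd_antisym_degree) auto
  then show ?thesis using g(2) g'(2) degree_f_pos by simp
qed

section \<open>Rank and nullity\<close>

definition image_of :: "'l poly \<Rightarrow> 'l poly set" where
  "image_of u = {rem_f (u \<star> b) | b. b \<in> remainders f}"

lemma comb_add_split:
  "comb (d + r) v c = comb d v c + comb r (\<lambda>i. v (d + i)) (\<lambda>i. c (d + i))"
  by (induction r) (simp_all add: comb_Suc algebra_simps, simp add: comb_def)

text \<open>The given kernel vectors extend to a basis of the kernel and then of \<open>V\<close>;
  the images of the added vectors form a basis of the image. Prescribing \<open>v0\<close> gives the
  caller a lower bound on the nullity.\<close>

lemma rank_nullity:
  assumes basis: "\<And>d v. indep d v \<Longrightarrow> (\<forall>b\<in>remainders f. spans d v b) \<Longrightarrow> d = m"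
    and v0: "indep d0 v0" "\<And>i. i < d0 \<Longrightarrow> v0 i \<in> remainders f" "annihilates d0 v0 u"
  obtains d v where "d0 \<le> d" "d \<le> m" "indep d v" "\<forall>i<d. v i \<in> remainders f" "annihilates d v u"
    "eigen_dim \<sigma> f (image_of u) (m - d)"
proof -
  define W where "W = {b \<in> remainders f. right_dvd f (u \<star> b)}"
  have "\<And>i. i < d0 \<Longrightarrow> v0 i \<in> W" using v0 by (simp add: W_def annihilates_def)
  from exists_basis_extending[OF v0(1) this] obtain d v where v: "d0 \<le> d" "indep d v"
    "\<forall>i<d. v i \<in> W" "\<forall>b\<in>W. spans d v b" by blast
  have vW: "\<And>i. i < d \<Longrightarrow> v i \<in> remainders f" using v(3) by (simp add: W_def)
  from exists_basis_extending[OF v(2) vW] obtain m' v' where v': "d \<le> m'" "indep m' v'"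
    "\<forall>i<d. v' i = v i" "\<forall>i<m'. v' i \<in> remainders f" "\<forall>b\<in>remainders f. spans m' v' b" by blast
  have m': "m' = m" using basis v' by blast
  have dm: "d + (m - d) = m" using v'(1) m' by simp
  have ann: "annihilates d v u" using v(3) by (simp add: annihilates_def W_def)
  define w where "w i = rem_f (u \<star> v' (d + i))" for i
  have comb_w: "rem_f (comb r w c) = rem_f (u \<star> comb r (\<lambda>i. v' (d + i)) c)" if "\<forall>i<r. c i \<in> D" for c r
    using that by (simp add: comb_def w_def skew_mult_sum_right skew_rmod_sum rem_mult_rem_left flip: skew_mult_assoc)
  have ind: "indep (m - d) w"
    unfolding indep_def
  proof (intro allI impI, elim conjE)
    fix c i assume c: "\<forall>i<m - d. c i \<in> D" "right_dvd f (comb (m - d) w c)" and i: "i < m - d"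
    define b where "b = comb (m - d) (\<lambda>i. v' (d + i)) c"
    have "right_dvd f (u \<star> b)"
      using c(2) comb_w[OF c(1)] by (metis b_def f_nz skew_rmod_eq_0_iff)
    moreover have "rem_f (u \<star> rem_f b) = rem_f (u \<star> b)" by (rule rem_mult_rem_right)
    ultimately have "rem_f b \<in> W"
      by (metis (mono_tags, lifting) W_def f_nz mem_Collect_eq skew_rmod_eq_0_iff skew_rmod_remainder)
    then obtain e where e: "\<forall>i<d. e i \<in> D" "right_dvd f (rem_f b - comb d v e)"
      using v(4) by (auto simp: spans_def)
    have "right_dvd f (b - comb d v e)"
      using right_dvd_add[OF rem_diff_dvd[of b] e(2)] by simp
    \<comment> \<open>A relation among images puts \<open>b\<close> into the kernel, so
      \<open>b\<close> is also a combination of the kernel basis. The difference of the two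
      expressions is a relation among the whole basis \<open>v'\<close>.\<close>
    define c' where "c' i = (if i < d then - e i else c (i - d))" for i
    have "comb (d + (m - d)) v' c' = b - comb d v e"
      unfolding comb_add_split using v'(3)
      by (auto simp: comb_def b_def c'_def skew_mult_minus sum_negf)
    then have "right_dvd f (comb m v' c')" using \<open>right_dvd f (b - comb d v e)\<close> dm by simp
    moreover have "c' i \<in> D" if "i < m" for i
      using that c(1) e(1) by (auto simp: c'_def eigen_minus)
    ultimately have "c' (d + i) = 0" using v'(2) m' i by (intro indepD[of m v' c']) auto
    then show "c i = 0" by (simp add: c'_def)
  qed
  have "image_of u = {rem_f (comb (m - d) w c) | c. \<forall>i<m - d. c i \<in> D}"
  proof (intro equalityI subsetI)
    fix x assume "x \<in> image_of u"
    then obtain b where b: "b \<in> remainders f" "x = rem_f (u \<star> b)" by (auto simp: image_of_def)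
    then obtain c where c: "\<forall>i<m. c i \<in> D" "right_dvd f (b - comb m v' c)"
      using v'(5) m' by (auto simp: spans_def)
    have split: "comb m v' c = comb d v c + comb (m - d) (\<lambda>i. v' (d + i)) (\<lambda>i. c (d + i))"
      using comb_add_split[of d "m - d" v' c] v'(3) dm by (simp add: comb_def)
    have "right_dvd f (u \<star> comb d v c)"
      using annihilates_comb[OF ann] c(1) v'(1) m' by simp
    then have "right_dvd f (u \<star> (b - comb m v' c) + u \<star> comb d v c)"
      using right_dvd_mult[OF c(2)] right_dvd_add by blast
    then have "right_dvd f (u \<star> b - u \<star> comb (m - d) (\<lambda>i. v' (d + i)) (\<lambda>i. c (d + i)))"
      by (simp add: split skew_mult_distribs algebra_simps)
    then have "x = rem_f (comb (m - d) w (\<lambda>i. c (d + i)))"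
      using comb_w[of "m - d" "\<lambda>i. c (d + i)"] c(1) b(2) by (simp add: rem_cong)
    then show "x \<in> {rem_f (comb (m - d) w c) | c. \<forall>i<m - d. c i \<in> D}"
      using c(1) by (intro CollectI exI[of _ "\<lambda>i. c (d + i)"]) auto
  next
    fix x assume "x \<in> {rem_f (comb (m - d) w c) | c. \<forall>i<m - d. c i \<in> D}"
    then obtain c where c: "x = rem_f (comb (m - d) w c)" "\<forall>i<m - d. c i \<in> D" by blast
    then have "x = rem_f (u \<star> rem_f (comb (m - d) (\<lambda>i. v' (d + i)) c))"
      by (simp add: comb_w rem_mult_rem_right)
    then show "x \<in> image_of u" unfolding image_of_def using skew_rmod_remainder[OF f_nz] by blast
  qed
  then have "eigen_dim \<sigma> f (image_of u) (m - d)"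
    using ind by (intro eigen_dimI[of _ w]) (simp_all add: w_def skew_rmod_remainder)
  then show ?thesis using that[of d v] v(1,2) v'(1) m' vW ann by blast
qed

end

section \<open>The reduced norm\<close>

locale cyclic_skew_poly = skew_poly \<sigma> for \<sigma> :: "'l::field \<Rightarrow> 'l" +
  fixes n :: nat
  assumes n_pos: "n > 0"
    and order: "\<sigma> ^^ i = id \<longleftrightarrow> n dvd i"
begin

lemma funpow_dvd: "n dvd i \<Longrightarrow> (\<sigma> ^^ i) a = a"
  using order[of i] by simp

lemma funpow_cong_mod: "i mod n = j mod n \<Longrightarrow> (\<sigma> ^^ i) a = (\<sigma> ^^ j) a"
proof -
  have "(\<sigma> ^^ i) a = (\<sigma> ^^ (i mod n)) a" for i
  proof -
    have "(\<sigma> ^^ (i mod n + i div n * n)) a = (\<sigma> ^^ (i mod n)) a"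
      by (simp only: funpow_add comp_apply) (simp add: funpow_dvd)
    then show ?thesis by simp
  qed
  then show "i mod n = j mod n \<Longrightarrow> (\<sigma> ^^ i) a = (\<sigma> ^^ j) a" by metis
qed

lemma funpow_fixed: "\<sigma> a = a \<Longrightarrow> (\<sigma> ^^ i) a = a"
  by (induction i) auto

text \<open>This is \<open>K[x^n]\<close> for \<open>K\<close> the fixed field of
  \<open>\<sigma>\<close>, the centre of \<open>R\<close>. Describing it by coefficients shows that
  products with such a factor coincide with ordinary polynomial products, so commutative arithmetic
  applies to them.\<close>

definition central :: "'l poly set" where
  "central = {p. (\<forall>k. \<sigma> (coeff p k) = coeff p k) \<and> (\<forall>k. coeff p k \<noteq> 0 \<longrightarrow> n dvd k)}"

lemma centralD: "p \<in> central \<Longrightarrow> \<sigma> (coeff p k) = coeff p k" "p \<in> central \<Longrightarrow> coeff p k \<noteq> 0 \<Longrightarrow> n dvd k"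
  by (auto simp: central_def)

lemma skew_mult_central_right:
  assumes "p \<in> central"
  shows "q \<star> p = q * p"
  using assms by (intro poly_eqI) (simp add: coeff_skew_mult coeff_mult centralD funpow_fixed)

lemma skew_mult_central_left:
  assumes "p \<in> central"
  shows "p \<star> q = p * q"
proof (rule poly_eqI)
  fix k
  have "coeff p i * (\<sigma> ^^ i) a = coeff p i * a" for i a
    using centralD(2)[OF assms, of i] by (cases "coeff p i = 0") (auto simp: funpow_dvd)
  then show "coeff (p \<star> q) k = coeff (p * q) k" unfolding coeff_skew_mult coeff_mult by (intro sum.cong refl)
qed

lemma central_commute: "p \<in> central \<Longrightarrow> p \<star> q = q \<star> p"
  by (simp add: skew_mult_central_left skew_mult_central_right mult.commute)

lemma \<sigma>_sum: "\<sigma> (sum g A) = (\<Sum>x\<in>A. \<sigma> (g x))"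
  using funpow_sum[of 1 g A] by simp

lemma \<sigma>_minus: "\<sigma> (- a) = - \<sigma> a"
  using funpow_minus[of 1 a] by simp

lemma central_mult:
  assumes "p \<in> central" "q \<in> central"
  shows "p * q \<in> central"
  unfolding central_def
proof (intro CollectI conjI allI impI)
  fix k
  show "\<sigma> (coeff (p * q) k) = coeff (p * q) k"
    by (simp add: coeff_mult \<sigma>_sum \<sigma>_mult centralD assms)
  assume "coeff (p * q) k \<noteq> 0"
  then obtain i where i: "i \<le> k" "coeff p i * coeff q (k - i) \<noteq> 0"
    unfolding coeff_mult by (meson atMost_iff sum.neutral)
  then have "n dvd i" "n dvd k - i" using centralD(2) assms by auto
  then have "n dvd i + (k - i)" by (rule dvd_add)
  then show "n dvd k" using i(1) by simp
qed

lemma central_add: "p \<in> central \<Longrightarrow> q \<in> central \<Longrightarrow> p + q \<in> central"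
  by (auto simp: central_def \<sigma>_add) (metis add_cancel_right_left)

lemma central_minus: "p \<in> central \<Longrightarrow> - p \<in> central"
  by (auto simp: central_def \<sigma>_minus)

lemma central_diff: "p \<in> central \<Longrightarrow> q \<in> central \<Longrightarrow> p - q \<in> central"
  using central_add[of p "- q"] central_minus[of q] by simp

lemma central_zero [simp]: "0 \<in> central"
  by (simp add: central_def)

lemma central_monom: "\<sigma> c = c \<Longrightarrow> n dvd d \<Longrightarrow> monom c d \<in> central"
  by (auto simp: central_def)

lemma central_one [simp]: "1 \<in> central"
  using central_monom[of 1 0] by (simp add: \<sigma>_one)

lemma central_smult: "\<sigma> c = c \<Longrightarrow> p \<in> central \<Longrightarrow> smult c p \<in> central"
  by (auto simp: central_def \<sigma>_mult)

lemma degree_central: "p \<in> central \<Longrightarrow> p \<noteq> 0 \<Longrightarrow> n dvd degree p"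
  by (simp add: centralD)

lemma \<sigma>_inverse: "\<sigma> (inverse c) = inverse (\<sigma> c)"
proof (cases "c = 0")
  case False
  then have "\<sigma> c * \<sigma> (inverse c) = 1" by (simp flip: \<sigma>_mult add: \<sigma>_one)
  then show ?thesis by (metis inverse_unique)
qed simp

text \<open>
  The matrix of right multiplication by \<open>g\<close> on the basis \<open>1, x, \<dots>, x\<^sup>n\<^sup>-\<^sup>1\<close> over
  \<open>L[x\<^sup>n]\<close>, conjugated by the diagonal matrix with entries \<open>z\<^sup>i\<close>, where \<open>z\<^sup>n = x\<^sup>n\<close>.
\<close>
definition red_mat :: "'l poly \<Rightarrow> 'l poly mat" where
  "red_mat g = mat n n (\<lambda>(i, j). \<Sum>k\<le>degree g. if (i + k) mod n = j then monom ((\<sigma> ^^ i) (coeff g k)) k else 0)"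

lemma red_mat_carrier [simp]: "red_mat g \<in> carrier_mat n n" "dim_row (red_mat g) = n" "dim_col (red_mat g) = n"
  by (simp_all add: red_mat_def)

lemma coeff_red_mat:
  assumes "i < n" "j < n"
  shows "coeff (red_mat g $$ (i, j)) k = (if (i + k) mod n = j then (\<sigma> ^^ i) (coeff g k) else 0)"
proof -
  have "coeff (red_mat g $$ (i, j)) k
    = (\<Sum>k'\<le>degree g. if k' = k then (if (i + k) mod n = j then (\<sigma> ^^ i) (coeff g k) else 0) else 0)"
    using assms unfolding red_mat_def index_mat(1)[OF assms] split coeff_sum by (intro sum.cong) auto
  then show ?thesis by (auto simp: sum.delta coeff_eq_0)
qed

text \<open>Row \<open>i\<close> holds the coordinates of \<open>x^i g\<close>, and
  \<open>x^i (g h) = (x^i g) h\<close>.\<close>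

lemma red_mat_mult: "red_mat (g \<star> h) = red_mat g * red_mat h"
proof (rule eq_matI)
  fix i j assume "i < dim_row (red_mat g * red_mat h)" "j < dim_col (red_mat g * red_mat h)"
  then have ij: "i < n" "j < n" by auto
  show "red_mat (g \<star> h) $$ (i, j) = (red_mat g * red_mat h) $$ (i, j)"
  proof (rule poly_eqI)
    fix k
    have "coeff ((red_mat g * red_mat h) $$ (i, j)) k
      = (\<Sum>p<n. \<Sum>u\<le>k. coeff (red_mat g $$ (i, p)) u * coeff (red_mat h $$ (p, j)) (k - u))"
      using ij by (simp add: scalar_prod_def coeff_sum coeff_mult atLeast0LessThan)
    also have "\<dots> = (\<Sum>p<n. \<Sum>u\<le>k. if (i + u) mod n = p then (if (p + (k - u)) mod n = j
        then (\<sigma> ^^ i) (coeff g u) * (\<sigma> ^^ p) (coeff h (k - u)) else 0) else 0)"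
      using ij by (intro sum.cong refl) (auto simp: coeff_red_mat)
    also have "\<dots> = (\<Sum>u\<le>k. \<Sum>p<n. if (i + u) mod n = p then (if (p + (k - u)) mod n = j
        then (\<sigma> ^^ i) (coeff g u) * (\<sigma> ^^ p) (coeff h (k - u)) else 0) else 0)"
      by (rule sum.swap)
    \<comment> \<open>An exponent \<open>u\<close> in row \<open>i\<close> of the first factor
      occurs in one column only, so the middle index \<open>p\<close> is determined by
      \<open>u\<close>.\<close>
    also have "\<dots> = (\<Sum>u\<le>k. if ((i + u) mod n + (k - u)) mod n = j
        then (\<sigma> ^^ i) (coeff g u) * (\<sigma> ^^ ((i + u) mod n)) (coeff h (k - u)) else 0)"
      using n_pos by (intro sum.cong refl) (simp add: sum.delta)
    also have "\<dots> = (\<Sum>u\<le>k. if (i + k) mod n = j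
        then (\<sigma> ^^ i) (coeff g u * (\<sigma> ^^ u) (coeff h (k - u))) else 0)"
    proof (intro sum.cong refl)
      fix u assume "u \<in> {..k}"
      then have "((i + u) mod n + (k - u)) mod n = (i + k) mod n"
        using mod_add_left_eq[of "i + u" n "k - u"] by simp
      moreover have "(\<sigma> ^^ ((i + u) mod n)) a = (\<sigma> ^^ i) ((\<sigma> ^^ u) a)" for a
        using funpow_cong_mod[of "(i + u) mod n" "i + u" a] by (simp add: funpow_add)
      ultimately show "(if ((i + u) mod n + (k - u)) mod n = j
          then (\<sigma> ^^ i) (coeff g u) * (\<sigma> ^^ ((i + u) mod n)) (coeff h (k - u)) else 0)
        = (if (i + k) mod n = j then (\<sigma> ^^ i) (coeff g u * (\<sigma> ^^ u) (coeff h (k - u))) else 0)"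
        by (simp add: funpow_mult')
    qed
    also have "\<dots> = coeff (red_mat (g \<star> h) $$ (i, j)) k"
      using ij by (simp add: coeff_red_mat coeff_skew_mult funpow_sum)
    finally show "coeff (red_mat (g \<star> h) $$ (i, j)) k = coeff ((red_mat g * red_mat h) $$ (i, j)) k" ..
  qed
qed auto

definition red_norm :: "'l poly \<Rightarrow> 'l poly" where
  "red_norm g = det (red_mat g)"

lemma red_norm_mult: "red_norm (g \<star> h) = red_norm g * red_norm h"
  unfolding red_norm_def red_mat_mult by (rule det_mult) auto

lemma red_norm_central:
  assumes "p \<in> central"
  shows "red_norm p = p ^ n"
proof -
  have "red_mat p = p \<cdot>\<^sub>m 1\<^sub>m n"
  proof (rule eq_matI)
    fix i j assume "i < dim_row (p \<cdot>\<^sub>m 1\<^sub>m n)" "j < dim_col (p \<cdot>\<^sub>m 1\<^sub>m n)"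
    then have ij: "i < n" "j < n" by auto
    show "red_mat p $$ (i, j) = (p \<cdot>\<^sub>m 1\<^sub>m n) $$ (i, j)"
    proof (rule poly_eqI)
      fix k
      show "coeff (red_mat p $$ (i, j)) k = coeff ((p \<cdot>\<^sub>m 1\<^sub>m n) $$ (i, j)) k"
      proof (cases "coeff p k = 0")
        case False
        then have "(i + k) mod n = i" using centralD(2)[OF assms False] ij by (metis dvd_eq_mod_eq_0 add.right_neutral mod_add_right_eq mod_less)
        then show ?thesis using ij assms by (auto simp: coeff_red_mat funpow_fixed centralD)
      qed (use ij in \<open>auto simp: coeff_red_mat\<close>)
    qed
  qed auto
  then show ?thesis by (simp add: red_norm_def)
qed

text \<open>At \<open>x = 0\<close> only constant terms survive, and they sit on the diagonal as the
  conjugates of the constant coefficient. This links the reduced norm to the field norm.\<close>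

lemma coeff_red_norm_0: "coeff (red_norm g) 0 = (\<Prod>i<n. (\<sigma> ^^ i) (coeff g 0))"
proof -
  interpret h: comm_ring_hom "\<lambda>p :: 'l poly. poly p 0" by unfold_locales auto
  have "poly (red_norm g) 0 = det (map_mat (\<lambda>p. poly p 0) (red_mat g))"
    by (simp add: red_norm_def)
  also have "\<dots> = prod_list (diag_mat (map_mat (\<lambda>p. poly p 0) (red_mat g)))"
    by (rule det_upper_triangular[where n = n])
       (auto intro!: upper_triangularI simp: poly_0_coeff_0 coeff_red_mat)
  also have "\<dots> = (\<Prod>i<n. (\<sigma> ^^ i) (coeff g 0))"
    by (simp add: prod_list_diag_prod poly_0_coeff_0 coeff_red_mat atLeast0LessThan)
  finally show ?thesis by (simp add: poly_0_coeff_0)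
qed

lemma degree_red_norm_le: "degree (red_norm g) \<le> degree g * n"
  unfolding red_norm_def
proof (rule degree_det_le)
  fix i j assume "i < n" "j < n"
  then show "degree (red_mat g $$ (i, j)) \<le> degree g"
    by (intro degree_le allI impI) (simp add: coeff_red_mat coeff_eq_0)
qed simp

text \<open>The exponent \<open>t * card A\<close> is reached only by taking exponent
  \<open>t\<close> in every factor.\<close>

lemma coeff_prod_top:
  fixes p :: "'b \<Rightarrow> 'c::idom poly"
  assumes "finite A" "\<And>i. i \<in> A \<Longrightarrow> degree (p i) \<le> t"
  shows "coeff (\<Prod>i\<in>A. p i) (t * card A) = (\<Prod>i\<in>A. coeff (p i) t) \<and> degree (\<Prod>i\<in>A. p i) \<le> t * card A"
  using assms
proof (induction A rule: finite_induct)
  case (insert a A)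
  then have IH: "coeff (\<Prod>i\<in>A. p i) (t * card A) = (\<Prod>i\<in>A. coeff (p i) t)" "degree (\<Prod>i\<in>A. p i) \<le> t * card A"
    and a: "degree (p a) \<le> t" by auto
  have "coeff (p a * (\<Prod>i\<in>A. p i)) (t + t * card A) = (\<Sum>i\<in>{t}. coeff (p a) i * coeff (\<Prod>i\<in>A. p i) (t + t * card A - i))"
    unfolding coeff_mult
  proof (rule sum.mono_neutral_right)
    show "\<forall>i\<in>{..t + t * card A} - {t}. coeff (p a) i * coeff (\<Prod>i\<in>A. p i) (t + t * card A - i) = 0"
    proof
      fix i assume "i \<in> {..t + t * card A} - {t}"
      then consider "i > t" | "t + t * card A - i > t * card A" by force
      then show "coeff (p a) i * coeff (\<Prod>i\<in>A. p i) (t + t * card A - i) = 0"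
        using a IH(2) by cases (auto simp: coeff_eq_0)
    qed
  qed auto
  moreover have "degree (p a * (\<Prod>i\<in>A. p i)) \<le> t + t * card A"
    using degree_mult_le[of "p a" "\<Prod>i\<in>A. p i"] a IH(2) by linarith
  ultimately show ?case using insert.hyps IH(1) by simp
qed simp

text \<open>Entries of degree at most \<open>t\<close>: the coefficient only depends on the leading coefficient of \<open>g\<close>.\<close>
lemma coeff_red_norm_top:
  assumes "degree g \<le> t"
  shows "coeff (red_norm g) (t * n) = (\<Sum>p\<in>{p. p permutes {0..<n}}. signof p *
    (\<Prod>i = 0..<n. if (i + t) mod n = p i then (\<sigma> ^^ i) (coeff g t) else 0))"
proof -
  have "coeff (signof p * (\<Prod>i = 0..<n. red_mat g $$ (i, p i))) (t * n) = signof p *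
    (\<Prod>i = 0..<n. if (i + t) mod n = p i then (\<sigma> ^^ i) (coeff g t) else 0)" if p: "p permutes {0..<n}" for p
  proof -
    have pi: "p i < n" if "i < n" for i using permutes_in_image[OF p, of i] that by simp
    have "degree (red_mat g $$ (i, p i)) \<le> t" if "i \<in> {0..<n}" for i
      using that pi assms by (intro degree_le allI impI) (simp add: coeff_red_mat coeff_eq_0)
    then have "coeff (\<Prod>i = 0..<n. red_mat g $$ (i, p i)) (t * n) = (\<Prod>i = 0..<n. coeff (red_mat g $$ (i, p i)) t)"
      using coeff_prod_top[of "{0..<n}" "\<lambda>i. red_mat g $$ (i, p i)" t] by simp
    then show ?thesis using pi by (simp add: sign_def coeff_red_mat)
  qed
  then show ?thesis unfolding red_norm_def det_def'[OF red_mat_carrier(1)] coeff_sum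
    by (intro sum.cong) auto
qed

text \<open>The matrix of \<open>x\<close> is \<open>x\<close> times the permutation matrix of an
  \<open>n\<close>-cycle, whence the sign. The last row has its single nonzero entry in column 0,
  and the complementary minor is \<open>x\<close> times the identity.\<close>

lemma red_norm_X: "red_norm (monom 1 (Suc 0)) = monom ((- 1) ^ (n - Suc 0)) n"
proof -
  let ?A = "red_mat (monom 1 (Suc 0))"
  have entry: "?A $$ (i, j) = (if Suc i mod n = j then monom 1 (Suc 0) else 0)" if "i < n" "j < n" for i j
    using that by (intro poly_eqI) (auto simp: coeff_red_mat)
  have "det ?A = (\<Sum>j<n. ?A $$ (n - Suc 0, j) * cofactor ?A (n - Suc 0) j)"
    using n_pos by (intro laplace_expansion_row) auto
  also have "\<dots> = (\<Sum>j<n. if j = 0 then monom 1 (Suc 0) * cofactor ?A (n - Suc 0) 0 else 0)"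
    using n_pos by (intro sum.cong) (auto simp: entry)
  also have "\<dots> = monom 1 (Suc 0) * cofactor ?A (n - Suc 0) 0" using n_pos by (simp add: sum.delta)
  also have "mat_delete ?A (n - Suc 0) 0 = monom 1 (Suc 0) \<cdot>\<^sub>m 1\<^sub>m (n - Suc 0)"
    by (rule eq_matI) (auto simp: mat_delete_def entry)
  then have "cofactor ?A (n - Suc 0) 0 = (- 1) ^ (n - Suc 0) * monom 1 (n - Suc 0)"
    by (simp add: cofactor_def monom_power)
  also have "monom 1 (Suc 0) * ((- 1) ^ (n - Suc 0) * monom 1 (n - Suc 0)) = ((- 1) ^ (n - Suc 0) :: 'l poly) * monom 1 n"
    using n_pos by (simp add: mult_monom mult.left_commute)
  also have "\<dots> = monom ((- 1) ^ (n - Suc 0)) n"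
    by (simp add: minus_one_power_iff minus_monom)
  finally show ?thesis by (simp add: red_norm_def)
qed

lemma skew_monom_power: "red_norm (monom 1 t) = red_norm (monom 1 1) ^ t"
proof (induction t)
  case 0
  then show ?case using red_norm_central[OF central_one] by simp
next
  case (Suc t)
  have "monom 1 (Suc t) = monom 1 1 \<star> monom (1::'l) t"
    by (intro poly_eqI) (auto simp: monom_skew_mult \<sigma>_one)
  then show ?case by (simp add: Suc red_norm_mult)
qed

text \<open>The top coefficient is unchanged when \<open>g\<close> is replaced by \<open>x\<close>
  to the power \<open>degree g\<close>, whose norm is a power of the norm of
  \<open>x\<close>.\<close>

lemma coeff_red_norm_monic:
  assumes "lead_coeff g = 1"
  shows "coeff (red_norm g) (degree g * n) = (- 1) ^ ((n - 1) * degree g)"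
proof -
  have "coeff (red_norm g) (degree g * n) = coeff (red_norm (monom 1 (degree g))) (degree g * n)"
    using assms coeff_red_norm_top[of g "degree g"] coeff_red_norm_top[of "monom 1 (degree g)" "degree g"]
    by (simp add: degree_monom_le cong: if_cong)
  also have "red_norm (monom 1 (degree g)) = monom ((- 1) ^ ((n - 1) * degree g)) (n * degree g)"
    by (subst skew_monom_power) (simp add: red_norm_X monom_power power_mult)
  finally show ?thesis by (simp add: mult.commute)
qed

lemma degree_red_norm_monic:
  assumes "lead_coeff g = 1"
  shows "degree (red_norm g) = degree g * n"
  using degree_red_norm_le[of g] coeff_red_norm_monic[OF assms] by (intro antisym le_degree) simp_all

text \<open>Exponents add in products, hence so do congruences between them. In the application
  \<open>r\<close> is a permutation, so the sum of the indices and that of their images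
  cancel.\<close>

lemma coeff_prod_support:
  fixes p :: "nat \<Rightarrow> 'c::idom poly"
  assumes "finite A" "\<And>i k. i \<in> A \<Longrightarrow> coeff (p i) k \<noteq> 0 \<Longrightarrow> (i + k) mod n = r i mod n"
    "coeff (\<Prod>i\<in>A. p i) k \<noteq> 0"
  shows "(\<Sum>A + k) mod n = (\<Sum>i\<in>A. r i) mod n"
  using assms
proof (induction A arbitrary: k rule: finite_induct)
  case empty
  then show ?case by (auto split: if_splits)
next
  case (insert a A)
  have "coeff (p a * (\<Prod>i\<in>A. p i)) k \<noteq> 0" using insert by simp
  then obtain j where j: "j \<le> k" "coeff (p a) j * coeff (\<Prod>i\<in>A. p i) (k - j) \<noteq> 0"
    unfolding coeff_mult by (meson atMost_iff sum.neutral)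
  have "(a + j) mod n = r a mod n" using insert.prems(1) j(2) by auto
  moreover have "(\<Sum>A + (k - j)) mod n = (\<Sum>i\<in>A. r i) mod n" using insert.IH insert.prems(1) j(2) by auto
  ultimately have "((a + j) + (\<Sum>A + (k - j))) mod n = (r a + (\<Sum>i\<in>A. r i)) mod n"
    by (rule mod_add_cong)
  then show ?case using insert.hyps j(1) by (simp add: algebra_simps)
qed

text \<open>Entry \<open>(i, j)\<close> carries only exponents congruent to \<open>j - i\<close>,
  and along a permutation these differences add up to zero.\<close>

lemma red_norm_support:
  assumes "coeff (red_norm g) k \<noteq> 0"
  shows "n dvd k"
proof -
  obtain p where p: "p permutes {0..<n}" "coeff (signof p * (\<Prod>i = 0..<n. red_mat g $$ (i, p i))) k \<noteq> 0"
    using assms unfolding red_norm_def det_def'[OF red_mat_carrier(1)] coeff_sum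
    by (rule sum.not_neutral_contains_not_neutral) auto
  have pi: "p i < n" if "i < n" for i using permutes_in_image[OF p(1), of i] that by simp
  have "coeff (\<Prod>i = 0..<n. red_mat g $$ (i, p i)) k \<noteq> 0" using p(2) by (auto simp: sign_def split: if_splits)
  then have "(\<Sum>{0..<n} + k) mod n = (\<Sum>i = 0..<n. p i) mod n"
    by (rule coeff_prod_support[rotated 2]) (auto simp: coeff_red_mat pi split: if_splits)
  also have "(\<Sum>i = 0..<n. p i) = \<Sum>{0..<n}" using sum.permute[OF p(1), of "\<lambda>i. i"] by (simp add: comp_def)
  finally have "(\<Sum>{0..<n} + k) mod n = (\<Sum>{0..<n} + 0) mod n" by simp
  then show ?thesis using mod_eq_dvd_iff_nat[of "\<Sum>{0..<n}" "\<Sum>{0..<n} + k" n] by simp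
qed

text \<open>Applying \<open>\<sigma>\<close> to coefficients is conjugation by \<open>x\<close>,
  since \<open>x g = \<sigma>(g) x\<close>. Norms are multiplicative in a commutative domain, so the
  norm of \<open>x\<close> cancels.\<close>

lemma red_norm_fixed: "map_poly \<sigma> (red_norm g) = red_norm g"
proof -
  interpret h: comm_ring_hom "map_poly \<sigma>"
    by unfold_locales
       (auto intro!: poly_eqI simp: coeff_map_poly \<sigma>_add \<sigma>_mult \<sigma>_sum coeff_mult \<sigma>_one)
  have "map_mat (map_poly \<sigma>) (red_mat g) = red_mat (map_poly \<sigma> g)"
  proof (rule eq_matI)
    fix i j assume "i < dim_row (red_mat (map_poly \<sigma> g))" "j < dim_col (red_mat (map_poly \<sigma> g))"
    then have ij: "i < n" "j < n" by auto
    then show "map_mat (map_poly \<sigma>) (red_mat g) $$ (i, j) = red_mat (map_poly \<sigma> g) $$ (i, j)"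
      by (intro poly_eqI) (auto simp: coeff_red_mat coeff_map_poly funpow_swap1)
  qed auto
  then have "map_poly \<sigma> (red_norm g) = red_norm (map_poly \<sigma> g)"
    unfolding red_norm_def by (simp flip: h.hom_det)
  moreover have "monom 1 1 \<star> g = map_poly \<sigma> g \<star> monom 1 1"
    by (intro poly_eqI) (auto simp: monom_skew_mult skew_mult_monom coeff_map_poly)
  then have "red_norm (monom 1 1) * red_norm g = red_norm (map_poly \<sigma> g) * red_norm (monom 1 1)"
    by (metis red_norm_mult)
  moreover have "red_norm (monom 1 1) \<noteq> 0" by (simp add: red_norm_X)
  ultimately show ?thesis by (simp add: mult.commute)
qed

lemma red_norm_in_central: "red_norm g \<in> central"
  unfolding central_def
proof (intro CollectI conjI allI impI)
  fix k
  show "\<sigma> (coeff (red_norm g) k) = coeff (red_norm g) k"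
    using arg_cong[OF red_norm_fixed, of "\<lambda>p. coeff p k"] by (simp add: coeff_map_poly)
qed (rule red_norm_support)

section \<open>Irreducibility in the centre\<close>

text \<open>Degrees in \<open>K[x^n]\<close> are multiples of \<open>n\<close> and quotients of
  leading coefficients are fixed by \<open>\<sigma>\<close>, so every term of the long division
  stays in \<open>K[x^n]\<close>.\<close>

lemma central_division:
  assumes b: "b \<in> central" "b \<noteq> 0" and a: "a \<in> central"
  shows "\<exists>q r. q \<in> central \<and> r \<in> central \<and> a = q * b + r \<and> r \<in> remainders b"
  using a
proof (induction "if a = 0 then 0 else Suc (degree a)" arbitrary: a rule: less_induct)
  case less
  show ?case
  proof (cases "a = 0 \<or> degree a < degree b")
    case True
    then show ?thesis using less.prems by (intro exI[of _ 0] exI[of _ a]) (auto simp: remainders_def)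
  next
    case False
    define c where "c = lead_coeff a / lead_coeff b"
    define m where "m = monom c (degree a - degree b)"
    define a' where "a' = a - m * b"
    have "\<sigma> c = c" using centralD(1) less.prems b(1) by (simp add: c_def divide_inverse \<sigma>_mult \<sigma>_inverse)
    moreover have "n dvd degree a - degree b"
      using degree_central less.prems b False by (intro dvd_diff_nat) auto
    ultimately have m: "m \<in> central" unfolding m_def by (rule central_monom)
    have a': "a' \<in> central" unfolding a'_def using m less.prems b(1) by (intro central_diff central_mult)
    have "c \<noteq> 0" using False b(2) by (simp add: c_def)
    then have deg: "degree (m * b) = degree a" 
      using False b(2) degree_mult_eq[of m b] by (simp add: m_def degree_monom_eq)
    have "coeff (m * b) (degree a) = lead_coeff a"
      using False b(2) deg lead_coeff_mult[of m b] \<open>c \<noteq> 0\<close> by (simp add: m_def degree_monom_eq) (simp add: c_def)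
    then have "coeff a' (degree a) = 0" by (simp add: a'_def)
    moreover have "degree a' \<le> degree a" unfolding a'_def by (intro degree_diff_le) (auto simp: deg)
    ultimately have "a' = 0 \<or> degree a' < degree a"
      using leading_coeff_0_iff[of a'] by (metis le_neq_implies_less)
    then have "\<exists>q r. q \<in> central \<and> r \<in> central \<and> a' = q * b + r \<and> r \<in> remainders b"
      using less.hyps[of a'] a' False by (cases "a' = 0") auto
    then obtain q r where "q \<in> central" "r \<in> central" "a' = q * b + r" "r \<in> remainders b" by blast
    then show ?thesis using m
      by (intro exI[of _ "q + m"] exI[of _ r]) (auto simp: a'_def algebra_simps central_add)
  qed
qed

text \<open>Irreducibility in \<open>K[x^n]\<close>; the same polynomial may factor further in
  \<open>R\<close>, as \<open>P\<close> does when \<open>m > 1\<close>.\<close>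

definition central_irreducible :: "'l poly \<Rightarrow> bool" where
  "central_irreducible p \<longleftrightarrow> p \<in> central \<and> degree p > 0 \<and>
     (\<forall>a\<in>central. \<forall>b\<in>central. p = a * b \<longrightarrow> degree a = 0 \<or> degree b = 0)"

text \<open>An element \<open>g\<close> of least degree generates the ideal \<open>(p, a)\<close> of
  \<open>K[x^n]\<close>. As \<open>g\<close> divides \<open>p\<close>, either the cofactor is
  constant, so that \<open>p\<close> divides \<open>a\<close>, or \<open>g\<close> is a constant and
  yields the Bezout identity.\<close>

lemma central_bezout:
  assumes p: "central_irreducible p" and a: "a \<in> central"
  shows "(\<exists>q\<in>central. a = q * p) \<or> (\<exists>u\<in>central. \<exists>v\<in>central. u * p + v * a = 1)"
proof -
  have pc: "p \<in> central" "p \<noteq> 0" using p by (auto simp: central_irreducible_def)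
  define I where "I = {u * p + v * a | u v. u \<in> central \<and> v \<in> central}"
  have Ic: "I \<subseteq> central" unfolding I_def using pc a by (auto intro!: central_add central_mult)
  have "p = 1 * p + 0 * a" "a = 0 * p + 1 * a" by simp_all
  then have "p \<in> I" "a \<in> I" unfolding I_def using central_one central_zero by blast+
  define d where "d = (LEAST d. \<exists>g\<in>I. g \<noteq> 0 \<and> degree g = d)"
  have "\<exists>g\<in>I. g \<noteq> 0 \<and> degree g = d"
    unfolding d_def by (rule LeastI_ex) (use \<open>p \<in> I\<close> pc in auto)
  then obtain g where g: "g \<in> I" "g \<noteq> 0" "degree g = d" by auto
  have least: "d \<le> degree h" if "h \<in> I" "h \<noteq> 0" for h
    unfolding d_def using that by (intro Least_le) auto
  obtain u v where uv: "g = u * p + v * a" "u \<in> central" "v \<in> central" using g(1) by (auto simp: I_def)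
  have dvd: "\<exists>q\<in>central. h = q * g" if h: "h \<in> I" for h
  proof -
    obtain q r where qr: "q \<in> central" "r \<in> central" "h = q * g + r" "r \<in> remainders g"
      using central_division[of g h] g Ic h by blast
    obtain u' v' where h': "h = u' * p + v' * a" "u' \<in> central" "v' \<in> central" using h by (auto simp: I_def)
    have "r = (u' - q * u) * p + (v' - q * v) * a" using qr(3) h'(1) uv(1) by (simp add: algebra_simps)
    then have "r \<in> I" unfolding I_def using qr(1) h'(2,3) uv(2,3) by (blast intro: central_diff central_mult)
    then have "r = 0" using least[of r] qr(4) g(3) by (metis remainders_iff not_less)
    then show ?thesis using qr by auto
  qed
  obtain q where q: "q \<in> central" "p = q * g" using dvd[OF \<open>p \<in> I\<close>] by blast
  have "degree q = 0 \<or> degree g = 0" using p q subsetD[OF Ic g(1)] by (simp add: central_irreducible_def)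
  then show ?thesis
  proof
    assume "degree q = 0"
    then obtain c where c: "q = [:c:]" by (auto elim: degree_eq_zeroE)
    then have "c \<noteq> 0" using q(2) pc by auto
    have "\<sigma> c = c" using centralD(1)[OF q(1), of 0] c by simp
    then have "\<sigma> (inverse c) = inverse c" by (simp add: \<sigma>_inverse)
    obtain q' where q': "q' \<in> central" "a = q' * g" using dvd[OF \<open>a \<in> I\<close>] by blast
    have "a = smult (inverse c) q' * p" using q'(2) q(2) c \<open>c \<noteq> 0\<close> by simp
    then show ?thesis using central_smult[OF \<open>\<sigma> (inverse c) = inverse c\<close> q'(1)] by blast
  next
    assume "degree g = 0"
    then obtain c where c: "g = [:c:]" by (auto elim: degree_eq_zeroE)
    then have "c \<noteq> 0" using g(2) by auto
    have "g \<in> central" using g(1) Ic by blast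
    then have "\<sigma> c = c" using centralD(1)[of g 0] c by simp
    then have s: "\<sigma> (inverse c) = inverse c" by (simp add: \<sigma>_inverse)
    have "smult (inverse c) u * p + smult (inverse c) v * a = smult (inverse c) g"
      by (simp add: uv(1) smult_add_right)
    also have "\<dots> = 1" using \<open>c \<noteq> 0\<close> by (simp add: c one_pCons)
    finally show ?thesis using central_smult[OF s] uv(2,3) by blast
  qed
qed

lemma central_irreducible_power_factor:
  assumes p: "central_irreducible p" and a: "a \<in> central" and b: "b \<in> central" and ab: "a * b = p ^ N"
  shows "\<exists>c j. a = smult c (p ^ j)"
  using a b ab
proof (induction N arbitrary: a)
  case 0
  then have "is_unit a" by (metis dvd_triv_left power_0)
  then obtain c where "a = [:c:]" by (auto elim: is_unit_polyE)
  then have "a = smult c (p ^ 0)" by simp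
  then show ?case by blast
next
  case (Suc N)
  have p0: "p \<noteq> 0" using p by (auto simp: central_irreducible_def)
  from central_bezout[OF p Suc.prems(1)] show ?case
  proof (elim disjE bexE)
    fix q assume q: "q \<in> central" "a = q * p"
    then have "p * (q * b) = p * p ^ N" using Suc.prems(3) by (simp add: ac_simps)
    then have "q * b = p ^ N" using p0 by simp
    from Suc.IH[OF q(1) Suc.prems(2) this] obtain c j where "q = smult c (p ^ j)" by blast
    then have "a = smult c (p ^ Suc j)" using q(2) by (simp add: mult.commute)
    then show ?thesis by blast
  next
    fix u v assume uv: "u \<in> central" "v \<in> central" "u * p + v * a = 1"
    \<comment> \<open>Being coprime to \<open>p\<close>, the polynomial \<open>a\<close> still
      divides after one factor \<open>p\<close> is stripped off.\<close>
    have "a dvd p ^ j \<Longrightarrow> a dvd 1" for j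
    proof (induction j)
      case (Suc j)
      have "p ^ j = (u * p + v * a) * p ^ j" using uv(3) by simp
      also have "\<dots> = u * p ^ Suc j + a * (v * p ^ j)" by (simp add: algebra_simps)
      finally have "a dvd p ^ j" using dvd_add[OF dvd_mult[OF Suc.prems, of u] dvd_triv_left[of a "v * p ^ j"]] by simp
      then show ?case by (rule Suc.IH)
    qed simp
    then have "is_unit a" using Suc.prems(3) by (metis dvd_triv_left)
    then obtain c where "a = [:c:]" by (auto elim: is_unit_polyE)
    then have "a = smult c (p ^ 0)" by simp
    then show ?thesis by blast
  qed
qed

text \<open>From \<open>p = q g\<close> the norm of \<open>g\<close> divides \<open>p^n\<close>,
  hence is a constant times \<open>p^j\<close>. Leading coefficients give the constant, degrees
  relate \<open>j\<close> to \<open>degree g\<close>, and evaluation at 0 gives the second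
  equation.\<close>

lemma right_factor_norm:
  assumes p: "central_irreducible p" "lead_coeff p = 1" and g: "lead_coeff g = 1" "right_dvd g p"
  obtains j where "degree g * n = degree p * j"
    "(\<Prod>i<n. (\<sigma> ^^ i) (coeff g 0)) = (- 1) ^ ((n - 1) * degree g) * coeff p 0 ^ j"
proof -
  have pc: "p \<in> central" and p_nz: "p \<noteq> 0" using p(1) by (auto simp: central_irreducible_def)
  obtain q where "p = q \<star> g" using g(2) by (auto simp: right_dvd_def)
  then have "red_norm g * red_norm q = p ^ n"
    using red_norm_mult[of q g] red_norm_central[OF pc] by (simp add: mult.commute)
  then obtain c j where cj: "red_norm g = smult c (p ^ j)"
    using central_irreducible_power_factor[OF p(1) red_norm_in_central red_norm_in_central] by blast
  have lead: "lead_coeff (red_norm g) = (- 1) ^ ((n - 1) * degree g)"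
    using coeff_red_norm_monic[OF g(1)] degree_red_norm_monic[OF g(1)] by simp
  then have "c = (- 1) ^ ((n - 1) * degree g)"
    using p(2) unfolding cj lead_coeff_smult lead_coeff_power by simp
  moreover from this have "c \<noteq> 0" by simp
  then have "degree (red_norm g) = degree p * j"
    using degree_power_eq[of p j, OF p_nz] by (simp add: cj mult.commute)
  ultimately show ?thesis
    using that[of j] degree_red_norm_monic[OF g(1)] coeff_red_norm_0[of g]
    by (simp add: cj coeff_0_power)
qed

text \<open>
  \<open>R/Rp\<close> is simple: a monic element of least degree \<open>d\<close> in a two-sided ideal satisfies
  \<open>g a = \<sigma>\<^sup>d(a) g\<close> and commutes with \<open>x\<close>; its constant coefficient is nonzero, so it is central.
\<close>
lemma two_sided_ideal_maximal:
  assumes p: "central_irreducible p" "coeff p 0 \<noteq> 0"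
    and add: "\<And>u v. u \<in> I \<Longrightarrow> v \<in> I \<Longrightarrow> u + v \<in> I"
    and left: "\<And>u v. v \<in> I \<Longrightarrow> u \<star> v \<in> I"
    and right: "\<And>u v. v \<in> I \<Longrightarrow> v \<star> u \<in> I"
    and pI: "p \<in> I" and proper: "1 \<notin> I" and u: "u \<in> I"
  shows "right_dvd p u"
proof -
  have pc: "p \<in> central" "p \<noteq> 0" using p(1) by (auto simp: central_irreducible_def)
  obtain g where g: "lead_coeff g = 1" "g \<in> I" "I = {a. right_dvd g a}"
    "\<And>h. h \<in> I \<Longrightarrow> h \<noteq> 0 \<Longrightarrow> degree g \<le> degree h"
    using left_ideal_principal[of I p, OF add left pI pc(2)] by blast
  have g0: "g \<noteq> 0" using g(1) by auto
  define d where "d = degree g"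
  obtain q where q: "p = q \<star> g" using g(3) pI by (auto simp: right_dvd_def)
  have c0: "coeff g 0 \<noteq> 0" using p(2) by (simp add: q coeff_skew_mult_0)
  have neg: "- u \<in> I" if "u \<in> I" for u using left[OF that, of "[:-1:]"] by (simp add: const_skew_mult)
  have twist: "coeff g k * (\<sigma> ^^ k) a = (\<sigma> ^^ d) a * coeff g k" for k a
  proof -
    \<comment> \<open>At degree \<open>d\<close> the two products have the same coefficient, as
      \<open>g\<close> is monic. So \<open>h\<close> has smaller degree than \<open>g\<close> and
      must vanish.\<close>
    define h where "h = g \<star> monom a 0 + - (monom ((\<sigma> ^^ d) a) 0 \<star> g)"
    have h: "h \<in> I" unfolding h_def by (intro add right neg left g(2))
    have ch: "coeff h k = coeff g k * (\<sigma> ^^ k) a - (\<sigma> ^^ d) a * coeff g k" for k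
      by (simp add: h_def skew_mult_monom monom_skew_mult)
    have "h = 0"
    proof (rule ccontr)
      assume "h \<noteq> 0"
      then have "d \<le> degree h" using g(4)[OF h] by (simp add: d_def)
      moreover have "degree h \<le> d" by (rule degree_le) (simp add: ch d_def coeff_eq_0)
      ultimately have "degree h = d" by simp
      moreover have "coeff h d = 0" using g(1) by (simp add: ch d_def)
      ultimately show False using \<open>h \<noteq> 0\<close> by (metis leading_coeff_0_iff)
    qed
    then show ?thesis using ch[of k] by simp
  qed
  have fixed: "\<sigma> (coeff g k) = coeff g k" for k
  proof -
    define h where "h = monom 1 1 \<star> g + - (g \<star> monom 1 1)"
    have h: "h \<in> I" unfolding h_def by (intro add right neg left g(2))
    have ch: "coeff h j = (if 1 \<le> j then \<sigma> (coeff g (j - 1)) - coeff g (j - 1) else 0)" for j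
      by (simp add: h_def skew_mult_monom monom_skew_mult)
    have "h = 0"
    proof (rule ccontr)
      assume "h \<noteq> 0"
      \<comment> \<open>The terms of degree \<open>d + 1\<close> cancel, so a nonzero
        \<open>r\<close> would be a constant. But \<open>h\<close> has no constant term while
        \<open>g\<close> has one.\<close>
      obtain r where r: "h = r \<star> g" using h g(3) by (auto simp: right_dvd_def)
      have "r \<noteq> 0" using \<open>h \<noteq> 0\<close> r by auto
      have "degree h \<le> d"
      proof (rule degree_le, intro allI impI)
        fix j assume j: "d < j"
        show "coeff h j = 0"
        proof (cases "j = Suc d")
          case True
          then show ?thesis using g(1) by (simp add: ch d_def \<sigma>_one)
        next
          case False
          then have "degree g < j - 1" using j by (simp add: d_def)
          then show ?thesis by (simp add: ch coeff_eq_0)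
        qed
      qed
      then have "degree r = 0" using degree_skew_mult[OF \<open>r \<noteq> 0\<close> g0] r by (simp add: d_def)
      then have "coeff r 0 \<noteq> 0" using \<open>r \<noteq> 0\<close> by (metis leading_coeff_0_iff)
      moreover have "coeff h 0 = 0" by (simp add: ch)
      ultimately show False using c0 by (simp add: r coeff_skew_mult_0)
    qed
    then show ?thesis using ch[of "Suc k"] by simp
  qed
  \<comment> \<open>The twist relation at the nonzero constant coefficient forces
    \<open>\<sigma>^d\<close> to be the identity. At any other nonzero coefficient it then yields
    \<open>\<sigma>^k = id\<close>.\<close>
  have d_id: "(\<sigma> ^^ d) a = a" for a using twist[of 0 a] c0 by (simp add: mult.commute)
  have "g \<in> central"
    unfolding central_def
  proof (intro CollectI conjI allI impI fixed)
    fix k assume k: "coeff g k \<noteq> 0"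
    have "(\<sigma> ^^ k) a = a" for a using twist[of k a] k d_id[of a] by (simp add: mult.commute)
    then have "\<sigma> ^^ k = id" by auto
    then show "n dvd k" using order by simp
  qed
  from central_bezout[OF p(1) this] show ?thesis
  proof (elim disjE bexE)
    fix q assume "q \<in> central" "g = q * p"
    then have "right_dvd p g" using skew_mult_central_right[OF pc(1), of q] right_dvdI by metis
    moreover have "right_dvd g u" using g(3) u by blast
    ultimately show ?thesis by (metis right_dvd_def right_dvd_mult)
  next
    fix a b assume "a \<in> central" "b \<in> central" "a * p + b * g = 1"
    then have "1 = a \<star> p + b \<star> g" using skew_mult_central_left by simp
    then have "1 \<in> I" using add left pI g(2) by metis
    then show ?thesis using proper by simp
  qed
qed

end

section \<open>Bases and norms of field extensions\<close>

lemma ambient_simps [simp]: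
  "carrier ambient_field = UNIV" "a \<otimes>\<^bsub>ambient_field\<^esub> b = a * b" "a \<oplus>\<^bsub>ambient_field\<^esub> b = a + b"
  "\<one>\<^bsub>ambient_field\<^esub> = 1" "\<zero>\<^bsub>ambient_field\<^esub> = 0"
  by (simp_all add: ring_of_type_algebra_def)

interpretation ambient: cring "ambient_field :: 'l::field ring"
  by (rule cring_from_type_algebra)

declare ambient.Span.simps [simp del]

lemma ambient_uminus [simp]: "\<ominus>\<^bsub>ambient_field\<^esub> a = - a"
  using ambient.minus_equality[of "- a" a] by simp

lemma ambient_inv: "a \<noteq> 0 \<Longrightarrow> inv\<^bsub>ambient_field\<^esub> a = inverse a"
  using ambient.comm_inv_char[of a "inverse a"] by simp

lemma subfield_closed:
  assumes "subfield K ambient_field"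
  shows "0 \<in> K" "1 \<in> K" "a \<in> K \<Longrightarrow> b \<in> K \<Longrightarrow> a + b \<in> K" "a \<in> K \<Longrightarrow> b \<in> K \<Longrightarrow> a * b \<in> K"
    "a \<in> K \<Longrightarrow> - a \<in> K" "a \<in> K \<Longrightarrow> inverse a \<in> K"
proof -
  note sr = subringE[OF subfieldE(1)[OF assms], unfolded ambient_simps ambient_uminus]
  show "0 \<in> K" "1 \<in> K" by (fact sr(2,3))+
  show "- a \<in> K" if "a \<in> K" using that by (rule sr(5))
  show "a * b \<in> K" "a + b \<in> K" if "a \<in> K" "b \<in> K" using that by (rule sr(6), rule sr(7))
  show "inverse a \<in> K" if "a \<in> K"
  proof (cases "a = 0")
    case False
    then have "inv\<^bsub>ambient_field\<^esub> a \<in> K - {\<zero>\<^bsub>ambient_field\<^esub>}"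
      using that by (intro ambient.subfield_m_inv(1)[OF assms]) simp
    then show ?thesis using False by (simp add: ambient_inv)
  qed (use that in simp)
qed

lemma subfieldI_closed:
  fixes K :: "'l::field set"
  assumes "1 \<in> K" "\<And>a b. a \<in> K \<Longrightarrow> b \<in> K \<Longrightarrow> a + b \<in> K" "\<And>a b. a \<in> K \<Longrightarrow> b \<in> K \<Longrightarrow> a * b \<in> K"
    "\<And>a. a \<in> K \<Longrightarrow> - a \<in> K" "\<And>a. a \<in> K \<Longrightarrow> inverse a \<in> K"
  shows "subfield K ambient_field"
proof (rule field.subfieldI'[OF field_from_type_algebra])
  show "subring K ambient_field"
    by (rule ambient.subringI) (use assms(1-4) in simp_all)
  show "inv\<^bsub>ambient_field\<^esub> k \<in> K" if "k \<in> K - {\<zero>\<^bsub>ambient_field\<^esub>}" for k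
    using that assms(5)[of k] by (simp add: ambient_inv)
qed

lemma subfield_sum: "subfield K ambient_field \<Longrightarrow> (\<And>x. x \<in> A \<Longrightarrow> g x \<in> K) \<Longrightarrow> sum g A \<in> K"
  by (induction A rule: infinite_finite_induct) (auto intro: subfield_closed(1,3))

lemma combine_eq_sum:
  "length Ks = length Us \<Longrightarrow> ambient.combine Ks Us = (\<Sum>i<length Us. Ks ! i * Us ! i)"
  by (induction Ks Us rule: list_induct2) (simp_all add: sum.lessThan_Suc_shift del: sum.lessThan_Suc)

definition basis_of :: "'l::field set \<Rightarrow> 'l set \<Rightarrow> 'l list \<Rightarrow> bool" where
  "basis_of K E bs \<longleftrightarrow> ambient.independent K bs \<and> ambient.Span K bs = E"

text \<open>Replacing recursive combinations of lists by indexed sums lets spans and bases be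
  handled together with matrices.\<close>

lemma Span_eq_sums:
  assumes "subfield K ambient_field"
  shows "ambient.Span K bs = {(\<Sum>i<length bs. c i * bs ! i) | c. \<forall>i<length bs. c i \<in> K}"
  unfolding ambient.Span_eq_combine_set_length_version[OF assms, of bs, unfolded ambient_simps, OF subset_UNIV]
proof (intro equalityI subsetI)
  fix x assume "x \<in> {ambient.combine Ks bs | Ks. length Ks = length bs \<and> set Ks \<subseteq> K}"
  then obtain Ks where Ks: "x = ambient.combine Ks bs" "length Ks = length bs" "set Ks \<subseteq> K" by blast
  then have "x = (\<Sum>i<length bs. Ks ! i * bs ! i)" "\<forall>i<length bs. Ks ! i \<in> K"
    by (auto simp: combine_eq_sum)
  then show "x \<in> {(\<Sum>i<length bs. c i * bs ! i) | c. \<forall>i<length bs. c i \<in> K}" by blast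
next
  fix x assume "x \<in> {(\<Sum>i<length bs. c i * bs ! i) | c. \<forall>i<length bs. c i \<in> K}"
  then obtain c where c: "x = (\<Sum>i<length bs. c i * bs ! i)" "\<forall>i<length bs. c i \<in> K" by blast
  have "x = ambient.combine (map c [0..<length bs]) bs"
    by (simp add: combine_eq_sum c(1))
  moreover have "set (map c [0..<length bs]) \<subseteq> K" using c(2) by auto
  ultimately show "x \<in> {ambient.combine Ks bs | Ks. length Ks = length bs \<and> set Ks \<subseteq> K}"
    by (intro CollectI exI[of _ "map c [0..<length bs]"]) simp
qed

lemma independent_iff:
  assumes "subfield K ambient_field"
  shows "ambient.independent K bs \<longleftrightarrow>
    (\<forall>c. (\<forall>i<length bs. c i \<in> K) \<and> (\<Sum>i<length bs. c i * bs ! i) = 0 \<longrightarrow> (\<forall>i<length bs. c i = 0))"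
proof (intro iffI allI impI, elim conjE)
  fix c i assume ind: "ambient.independent K bs" and c: "\<forall>i<length bs. c i \<in> K" "(\<Sum>i<length bs. c i * bs ! i) = 0"
    and i: "i < length bs"
  have K: "set (map c [0..<length bs]) \<subseteq> K" using c(1) by (simp add: image_subset_iff)
  have "ambient.combine (map c [0..<length bs]) bs = \<zero>\<^bsub>ambient_field\<^esub>"
    using c(2) combine_eq_sum[of "map c [0..<length bs]" bs] by simp
  from ambient.independent_imp_trivial_combine[OF assms ind K this]
  have "set (map c [0..<length bs]) \<subseteq> {0}" by simp
  then show "c i = 0" using i by (simp add: image_subset_iff)
next
  assume *: "\<forall>c. (\<forall>i<length bs. c i \<in> K) \<and> (\<Sum>i<length bs. c i * bs ! i) = 0 \<longrightarrow> (\<forall>i<length bs. c i = 0)"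
  show "ambient.independent K bs"
  proof (rule ccontr)
    assume "\<not> ambient.independent K bs"
    then obtain Ks where Ks: "length Ks = length bs" "ambient.combine Ks bs = 0" "set Ks \<subseteq> K" "set Ks \<noteq> {0}"
      by (rule ambient.dependent_imp_non_trivial_combine[OF assms, of bs, unfolded ambient_simps, OF subset_UNIV])
    have mem: "\<forall>i<length bs. Ks ! i \<in> K" using Ks(1,3) nth_mem[of _ Ks] by (auto simp only: subset_iff)
    have "(\<Sum>i<length bs. Ks ! i * bs ! i) = 0" using combine_eq_sum[OF Ks(1)] Ks(2) by (simp only:)
    with mem have "\<forall>i<length bs. Ks ! i = 0" using spec[OF *, of "\<lambda>i. Ks ! i"] by blast
    then have "x = 0" if "x \<in> set Ks" for x using that Ks(1) unfolding in_set_conv_nth by force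
    then have "set Ks \<subseteq> {0}" by blast
    then have "set Ks = {}" using Ks(4) subset_singletonD by metis
    then have "Ks = []" by simp
    then have "bs = []" using Ks(1) by simp
    then show False using \<open>\<not> ambient.independent K bs\<close> ambient.li_Nil by blast
  qed
qed

lemma basis_unique:
  assumes "subfield K ambient_field" "basis_of K E bs" "\<And>i. i < length bs \<Longrightarrow> c i \<in> K" "\<And>i. i < length bs \<Longrightarrow> c' i \<in> K"
    "(\<Sum>i<length bs. c i * bs ! i) = (\<Sum>i<length bs. c' i * bs ! i)" "i < length bs"
  shows "c i = c' i"
proof -
  have mem: "\<forall>i<length bs. c i - c' i \<in> K"
    unfolding diff_conv_add_uminus[of "c _"]
    by (intro allI impI subfield_closed(3)[OF assms(1)] subfield_closed(5)[OF assms(1)] assms(3,4))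
  have sum0: "(\<Sum>i<length bs. (c i - c' i) * bs ! i) = 0"
    unfolding left_diff_distrib sum_subtractf assms(5) by simp
  have "ambient.independent K bs" using assms(2) unfolding basis_of_def by blast
  then have "\<forall>i<length bs. c i - c' i = 0"
    unfolding independent_iff[OF assms(1)] using spec[of _ "\<lambda>i. c i - c' i"] mem sum0 by blast
  then show ?thesis using assms(6) by simp
qed

lemma basis_eq_sums:
  assumes "subfield K ambient_field" "basis_of K E bs"
  shows "E = {(\<Sum>i<length bs. c i * bs ! i) | c. \<forall>i<length bs. c i \<in> K}"
  using assms(2) unfolding basis_of_def Span_eq_sums[OF assms(1), symmetric] by blast

lemma basis_coeffs:
  assumes "subfield K ambient_field" "basis_of K E bs" "a \<in> E"
  obtains c where "\<And>i. i < length bs \<Longrightarrow> c i \<in> K" "a = (\<Sum>i<length bs. c i * bs ! i)"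
  using assms(3) unfolding basis_eq_sums[OF assms(1,2)] by blast

lemma basis_sum_mem:
  assumes "subfield K ambient_field" "basis_of K E bs" "\<And>i. i < length bs \<Longrightarrow> c i \<in> K"
  shows "(\<Sum>i<length bs. c i * bs ! i) \<in> E"
  unfolding basis_eq_sums[OF assms(1,2)] using assms(3) by blast

lemma basis_nth_mem:
  assumes "subfield K ambient_field" "basis_of K E bs" "j < length bs"
  shows "bs ! j \<in> E"
proof -
  have "(\<Sum>i<length bs. (if i = j then 1 else 0) * bs ! i) \<in> E"
    by (rule basis_sum_mem[OF assms(1,2)]) (simp add: subfield_closed[OF assms(1)])
  then show ?thesis using assms(3) by (simp add: if_distrib[of "\<lambda>x. x * _"] sum.delta cong: if_cong)
qed

lemma basis_ofI:
  assumes "subfield K ambient_field"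
    and "\<And>c i. (\<And>i. i < length bs \<Longrightarrow> c i \<in> K) \<Longrightarrow> (\<Sum>i<length bs. c i * bs ! i) = 0 \<Longrightarrow> i < length bs \<Longrightarrow> c i = 0"
    and "\<And>a. \<exists>c. (\<forall>i<length bs. c i \<in> K) \<and> a = (\<Sum>i<length bs. c i * bs ! i)"
  shows "basis_of K UNIV bs"
proof -
  have "ambient.independent K bs" unfolding independent_iff[OF assms(1)] using assms(2) by blast
  moreover have "a \<in> ambient.Span K bs" for a
    using assms(3)[of a] unfolding Span_eq_sums[OF assms(1)] by blast
  ultimately show ?thesis unfolding basis_of_def by blast
qed

lemma basis_exists:
  assumes "subfield K ambient_field" "ambient.dimension r K E"
  obtains bs where "basis_of K E bs" "length bs = r"
  using ambient.exists_base[OF assms] unfolding basis_of_def by blast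

section \<open>Matrices of multiplication maps and the field norm\<close>

definition mult_mat :: "'l::field set \<Rightarrow> 'l list \<Rightarrow> 'l \<Rightarrow> 'l mat \<Rightarrow> bool" where
  "mult_mat K bs a A \<longleftrightarrow> A \<in> carrier_mat (length bs) (length bs) \<and>
     (\<forall>i<length bs. \<forall>j<length bs. A $$ (i, j) \<in> K) \<and>
     (\<forall>j<length bs. a * bs ! j = (\<Sum>i<length bs. A $$ (i, j) * bs ! i))"

lemma elements_mat_subset_iff:
  "A \<in> carrier_mat n n \<Longrightarrow> elements_mat A \<subseteq> K \<longleftrightarrow> (\<forall>i<n. \<forall>j<n. A $$ (i, j) \<in> K)"
  by (auto simp: elements_mat_def UN_subset_iff image_subset_iff)

lemma mult_mat_exists:
  assumes "subfield K ambient_field" "basis_of K E bs" "\<And>b. b \<in> E \<Longrightarrow> a * b \<in> E"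
  obtains A where "mult_mat K bs a A"
proof -
  have "\<forall>j. \<exists>c. j < length bs \<longrightarrow> (\<forall>i<length bs. c i \<in> K) \<and> a * bs ! j = (\<Sum>i<length bs. c i * bs ! i)"
    using basis_coeffs[OF assms(1,2) assms(3)[OF basis_nth_mem[OF assms(1,2)]]] by metis
  then obtain c where c: "\<And>j i. j < length bs \<Longrightarrow> i < length bs \<Longrightarrow> c j i \<in> K"
    "\<And>j. j < length bs \<Longrightarrow> a * bs ! j = (\<Sum>i<length bs. c j i * bs ! i)" by metis
  have "mult_mat K bs a (mat (length bs) (length bs) (\<lambda>(i, j). c j i))"
    using c by (simp add: mult_mat_def)
  then show ?thesis using that by blast
qed

lemma mult_mat_unique:
  assumes "subfield K ambient_field" "basis_of K E bs" "mult_mat K bs a A" "mult_mat K bs a B"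
  shows "A = B"
proof (rule eq_matI)
  fix i j assume "i < dim_row B" "j < dim_col B"
  then have ij: "i < length bs" "j < length bs" using assms(4) by (auto simp: mult_mat_def)
  show "A $$ (i, j) = B $$ (i, j)"
    using basis_unique[OF assms(1,2), of "\<lambda>i. A $$ (i, j)" "\<lambda>i. B $$ (i, j)" i] assms(3,4) ij
    by (simp add: mult_mat_def)
qed (use assms(3,4) in \<open>auto simp: mult_mat_def\<close>)

lemma mult_mat_mult:
  assumes K: "subfield K ambient_field" and A: "mult_mat K bs a A" and B: "mult_mat K bs b B"
  shows "mult_mat K bs (a * b) (A * B)"
proof -
  let ?r = "length bs"
  have carr: "A \<in> carrier_mat ?r ?r" "B \<in> carrier_mat ?r ?r" using A B by (auto simp: mult_mat_def)
  have entry: "(A * B) $$ (i, j) = (\<Sum>k<?r. A $$ (i, k) * B $$ (k, j))" if "i < ?r" "j < ?r" for i j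
    using that carr by (simp add: scalar_prod_def atLeast0LessThan)
  have "a * b * bs ! j = (\<Sum>i<?r. (A * B) $$ (i, j) * bs ! i)" if j: "j < ?r" for j
  proof -
    have "a * b * bs ! j = (\<Sum>k<?r. B $$ (k, j) * (a * bs ! k))"
      using B j by (simp add: mult_mat_def mult.assoc sum_distrib_left mult.left_commute)
    also have "\<dots> = (\<Sum>k<?r. \<Sum>i<?r. B $$ (k, j) * (A $$ (i, k) * bs ! i))"
      using A by (simp add: mult_mat_def sum_distrib_left)
    also have "\<dots> = (\<Sum>i<?r. \<Sum>k<?r. B $$ (k, j) * (A $$ (i, k) * bs ! i))" by (rule sum.swap)
    also have "\<dots> = (\<Sum>i<?r. (A * B) $$ (i, j) * bs ! i)"
      using j by (intro sum.cong refl) (simp add: entry sum_distrib_left mult_ac del: index_mult_mat(1))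
    finally show ?thesis .
  qed
  moreover have "(A * B) $$ (i, j) \<in> K" if "i < ?r" "j < ?r" for i j
    unfolding entry[OF that] using that A B
    by (intro subfield_sum[OF K] subfield_closed(4)[OF K]) (auto simp: mult_mat_def)
  ultimately show ?thesis using carr by (auto simp: mult_mat_def)
qed

lemma mult_mat_add:
  assumes K: "subfield K ambient_field" and A: "mult_mat K bs a A" and B: "mult_mat K bs b B"
  shows "mult_mat K bs (a + b) (A + B)"
  using A B by (auto simp: mult_mat_def subfield_closed[OF K] algebra_simps sum.distrib)

lemma mult_mat_one:
  assumes K: "subfield K ambient_field"
  shows "mult_mat K bs 1 (1\<^sub>m (length bs))"
  using subfield_closed(1,2)[OF K]
  by (auto simp: mult_mat_def if_distrib[of "\<lambda>x. x * _"] sum.delta cong: if_cong)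

lemma change_of_basis:
  assumes K: "subfield K ambient_field" and bs: "basis_of K E bs" and cs: "basis_of K E cs"
  obtains Q where "Q \<in> carrier_mat (length bs) (length cs)"
    "\<And>i j. i < length bs \<Longrightarrow> j < length cs \<Longrightarrow> Q $$ (i, j) \<in> K"
    "\<And>j. j < length cs \<Longrightarrow> cs ! j = (\<Sum>i<length bs. Q $$ (i, j) * bs ! i)"
proof -
  have "\<forall>j. \<exists>c. j < length cs \<longrightarrow> (\<forall>i<length bs. c i \<in> K) \<and> cs ! j = (\<Sum>i<length bs. c i * bs ! i)"
    using basis_coeffs[OF K bs basis_nth_mem[OF K cs]] by metis
  then obtain c where "\<And>j i. j < length cs \<Longrightarrow> i < length bs \<Longrightarrow> c j i \<in> K"
    "\<And>j. j < length cs \<Longrightarrow> cs ! j = (\<Sum>i<length bs. c j i * bs ! i)" by metis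
  then show ?thesis by (intro that[of "mat (length bs) (length cs) (\<lambda>(i, j). c j i)"]) simp_all
qed

lemma basis_length_unique:
  assumes K: "subfield K ambient_field" and bs: "basis_of K E bs" and cs: "basis_of K E cs"
  shows "length bs = length cs"
  using ambient.dimension_is_inj[OF K, of "length bs" E "length cs"] bs cs
    ambient.dimensionI[OF K, of bs E] ambient.dimensionI[OF K, of cs E] by (simp add: basis_of_def)

text \<open>The change of basis \<open>Q\<close> is invertible and satisfies
  \<open>A Q = Q B\<close>.\<close>

lemma det_mult_mat_unique:
  assumes K: "subfield K ambient_field" and bs: "basis_of K E bs" and cs: "basis_of K E cs"
    and A: "mult_mat K bs a A" and B: "mult_mat K cs a B"
  shows "det A = det B"
proof -
  let ?r = "length bs"
  have len: "length cs = ?r" using basis_length_unique[OF K bs cs] by simp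
  obtain Q where Q: "Q \<in> carrier_mat ?r ?r"
    "\<And>i j. i < ?r \<Longrightarrow> j < ?r \<Longrightarrow> Q $$ (i, j) \<in> K"
    "\<And>j. j < ?r \<Longrightarrow> cs ! j = (\<Sum>i<?r. Q $$ (i, j) * bs ! i)"
    using change_of_basis[OF K bs cs] unfolding len by blast
  obtain Q' where Q': "Q' \<in> carrier_mat ?r ?r"
    "\<And>i j. i < ?r \<Longrightarrow> j < ?r \<Longrightarrow> Q' $$ (i, j) \<in> K"
    "\<And>j. j < ?r \<Longrightarrow> bs ! j = (\<Sum>i<?r. Q' $$ (i, j) * cs ! i)"
    using change_of_basis[OF K cs bs] unfolding len by blast
  have carr: "A \<in> carrier_mat ?r ?r" "B \<in> carrier_mat ?r ?r" using A B len by (auto simp: mult_mat_def)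
  have entry: "(M * N) $$ (i, j) = (\<Sum>k<?r. M $$ (i, k) * N $$ (k, j))"
    if "i < ?r" "j < ?r" "M \<in> carrier_mat ?r ?r" "N \<in> carrier_mat ?r ?r" for M N :: "'a mat" and i j
    using that by (simp add: scalar_prod_def atLeast0LessThan)
  have memK: "(M * N) $$ (i, j) \<in> K"
    if "i < ?r" "j < ?r" "M \<in> carrier_mat ?r ?r" "N \<in> carrier_mat ?r ?r"
      "\<And>i j. i < ?r \<Longrightarrow> j < ?r \<Longrightarrow> M $$ (i, j) \<in> K" "\<And>i j. i < ?r \<Longrightarrow> j < ?r \<Longrightarrow> N $$ (i, j) \<in> K" for M N i j
    unfolding entry[OF that(1-4)] using that
    by (intro subfield_sum[OF K] subfield_closed(4)[OF K]) auto
  have combo: "(\<Sum>k<?r. N $$ (k, j) * (\<Sum>i<?r. M $$ (i, k) * e i)) = (\<Sum>i<?r. (M * N) $$ (i, j) * e i)"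
    if "j < ?r" "M \<in> carrier_mat ?r ?r" "N \<in> carrier_mat ?r ?r" for M N :: "'a mat" and j e
  proof -
    have "(\<Sum>k<?r. N $$ (k, j) * (\<Sum>i<?r. M $$ (i, k) * e i)) = (\<Sum>k<?r. \<Sum>i<?r. M $$ (i, k) * N $$ (k, j) * e i)"
      by (simp add: sum_distrib_left ac_simps)
    also have "\<dots> = (\<Sum>i<?r. \<Sum>k<?r. M $$ (i, k) * N $$ (k, j) * e i)" by (rule sum.swap)
    finally show ?thesis using that by (simp add: entry sum_distrib_right del: index_mult_mat(1))
  qed
  \<comment> \<open>Expanding \<open>cs\<close> in \<open>bs\<close> and back returns
    \<open>cs\<close>. Comparing coordinates is legitimate only for entries in \<open>K\<close>,
    which is why membership of the product entries is tracked.\<close>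
  have "Q' * Q = 1\<^sub>m ?r"
  proof (rule eq_matI)
    fix i j assume "i < dim_row (1\<^sub>m ?r)" "j < dim_col (1\<^sub>m ?r)"
    then have ij: "i < ?r" "j < ?r" by auto
    have "cs ! j = (\<Sum>k<?r. Q $$ (k, j) * (\<Sum>i<?r. Q' $$ (i, k) * cs ! i))"
      unfolding Q(3)[OF ij(2)] by (intro sum.cong refl arg_cong2[of _ _ _ _ "(*)"] Q'(3)) simp
    then have "(\<Sum>i<?r. (Q' * Q) $$ (i, j) * cs ! i) = cs ! j"
      using combo[OF ij(2) Q'(1) Q(1), of "\<lambda>i. cs ! i"] by (simp only:)
    also have "\<dots> = (\<Sum>i<?r. (1\<^sub>m ?r) $$ (i, j) * cs ! i)"
      using ij by (simp add: if_distrib[of "\<lambda>x. x * _"] sum.delta' cong: if_cong)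
    finally show "(Q' * Q) $$ (i, j) = 1\<^sub>m ?r $$ (i, j)"
      using ij by (intro basis_unique[OF K cs, unfolded len, of "\<lambda>i. (Q' * Q) $$ (i, j)" "\<lambda>i. 1\<^sub>m ?r $$ (i, j)"])
        (simp_all add: memK[OF _ _ Q'(1) Q(1)] Q'(2) Q(2) subfield_closed[OF K] del: index_mult_mat(1))
  qed (use Q Q' in auto)
  then have "det Q' * det Q = 1" using det_mult[OF Q'(1) Q(1)] by simp
  then have detQ: "det Q \<noteq> 0" by auto
  have "A * Q = Q * B"
  proof (rule eq_matI)
    fix i j assume "i < dim_row (Q * B)" "j < dim_col (Q * B)"
    then have ij: "i < ?r" "j < ?r" using Q carr by auto
    have "a * cs ! j = (\<Sum>k<?r. Q $$ (k, j) * (a * bs ! k))"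
      using Q(3)[OF ij(2)] by (simp add: sum_distrib_left mult.left_commute)
    also have "\<dots> = (\<Sum>k<?r. Q $$ (k, j) * (\<Sum>i<?r. A $$ (i, k) * bs ! i))"
      using A by (simp add: mult_mat_def)
    also have "\<dots> = (\<Sum>i<?r. (A * Q) $$ (i, j) * bs ! i)" by (rule combo[OF ij(2) carr(1) Q(1)])
    finally have 1: "a * cs ! j = (\<Sum>i<?r. (A * Q) $$ (i, j) * bs ! i)" .
    have "a * cs ! j = (\<Sum>k<?r. B $$ (k, j) * (\<Sum>i<?r. Q $$ (i, k) * bs ! i))"
    proof -
      have "a * cs ! j = (\<Sum>k<?r. B $$ (k, j) * cs ! k)" using B ij(2) len by (simp add: mult_mat_def)
      also have "\<dots> = (\<Sum>k<?r. B $$ (k, j) * (\<Sum>i<?r. Q $$ (i, k) * bs ! i))"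
        by (intro sum.cong refl arg_cong2[of _ _ _ _ "(*)"] Q(3)) simp
      finally show ?thesis .
    qed
    also have "\<dots> = (\<Sum>i<?r. (Q * B) $$ (i, j) * bs ! i)" by (rule combo[OF ij(2) Q(1) carr(2)])
    finally have "(\<Sum>i<?r. (A * Q) $$ (i, j) * bs ! i) = (\<Sum>i<?r. (Q * B) $$ (i, j) * bs ! i)" using 1 by simp
    then show "(A * Q) $$ (i, j) = (Q * B) $$ (i, j)"
      using A B len ij by (intro basis_unique[OF K bs, of "\<lambda>i. (A * Q) $$ (i, j)" "\<lambda>i. (Q * B) $$ (i, j)"])
        (simp_all add: memK[OF _ _ carr(1) Q(1)] memK[OF _ _ Q(1) carr(2)] mult_mat_def Q(2) del: index_mult_mat(1))
  qed (use Q carr in auto)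
  then have "det Q * det A = det Q * det B"
    using det_mult[OF carr(1) Q(1)] det_mult[OF Q(1) carr(2)] by (metis mult.commute)
  then show ?thesis using detQ mult_left_cancel[of "det Q"] by blast
qed

text \<open>Independence of the basis resolves the definite description, so any convenient basis may
  be used from here on.\<close>

lemma field_norm_eq:
  assumes K: "subfield K ambient_field" and bs: "basis_of K E bs" and A: "mult_mat K bs a A"
  shows "field_norm E K a = det A"
proof -
  have iff: "(\<exists>bs A. ambient.independent K bs \<and> ambient.Span K bs = E \<and>
       A \<in> carrier_mat (length bs) (length bs) \<and> elements_mat A \<subseteq> K \<and>
       (\<forall>j<length bs. a * bs ! j = (\<Sum>i<length bs. A $$ (i, j) * bs ! i)) \<and> d = det A)
    \<longleftrightarrow> (\<exists>bs A. basis_of K E bs \<and> mult_mat K bs a A \<and> d = det A)" for d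
    unfolding basis_of_def mult_mat_def
  proof (intro arg_cong[of _ _ Ex] ext)
    fix bs A
    show "(ambient.independent K bs \<and> ambient.Span K bs = E \<and>
       A \<in> carrier_mat (length bs) (length bs) \<and> elements_mat A \<subseteq> K \<and>
       (\<forall>j<length bs. a * bs ! j = (\<Sum>i<length bs. A $$ (i, j) * bs ! i)) \<and> d = det A) =
      ((ambient.independent K bs \<and> ambient.Span K bs = E) \<and>
       (A \<in> carrier_mat (length bs) (length bs) \<and>
        (\<forall>i<length bs. \<forall>j<length bs. A $$ (i, j) \<in> K) \<and>
        (\<forall>j<length bs. a * bs ! j = (\<Sum>i<length bs. A $$ (i, j) * bs ! i))) \<and> d = det A)"
      using elements_mat_subset_iff[of A "length bs" K] by (cases "A \<in> carrier_mat (length bs) (length bs)") simp_all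
  qed
  show ?thesis
    unfolding field_norm_def iff
  proof (rule the_equality)
    show "\<exists>bs A'. basis_of K E bs \<and> mult_mat K bs a A' \<and> det A = det A'" using bs A by blast
    fix d assume "\<exists>bs A. basis_of K E bs \<and> mult_mat K bs a A \<and> d = det A"
    then obtain cs B where "basis_of K E cs" "mult_mat K cs a B" "d = det B" by blast
    then show "d = det A" using det_mult_mat_unique[OF K bs _ A] by simp
  qed
qed

section \<open>Block determinants\<close>

text \<open>Every entry is replaced by its \<open>r\<close> by \<open>r\<close> block. Index
  \<open>i\<close> splits into block \<open>i div r\<close> and offset \<open>i mod r\<close>, the
  same splitting that orders the product basis of a tower.\<close>

definition blow_up :: "nat \<Rightarrow> ('a \<Rightarrow> 'b mat) \<Rightarrow> 'a mat \<Rightarrow> 'b mat" where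
  "blow_up r \<chi> M = mat (dim_row M * r) (dim_col M * r)
     (\<lambda>(i, j). \<chi> (M $$ (i div r, j div r)) $$ (i mod r, j mod r))"

lemma blow_up_carrier: "M \<in> carrier_mat a b \<Longrightarrow> blow_up r \<chi> M \<in> carrier_mat (a * r) (b * r)"
  by (simp add: blow_up_def)

lemma sum_blocks: "(\<Sum>t<a * r. g t) = (\<Sum>i<a. \<Sum>j<r. g (i * r + j :: nat))"
proof (induction a)
  case (Suc a)
  have "(\<Sum>t<Suc a * r. g t) = (\<Sum>t<a * r + r. g t)" by (simp add: add.commute)
  also have "\<dots> = (\<Sum>t<a * r. g t) + (\<Sum>j<r. g (a * r + j))"
  proof -
    have "(\<Sum>t<b + k. g t) = (\<Sum>t<b. g t) + (\<Sum>j<k. g (b + j))" for b k :: nat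
      by (induction k) (simp_all add: add.assoc)
    then show ?thesis .
  qed
  finally show ?case using Suc.IH by simp
qed simp

text \<open>In the application \<open>\<chi> c\<close> is the matrix over \<open>K'\<close> of
  multiplication by \<open>c\<close> on \<open>K\<close>. Closure of \<open>K\<close> under inverses
  keeps Gaussian elimination inside the domain of \<open>\<chi>\<close>.\<close>

locale matrix_rep =
  fixes r :: nat and K :: "'a::field set" and \<chi> :: "'a \<Rightarrow> 'b::field mat"
  assumes r_pos: "r > 0"
    and K_zero: "0 \<in> K" and K_one: "1 \<in> K"
    and K_add: "a \<in> K \<Longrightarrow> b \<in> K \<Longrightarrow> a + b \<in> K"
    and K_mult: "a \<in> K \<Longrightarrow> b \<in> K \<Longrightarrow> a * b \<in> K"
    and K_minus: "a \<in> K \<Longrightarrow> - a \<in> K"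
    and K_inverse: "a \<in> K \<Longrightarrow> inverse a \<in> K"
    and carrier: "a \<in> K \<Longrightarrow> \<chi> a \<in> carrier_mat r r"
    and rep_add: "a \<in> K \<Longrightarrow> b \<in> K \<Longrightarrow> \<chi> (a + b) = \<chi> a + \<chi> b"
    and rep_mult: "a \<in> K \<Longrightarrow> b \<in> K \<Longrightarrow> \<chi> (a * b) = \<chi> a * \<chi> b"
    and rep_one: "\<chi> 1 = 1\<^sub>m r"
begin

definition over_K :: "'a mat \<Rightarrow> bool" where
  "over_K M \<longleftrightarrow> (\<forall>i<dim_row M. \<forall>j<dim_col M. M $$ (i, j) \<in> K)"

lemma over_KD: "over_K M \<Longrightarrow> i < dim_row M \<Longrightarrow> j < dim_col M \<Longrightarrow> M $$ (i, j) \<in> K"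
  by (simp add: over_K_def)

lemma K_sum: "(\<And>x. x \<in> A \<Longrightarrow> g x \<in> K) \<Longrightarrow> sum g A \<in> K"
  by (induction A rule: infinite_finite_induct) (auto intro: K_zero K_add)

lemma rep_zero: "\<chi> 0 = 0\<^sub>m r r"
proof (rule eq_matI)
  fix i j assume "i < dim_row (0\<^sub>m r r)" "j < dim_col (0\<^sub>m r r)"
  then have ij: "i < r" "j < r" by auto
  have "\<chi> 0 = \<chi> 0 + \<chi> 0" using rep_add[OF K_zero K_zero] by simp
  then have "\<chi> 0 $$ (i, j) = (\<chi> 0 + \<chi> 0) $$ (i, j)" by simp
  also have "\<dots> = \<chi> 0 $$ (i, j) + \<chi> 0 $$ (i, j)"
    using carrier[OF K_zero] ij by (intro index_add_mat(1)) auto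
  finally have "\<chi> 0 $$ (i, j) = 0" by (simp only: add_cancel_right_right)
  then show "\<chi> 0 $$ (i, j) = 0\<^sub>m r r $$ (i, j)" using ij by simp
qed (use carrier[OF K_zero] in auto)

lemma rep_sum:
  assumes "finite A" "\<And>x. x \<in> A \<Longrightarrow> g x \<in> K" "i < r" "j < r"
  shows "\<chi> (sum g A) $$ (i, j) = (\<Sum>x\<in>A. \<chi> (g x) $$ (i, j))"
  using assms
proof (induction A rule: finite_induct)
  case empty
  then show ?case by (simp add: rep_zero)
next
  case (insert x A)
  have "\<chi> (g x + sum g A) = \<chi> (g x) + \<chi> (sum g A)"
    using insert.prems by (intro rep_add K_sum) auto
  moreover have "(\<chi> (g x) + \<chi> (sum g A)) $$ (i, j) = \<chi> (g x) $$ (i, j) + \<chi> (sum g A) $$ (i, j)"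
    using insert.prems carrier[of "sum g A"] K_sum[of A g] by (intro index_add_mat(1)) auto
  ultimately show ?case using insert by simp
qed

lemma over_K_mult:
  assumes "over_K M" "over_K N" "M \<in> carrier_mat a b" "N \<in> carrier_mat b c"
  shows "over_K (M * N)"
  unfolding over_K_def
proof (intro allI impI)
  fix i j assume "i < dim_row (M * N)" "j < dim_col (M * N)"
  then have ij: "i < a" "j < c" using assms by auto
  have "(M * N) $$ (i, j) = (\<Sum>k<b. M $$ (i, k) * N $$ (k, j))"
    using ij assms(3,4) by (simp add: scalar_prod_def atLeast0LessThan)
  also have "\<dots> \<in> K" using ij assms by (intro K_sum K_mult over_KD) auto
  finally show "(M * N) $$ (i, j) \<in> K" .
qed

lemma blow_up_mult:
  assumes "over_K M" "over_K N" "M \<in> carrier_mat a b" "N \<in> carrier_mat b c"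
  shows "blow_up r \<chi> (M * N) = blow_up r \<chi> M * blow_up r \<chi> N"
proof (rule eq_matI)
  fix i j assume "i < dim_row (blow_up r \<chi> M * blow_up r \<chi> N)" "j < dim_col (blow_up r \<chi> M * blow_up r \<chi> N)"
  then have ij: "i < a * r" "j < c * r" using assms(3,4) by (auto simp: blow_up_def)
  then have d: "i div r < a" "j div r < c" by (simp_all add: less_mult_imp_div_less)
  have m: "i mod r < r" "j mod r < r" using r_pos by simp_all
  have MN: "(M * N) $$ (i div r, j div r) = (\<Sum>k<b. M $$ (i div r, k) * N $$ (k, j div r))"
    using d assms(3,4) by (simp add: scalar_prod_def atLeast0LessThan)
  have mem: "M $$ (i div r, k) \<in> K" "N $$ (k, j div r) \<in> K" if "k < b" for k
    using d that assms by (auto intro: over_KD)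
  have "blow_up r \<chi> (M * N) $$ (i, j) = \<chi> ((M * N) $$ (i div r, j div r)) $$ (i mod r, j mod r)"
    using ij assms(3,4) by (simp add: blow_up_def)
  also have "\<dots> = (\<Sum>k<b. \<chi> (M $$ (i div r, k) * N $$ (k, j div r)) $$ (i mod r, j mod r))"
    unfolding MN by (rule rep_sum) (use m mem K_mult in auto)
  also have "\<dots> = (\<Sum>k<b. \<Sum>q<r. \<chi> (M $$ (i div r, k)) $$ (i mod r, q) * \<chi> (N $$ (k, j div r)) $$ (q, j mod r))"
  proof (intro sum.cong refl)
    fix k assume "k \<in> {..<b}"
    then have k: "M $$ (i div r, k) \<in> K" "N $$ (k, j div r) \<in> K" using mem by auto
    show "\<chi> (M $$ (i div r, k) * N $$ (k, j div r)) $$ (i mod r, j mod r) =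
      (\<Sum>q<r. \<chi> (M $$ (i div r, k)) $$ (i mod r, q) * \<chi> (N $$ (k, j div r)) $$ (q, j mod r))"
      unfolding rep_mult[OF k] using carrier[OF k(1)] carrier[OF k(2)] m
      by (simp add: scalar_prod_def atLeast0LessThan)
  qed
  also have "\<dots> = (\<Sum>t<b * r. blow_up r \<chi> M $$ (i, t) * blow_up r \<chi> N $$ (t, j))"
    unfolding sum_blocks
  proof (intro sum.cong refl)
    fix k q assume "k \<in> {..<b}" "q \<in> {..<r}"
    then have kq: "k < b" "q < r" by auto
    then have "k * r + q < Suc k * r" by simp
    also have "\<dots> \<le> b * r" using kq by (intro mult_le_mono1) simp
    finally have "k * r + q < b * r" .
    then show "\<chi> (M $$ (i div r, k)) $$ (i mod r, q) * \<chi> (N $$ (k, j div r)) $$ (q, j mod r) =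
      blow_up r \<chi> M $$ (i, k * r + q) * blow_up r \<chi> N $$ (k * r + q, j)"
      using ij kq assms(3,4) by (simp add: blow_up_def)
  qed
  also have "\<dots> = (blow_up r \<chi> M * blow_up r \<chi> N) $$ (i, j)"
    using ij blow_up_carrier[OF assms(3), of r \<chi>] blow_up_carrier[OF assms(4), of r \<chi>]
    by (simp add: scalar_prod_def atLeast0LessThan)
  finally show "blow_up r \<chi> (M * N) $$ (i, j) = (blow_up r \<chi> M * blow_up r \<chi> N) $$ (i, j)" .
qed (use assms(3,4) in \<open>auto simp: blow_up_def\<close>)

lemma blow_up_entry:
  assumes "M \<in> carrier_mat a a" "i < a * r" "j < a * r"
  shows "blow_up r \<chi> M $$ (i, j) = \<chi> (M $$ (i div r, j div r)) $$ (i mod r, j mod r)"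
  using assms by (simp add: blow_up_def)

text \<open>Zeros become zero blocks and ones become identity blocks, so the unitriangular shape
  survives. Both orientations occur: upper to create a pivot, lower to clear a column with
  it.\<close>

lemma det_blow_up_unitriangular:
  assumes M: "M \<in> carrier_mat a a" and diag: "\<And>i. i < a \<Longrightarrow> M $$ (i, i) = 1"
    and tri: "(\<forall>i<a. \<forall>j<i. M $$ (i, j) = 0) \<or> (\<forall>j<a. \<forall>i<j. M $$ (i, j) = 0)"
  shows "det M = 1" "det (blow_up r \<chi> M) = 1"
proof -
  note B = blow_up_carrier[OF M, of r \<chi>]
  have d: "i div r < a" if "i < a * r" for i using that by (simp add: less_mult_imp_div_less)
  have Bdiag: "blow_up r \<chi> M $$ (i, i) = 1" if "i < a * r" for i
    using that d[OF that] r_pos by (simp add: blow_up_entry[OF M] diag rep_one)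
  have prods: "prod_list (diag_mat M) = 1" "prod_list (diag_mat (blow_up r \<chi> M)) = 1"
    using M B by (simp_all add: prod_list_diag_prod diag Bdiag)
  have same: "blow_up r \<chi> M $$ (i, j) = 0" if "i < a * r" "j < a * r" "i div r = j div r" "i \<noteq> j" for i j
  proof -
    have "i mod r \<noteq> j mod r" using that(3,4) by (metis div_mult_mod_eq)
    then show ?thesis using that d[of i] r_pos by (simp add: blow_up_entry[OF M] diag rep_one)
  qed
  from tri have "det M = 1 \<and> det (blow_up r \<chi> M) = 1"
  proof
    assume up: "\<forall>i<a. \<forall>j<i. M $$ (i, j) = 0"
    have "upper_triangular M" using up M by (auto intro: upper_triangularI)
    moreover have "upper_triangular (blow_up r \<chi> M)"
    proof (rule upper_triangularI)
      fix i j assume ji: "j < i" and "i < dim_row (blow_up r \<chi> M)"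
      then have i: "i < a * r" "j < a * r" using B by auto
      show "blow_up r \<chi> M $$ (i, j) = 0"
      proof (cases "i div r = j div r")
        case False
        then have "j div r < i div r" using ji div_le_mono[of j i r] by simp
        then show ?thesis using i up d[OF i(1)] r_pos by (simp add: blow_up_entry[OF M] rep_zero)
      qed (use same i ji in auto)
    qed
    ultimately show ?thesis using det_upper_triangular[OF _ M] det_upper_triangular[OF _ B] prods by simp
  next
    assume lo: "\<forall>j<a. \<forall>i<j. M $$ (i, j) = 0"
    have "blow_up r \<chi> M $$ (i, j) = 0" if ij: "i < j" "j < a * r" for i j
    proof (cases "i div r = j div r")
      case False
      then have "i div r < j div r" using ij div_le_mono[of i j r] by simp
      then show ?thesis using ij lo d[OF ij(2)] r_pos by (simp add: blow_up_entry[OF M] rep_zero)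
    qed (use same ij in auto)
    then show ?thesis using det_lower_triangular[OF _ M] det_lower_triangular[OF _ B] prods lo by simp
  qed
  then show "det M = 1" "det (blow_up r \<chi> M) = 1" by auto
qed

text \<open>
  Gaussian elimination: multiplying from the left by unitriangular matrices over \<open>K\<close> clears the
  first column below a nonzero pivot.
\<close>
lemma clear_column:
  assumes M: "M \<in> carrier_mat (Suc a) (Suc a)" "over_K M" and i0: "i0 < Suc a" "M $$ (i0, 0) \<noteq> 0"
  obtains N where "N \<in> carrier_mat (Suc a) (Suc a)" "over_K N" "det N = det M"
    "det (blow_up r \<chi> N) = det (blow_up r \<chi> M)" "\<And>i. 0 < i \<Longrightarrow> i < Suc a \<Longrightarrow> N $$ (i, 0) = 0"
proof -
  have step: "det (E * N) = det N \<and> det (blow_up r \<chi> (E * N)) = det (blow_up r \<chi> N) \<and> over_K (E * N)"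
    if E: "E \<in> carrier_mat (Suc a) (Suc a)" "over_K E" "\<And>i. i < Suc a \<Longrightarrow> E $$ (i, i) = 1"
      "(\<forall>i<Suc a. \<forall>j<i. E $$ (i, j) = 0) \<or> (\<forall>j<Suc a. \<forall>i<j. E $$ (i, j) = 0)"
      and N: "N \<in> carrier_mat (Suc a) (Suc a)" "over_K N" for E N
    using det_blow_up_unitriangular[OF E(1,3,4)] blow_up_mult[OF E(2) N(2) E(1) N(1)]
      over_K_mult[OF E(2) N(2) E(1) N(1)] det_mult[OF E(1) N(1)]
      det_mult[OF blow_up_carrier[OF E(1), of r \<chi>] blow_up_carrier[OF N(1), of r \<chi>]] by simp
  obtain M' where M': "M' \<in> carrier_mat (Suc a) (Suc a)" "over_K M'" "det M' = det M"
    "det (blow_up r \<chi> M') = det (blow_up r \<chi> M)" "M' $$ (0, 0) \<noteq> 0"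
  proof (cases "M $$ (0, 0) = 0")
    case False
    then show ?thesis using that[OF M] by simp
  next
    case True
    then have i0': "0 < i0" using i0 by (cases i0) auto
    \<comment> \<open>Row \<open>i0\<close> is added to row 0 instead of being swapped with it, so
      the matrix is unitriangular and no sign has to be followed through the blocks.\<close>
    define E where "E = mat (Suc a) (Suc a) (\<lambda>(i, j). if i = j \<or> (i = 0 \<and> j = i0) then 1 else (0::'a))"
    have E: "E \<in> carrier_mat (Suc a) (Suc a)" by (simp add: E_def)
    have "over_K E" by (auto simp: over_K_def E_def K_zero K_one)
    moreover have "E $$ (i, i) = 1" if "i < Suc a" for i using that by (simp add: E_def)
    moreover have "\<forall>i<Suc a. \<forall>j<i. E $$ (i, j) = 0" using i0' by (auto simp: E_def)
    ultimately have *: "det (E * M) = det M" "det (blow_up r \<chi> (E * M)) = det (blow_up r \<chi> M)" "over_K (E * M)"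
      using step[OF E _ _ _ M] by blast+
    have "(E * M) $$ (0, 0) = (\<Sum>k<Suc a. E $$ (0, k) * M $$ (k, 0))"
      using E M(1) by (simp add: scalar_prod_def atLeast0LessThan del: sum.lessThan_Suc)
    also have "\<dots> = (\<Sum>k<Suc a. if k = i0 then M $$ (i0, 0) else 0)"
      using True i0' by (intro sum.cong refl) (auto simp: E_def)
    also have "\<dots> = M $$ (i0, 0)" using i0(1) by (simp add: sum.delta del: sum.lessThan_Suc)
    finally show ?thesis using that[of "E * M"] * i0(2) E M(1) by simp
  qed
  define p where "p = M' $$ (0, 0)"
  have "p \<in> K" using M'(1,2) by (auto simp: p_def intro: over_KD)
  then have pK: "p \<in> K" "inverse p \<in> K" by (auto intro: K_inverse)
  define E where "E = mat (Suc a) (Suc a) (\<lambda>(i, j). if i = j then 1 else if j = 0 then - (M' $$ (i, 0) * inverse p) else 0)"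
  have E: "E \<in> carrier_mat (Suc a) (Suc a)" by (simp add: E_def)
  have "over_K E" using M'(1,2) pK by (auto simp: over_K_def E_def intro: K_zero K_one K_minus K_mult)
  moreover have "E $$ (i, i) = 1" if "i < Suc a" for i using that by (simp add: E_def)
  moreover have "\<forall>j<Suc a. \<forall>i<j. E $$ (i, j) = 0" by (auto simp: E_def)
  ultimately have *: "det (E * M') = det M'" "det (blow_up r \<chi> (E * M')) = det (blow_up r \<chi> M')" "over_K (E * M')"
    using step[OF E _ _ _ M'(1,2)] by blast+
  have "(E * M') $$ (i, 0) = 0" if i: "0 < i" "i < Suc a" for i
  proof -
    have "(E * M') $$ (i, 0) = (\<Sum>k<Suc a. E $$ (i, k) * M' $$ (k, 0))"
      using E M'(1) i by (simp add: scalar_prod_def atLeast0LessThan del: sum.lessThan_Suc)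
    also have "\<dots> = (\<Sum>k<Suc a. (if k = i then M' $$ (i, 0) else 0) + (if k = 0 then - (M' $$ (i, 0) * inverse p) * p else 0))"
      using i by (intro sum.cong refl) (auto simp: E_def p_def)
    also have "\<dots> = M' $$ (i, 0) + - (M' $$ (i, 0) * inverse p) * p"
      using i by (simp add: sum.distrib sum.delta del: sum.lessThan_Suc)
    also have "\<dots> = 0" using M'(5) by (simp add: p_def)
    finally show ?thesis .
  qed
  then show ?thesis using that[of "E * M'"] * M'(3,4) E M'(1) by simp
qed

text \<open>Elimination changes neither determinant and reaches a block triangular matrix with pivot
  \<open>p\<close>, where determinants multiply and \<open>\<chi>\<close> is multiplicative. If
  there is no pivot, the first column vanishes on both levels.\<close>

theorem det_blow_up:
  assumes "M \<in> carrier_mat a a" "over_K M"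
  shows "det M \<in> K \<and> det (blow_up r \<chi> M) = det (\<chi> (det M))"
  using assms
proof (induction a arbitrary: M)
  case 0
  then have "det M = 1" "blow_up r \<chi> M \<in> carrier_mat 0 0" using blow_up_carrier[of M 0 0 r \<chi>] by auto
  then show ?case by (simp add: rep_one K_one)
next
  case (Suc a)
  show ?case
  proof (cases "\<exists>i0<Suc a. M $$ (i0, 0) \<noteq> 0")
    case False
    then have "det M = 0"
      using laplace_expansion_column[OF Suc.prems(1), of 0] by simp
    moreover have B: "blow_up r \<chi> M \<in> carrier_mat (Suc a * r) (Suc a * r)" by (rule blow_up_carrier[OF Suc.prems(1)])
    have "blow_up r \<chi> M $$ (i, 0) = 0" if "i < Suc a * r" for i
    proof -
      have "i div r < Suc a" using that less_mult_imp_div_less by blast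
      then show ?thesis using False that r_pos blow_up_entry[OF Suc.prems(1) that, of 0] by (simp add: rep_zero)
    qed
    then have "det (blow_up r \<chi> M) = 0"
      using laplace_expansion_column[OF B, of 0] r_pos by simp
    moreover have "det (0\<^sub>m r r :: 'b mat) = 0" using r_pos by (rule det_zero)
    ultimately show ?thesis by (simp add: rep_zero K_zero)
  next
    case True
    then obtain N where N: "N \<in> carrier_mat (Suc a) (Suc a)" "over_K N" "det N = det M"
      "det (blow_up r \<chi> N) = det (blow_up r \<chi> M)" "\<And>i. 0 < i \<Longrightarrow> i < Suc a \<Longrightarrow> N $$ (i, 0) = 0"
      using clear_column[OF Suc.prems] by blast
    define p where "p = N $$ (0, 0)"
    define v where "v = mat 1 a (\<lambda>(i, j). N $$ (0, Suc j))"
    define N' where "N' = mat a a (\<lambda>(i, j). N $$ (Suc i, Suc j))"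
    have N': "N' \<in> carrier_mat a a" by (simp add: N'_def)
    have "over_K N'" using N(1,2) by (auto simp: over_K_def N'_def)
    note IH = Suc.IH[OF N' this]
    have pK: "p \<in> K" using N(1,2) by (auto simp: p_def intro: over_KD)
    define P1 where "P1 = mat 1 1 (\<lambda>_. p)"
    have "N = four_block_mat P1 v (0\<^sub>m a 1) N'"
      by (rule eq_matI) (use N(1,5) in \<open>auto simp: P1_def v_def N'_def p_def four_block_mat_def Let_def\<close>)
    then have "det N = det P1 * det N'"
      using det_four_block_mat_lower_left_zero[of P1 1 v a "0\<^sub>m a 1" N'] by (simp add: P1_def v_def N'_def)
    also have "det P1 = p" by (simp add: P1_def det_single)
    finally have detN: "det N = p * det N'" .
    define V where "V = mat r (a * r) (\<lambda>(i, j). blow_up r \<chi> N $$ (i, r + j))"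
    have B: "blow_up r \<chi> N \<in> carrier_mat (r + a * r) (r + a * r)" using blow_up_carrier[OF N(1)] by simp
    have B': "blow_up r \<chi> N' \<in> carrier_mat (a * r) (a * r)" by (rule blow_up_carrier[OF N'])
    have "blow_up r \<chi> N = four_block_mat (\<chi> p) V (0\<^sub>m (a * r) r) (blow_up r \<chi> N')"
    proof (rule eq_matI)
      fix i j assume "i < dim_row (four_block_mat (\<chi> p) V (0\<^sub>m (a * r) r) (blow_up r \<chi> N'))"
        "j < dim_col (four_block_mat (\<chi> p) V (0\<^sub>m (a * r) r) (blow_up r \<chi> N'))"
      then have ij: "i < Suc a * r" "j < Suc a * r" using carrier[OF pK] B' by auto
      have split: "i div r = Suc ((i - r) div r)" "i mod r = (i - r) mod r" if "\<not> i < r" for i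
        using that r_pos by (simp_all add: le_div_geq le_mod_geq)
      have dd: "(i - r) div r < a" "i - r < a * r" if "\<not> i < r" "i < Suc a * r" for i
        using that by (auto intro!: less_mult_imp_div_less)
      show "blow_up r \<chi> N $$ (i, j) = four_block_mat (\<chi> p) V (0\<^sub>m (a * r) r) (blow_up r \<chi> N') $$ (i, j)"
      proof (cases "i < r")
        case True
        then show ?thesis
          using ij carrier[OF pK] B' by (auto simp: blow_up_entry[OF N(1)] p_def V_def)
      next
        case False
        note i = this
        show ?thesis
        proof (cases "j < r")
          case True
          then show ?thesis using i ij carrier[OF pK] B' dd[OF i ij(1)]
            by (simp add: blow_up_entry[OF N(1)] split[OF i] N(5) rep_zero)
        next
          case False
          then show ?thesis using i ij carrier[OF pK] B' dd[OF i ij(1)] dd[OF False ij(2)]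
            by (simp add: blow_up_entry[OF N(1)] blow_up_entry[OF N'] split[OF i] split[OF False])
              (simp add: N'_def)
        qed
      qed
    qed (use B B' carrier[OF pK] in auto)
    then have "det (blow_up r \<chi> N) = det (\<chi> p) * det (blow_up r \<chi> N')"
      using det_four_block_mat_lower_left_zero[OF carrier[OF pK] _ _ B', of V "0\<^sub>m (a * r) r"]
      by (simp add: V_def)
    also have "\<dots> = det (\<chi> p * \<chi> (det N'))"
      using IH det_mult[OF carrier[OF pK] carrier] by simp
    also have "\<dots> = det (\<chi> (det N))" using IH rep_mult[OF pK] by (simp add: detN)
    finally show ?thesis using N(3,4) IH K_mult[OF pK] detN by metis
  qed
qed

end

section \<open>Cyclic extensions\<close>

lemma ring_iso_ambientD:
  assumes "\<tau> \<in> ring_iso ambient_field ambient_field"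
  shows "\<tau> (a + b) = \<tau> a + \<tau> b" "\<tau> (a * b) = \<tau> a * \<tau> b" "\<tau> 1 = 1" "bij \<tau>"
  using assms by (auto simp: ring_iso_def Ring.ring_hom_def)

lemma group_galois_group: "group (galois_group K)"
proof (rule groupI)
  fix x assume "x \<in> carrier (galois_group K)"
  then have x: "x \<in> ring_iso ambient_field ambient_field" "\<forall>a\<in>K. x a = a" by (auto simp: galois_group_def)
  have bij: "bij x" using ring_iso_ambientD(4)[OF x(1)] .
  have "inv_into UNIV x \<in> ring_iso ambient_field ambient_field" using ring_iso_set_sym[OF ring_from_type_algebra x(1)] by simp
  moreover have "inv_into UNIV x a = a" if "a \<in> K" for a using x(2) that bij by (metis bij_inv_eq_iff)
  moreover have "inv_into UNIV x \<circ> x = id" using bij by (simp add: bij_is_inj)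
  ultimately show "\<exists>y\<in>carrier (galois_group K). y \<otimes>\<^bsub>galois_group K\<^esub> x = \<one>\<^bsub>galois_group K\<^esub>"
    by (intro bexI[of _ "inv_into UNIV x"]) (auto simp: galois_group_def)
qed (auto simp: galois_group_def comp_assoc ring_iso_set_refl intro: ring_iso_set_trans)

text \<open>The elements fixing \<open>a\<close> contain the generator and are closed under products
  and inverses. Thus the fixed field of the single map \<open>\<sigma>\<close> is
  \<open>K\<close>.\<close>

lemma generator_fixed:
  assumes gen: "generate (galois_group K) {\<sigma>} = carrier (galois_group K)"
    and \<sigma>: "\<sigma> \<in> carrier (galois_group K)" "\<sigma> a = a" and \<tau>: "\<tau> \<in> carrier (galois_group K)"
  shows "\<tau> a = a"
proof -
  interpret G: group "galois_group K" by (rule group_galois_group)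
  have "\<tau> \<in> generate (galois_group K) {\<sigma>}" using gen \<tau> by simp
  then show ?thesis
  proof (induction rule: generate.induct)
    case one
    then show ?case by (simp add: galois_group_def)
  next
    case (incl h)
    then show ?case using \<sigma> by simp
  next
    case (inv h)
    have "inv\<^bsub>galois_group K\<^esub> \<sigma> \<otimes>\<^bsub>galois_group K\<^esub> \<sigma> = \<one>\<^bsub>galois_group K\<^esub>" by (rule G.l_inv[OF \<sigma>(1)])
    then have "(inv\<^bsub>galois_group K\<^esub> \<sigma>) (\<sigma> a) = a" by (simp add: galois_group_def fun_eq_iff)
    then show ?case using inv \<sigma>(2) by simp
  next
    case (eng h1 h2)
    then show ?case by (simp add: galois_group_def)
  qed
qed

text \<open>Dedekind's lemma on characters. It is behind both the order of \<open>\<sigma>\<close>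
  and the nonvanishing of the determinant of conjugates of a basis.\<close>

lemma dedekind_independence:
  fixes \<chi> :: "'i \<Rightarrow> 'l::field \<Rightarrow> 'l"
  assumes "finite A" "inj_on \<chi> A" "\<And>i a b. i \<in> A \<Longrightarrow> \<chi> i (a * b) = \<chi> i a * \<chi> i b"
    "\<And>i. i \<in> A \<Longrightarrow> \<chi> i 1 = 1" "\<And>a. (\<Sum>i\<in>A. c i * \<chi> i a) = 0" "i \<in> A"
  shows "c i = 0"
  using assms
proof (induction A arbitrary: c i rule: finite_induct)
  case (insert j A)
  have A: "c i = 0" if i: "i \<in> A" for i
  proof -
    have "\<chi> i \<noteq> \<chi> j" using insert.prems(1) insert.hyps(2) i by (auto simp: inj_on_def)
    \<comment> \<open>At an argument \<open>b\<close> separating the two characters, the relation at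
      \<open>b a\<close> minus \<open>\<chi> j b\<close> times the relation at \<open>a\<close>
      loses its \<open>j\<close>-term.\<close>
    then obtain b where b: "\<chi> i b \<noteq> \<chi> j b" by blast
    have "(\<Sum>i\<in>A. c i * (\<chi> i b - \<chi> j b) * \<chi> i a) = 0" for a
    proof -
      have "(\<Sum>i\<in>insert j A. c i * \<chi> i (b * a)) - \<chi> j b * (\<Sum>i\<in>insert j A. c i * \<chi> i a) = 0"
        using insert.prems(4) by simp
      moreover have "(\<Sum>i\<in>insert j A. c i * \<chi> i (b * a)) = (\<Sum>i\<in>insert j A. c i * \<chi> i b * \<chi> i a)"
        using insert.prems(2) by (intro sum.cong refl) (simp add: mult.assoc)
      ultimately have "(\<Sum>i\<in>insert j A. c i * \<chi> i b * \<chi> i a - \<chi> j b * (c i * \<chi> i a)) = 0"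
        by (simp only: sum_subtractf sum_distrib_left)
      moreover have "c i * \<chi> i b * \<chi> i a - \<chi> j b * (c i * \<chi> i a) = c i * (\<chi> i b - \<chi> j b) * \<chi> i a" for i
        by (simp add: algebra_simps)
      ultimately show ?thesis using insert.hyps by simp
    qed
    then have "c i * (\<chi> i b - \<chi> j b) = 0"
      by (intro insert.IH[of "\<lambda>i. c i * (\<chi> i b - \<chi> j b)"]) (use insert.prems i in auto)
    then show ?thesis using b by simp
  qed
  have "c j = 0" using insert.prems(3)[of j] insert.prems(4)[of 1] insert.hyps A by simp
  then show ?case using A insert.prems(5) by blast
qed simp

lemma (in skew_poly) funpow_inj: "\<sigma> ^^ i = \<sigma> ^^ j \<Longrightarrow> i \<le> j \<Longrightarrow> \<sigma> ^^ (j - i) = id"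
proof
  fix a assume eq: "\<sigma> ^^ i = \<sigma> ^^ j" and le: "i \<le> j"
  have "(\<sigma> ^^ i) ((\<sigma> ^^ (j - i)) a) = (\<sigma> ^^ (i + (j - i))) a" by (simp add: funpow_add)
  also have "\<dots> = (\<sigma> ^^ i) a" using le eq by simp
  finally have "(\<sigma> ^^ i) ((\<sigma> ^^ (j - i)) a - a) = 0"
    using funpow_add'[of i "(\<sigma> ^^ (j - i)) a" "- a"] by (simp add: funpow_minus)
  then show "(\<sigma> ^^ (j - i)) a = id a" by simp
qed

text \<open>Artin's argument. More than \<open>n\<close> distinct powers of \<open>\<sigma>\<close>
  would be linearly dependent, since a map of this kind is determined by \<open>n\<close> basis
  vectors; conversely traces show that the order is not below \<open>n\<close>.\<close>

lemma (in skew_poly) order_eq_dimension: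
  assumes K: "subfield K ambient_field" and fixed: "\<And>a. \<sigma> a = a \<longleftrightarrow> a \<in> K"
    and dim: "ambient.dimension n K UNIV"
  shows "n > 0" "\<sigma> ^^ i = id \<longleftrightarrow> n dvd i"
proof -
  obtain bs where bs: "basis_of K UNIV bs" "length bs = n" using basis_exists[OF K dim] .
  have fixK: "(\<sigma> ^^ i) a = a" if "a \<in> K" for i a using fixed that by (induction i) auto
  have expand: "(\<sigma> ^^ i) (\<Sum>j<n. c j * bs ! j) = (\<Sum>j<n. c j * (\<sigma> ^^ i) (bs ! j))" if "\<And>j. j < n \<Longrightarrow> c j \<in> K" for c i
    using that by (simp add: funpow_sum funpow_mult' fixK)
  have ded: "c i = 0" if "inj_on (\<lambda>i. \<sigma> ^^ i) {..<r}" "\<And>a. (\<Sum>i<r. c i * (\<sigma> ^^ i) a) = 0" "i < r" for c r i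
    using dedekind_independence[of "{..<r}" "\<lambda>i. \<sigma> ^^ i" c i] that by (simp add: funpow_mult')
  have le: "r \<le> n" if inj: "inj_on (\<lambda>i. \<sigma> ^^ i) {..<r}" for r
  proof (rule ccontr)
    assume "\<not> r \<le> n"
    then obtain x where x: "\<exists>j<r. x j \<noteq> 0" "\<And>i. i < n \<Longrightarrow> (\<Sum>j<r. (\<sigma> ^^ j) (bs ! i) * x j) = 0"
      using underdetermined_system[of n r "\<lambda>i j. (\<sigma> ^^ j) (bs ! i)"] by auto
    have "(\<Sum>j<r. x j * (\<sigma> ^^ j) a) = 0" for a
    proof -
      obtain c where c: "\<And>i. i < n \<Longrightarrow> c i \<in> K" "a = (\<Sum>i<n. c i * bs ! i)"
        using basis_coeffs[OF K bs(1) UNIV_I, of a] bs(2) by metis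
      have "(\<Sum>j<r. x j * (\<sigma> ^^ j) a) = (\<Sum>j<r. \<Sum>i<n. x j * (c i * (\<sigma> ^^ j) (bs ! i)))"
        unfolding c(2) by (simp add: expand c(1) sum_distrib_left)
      also have "\<dots> = (\<Sum>i<n. \<Sum>j<r. x j * (c i * (\<sigma> ^^ j) (bs ! i)))" by (rule sum.swap)
      also have "\<dots> = (\<Sum>i<n. c i * (\<Sum>j<r. (\<sigma> ^^ j) (bs ! i) * x j))"
        by (simp add: sum_distrib_left mult_ac)
      also have "\<dots> = 0" using x(2) by simp
      finally show ?thesis .
    qed
    then show False using ded[OF inj] x(1) by blast
  qed
  have "\<exists>r>0. \<sigma> ^^ r = id"
  proof (rule ccontr)
    assume no: "\<not> (\<exists>r>0. \<sigma> ^^ r = id)"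
    have "inj_on (\<lambda>i. \<sigma> ^^ i) {..<Suc n}"
    proof (rule linorder_inj_onI)
      fix i j :: nat assume "i < j"
      then show "\<sigma> ^^ i \<noteq> \<sigma> ^^ j" using no funpow_inj[of i j] by (metis less_imp_le zero_less_diff)
    qed auto
    then show False using le by fastforce
  qed
  define r where "r = (LEAST r. r > 0 \<and> \<sigma> ^^ r = id)"
  have r: "r > 0" "\<sigma> ^^ r = id"
    using LeastI_ex[OF \<open>\<exists>r>0. \<sigma> ^^ r = id\<close>] unfolding r_def by auto
  have least: "r \<le> i" if "i > 0" "\<sigma> ^^ i = id" for i unfolding r_def using that by (intro Least_le) auto
  have inj: "inj_on (\<lambda>i. \<sigma> ^^ i) {..<r}"
  proof (rule linorder_inj_onI)
    fix i j :: nat assume "i < j" "i \<in> {..<r}" "j \<in> {..<r}"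
    then show "\<sigma> ^^ i \<noteq> \<sigma> ^^ j" using least[of "j - i"] funpow_inj[of i j] by fastforce
  qed auto
  \<comment> \<open>The trace over the powers of \<open>\<sigma>\<close>; its values are fixed by
    \<open>\<sigma>\<close> and so lie in \<open>K\<close>.\<close>
  define T where "T a = (\<Sum>i<r. (\<sigma> ^^ i) a)" for a
  have TK: "T a \<in> K" for a
  proof -
    have "\<sigma> (T a) = (\<Sum>i<r. (\<sigma> ^^ Suc i) a)" using funpow_sum[of 1] by (simp add: T_def)
    also have "\<dots> = (\<Sum>i<Suc r. (\<sigma> ^^ i) a) - a" by (subst sum.lessThan_Suc_shift) simp
    also have "\<dots> = T a" using r(2) by (simp add: T_def)
    finally show ?thesis using fixed by simp
  qed
  have mult_id: "(\<sigma> ^^ (r * q)) a = a" for q a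
    using r(2) by (induction q) (simp_all add: funpow_add)
  have "n \<le> r"
  proof (rule ccontr)
    assume "\<not> n \<le> r"
    then obtain x where x: "\<exists>j<n. x j \<noteq> 0" "\<And>i. i < r \<Longrightarrow> (\<Sum>j<n. (\<sigma> ^^ i) (bs ! j) * x j) = 0"
      using underdetermined_system[of r n "\<lambda>i j. (\<sigma> ^^ i) (bs ! j)"] by auto
    \<comment> \<open>Applying the powers of \<open>\<sigma>\<close> to the system and adding gives
      a relation among the basis with coefficients \<open>T (x j * a)\<close> in \<open>K\<close>.
      So \<open>T\<close> would vanish identically, against Dedekind's lemma.\<close>
    have Tx: "T (x j * a) = 0" if j: "j < n" for j a
    proof -
      have shifted: "(\<Sum>j<n. bs ! j * (\<sigma> ^^ i) (x j * a)) = 0" if i: "i < r" for i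
      proof -
        \<comment> \<open>The exponent inverse to \<open>i\<close> modulo \<open>r\<close>; the
          outer \<open>mod\<close> makes it 0 for \<open>i = 0\<close>.\<close>
        define i' where "i' = (r - i) mod r"
        have "\<exists>q. i + i' = r * q"
          using i by (cases "i = 0") (auto simp: i'_def intro: exI[of _ 0] exI[of _ 1])
        then have id: "(\<sigma> ^^ i) ((\<sigma> ^^ i') b) = b" for b
          using mult_id by (auto simp flip: funpow_add comp_apply[of "\<sigma> ^^ i" "\<sigma> ^^ i'"])
        have "i' < r" using r(1) by (simp add: i'_def)
        from x(2)[OF this] have "(\<Sum>j<n. (\<sigma> ^^ i') (bs ! j) * x j) * a = 0" by simp
        then have "(\<sigma> ^^ i) (\<Sum>j<n. (\<sigma> ^^ i') (bs ! j) * (x j * a)) = 0"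
          by (simp add: sum_distrib_right mult.assoc)
        then show ?thesis by (simp only: funpow_sum funpow_mult' id)
      qed
      have "(\<Sum>j<n. T (x j * a) * bs ! j) = (\<Sum>j<n. \<Sum>i<r. bs ! j * (\<sigma> ^^ i) (x j * a))"
        by (simp add: T_def sum_distrib_left mult.commute)
      also have "\<dots> = (\<Sum>i<r. \<Sum>j<n. bs ! j * (\<sigma> ^^ i) (x j * a))" by (rule sum.swap)
      also have "\<dots> = (\<Sum>j<n. 0 * bs ! j)" using shifted by simp
      finally show ?thesis
        using basis_unique[OF K bs(1), of "\<lambda>j. T (x j * a)" "\<lambda>_. 0" j] bs(2) TK subfield_closed(1)[OF K] j
        by simp
    qed
    obtain j where j: "j < n" "x j \<noteq> 0" using x(1) by blast
    have "T a = 0" for a using Tx[OF j(1), of "inverse (x j) * a"] j(2) by (simp flip: mult.assoc)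
    then have "(1::'l) = 0" using ded[OF inj, of "\<lambda>_. 1" 0] r(1) by (simp add: T_def)
    then show False by simp
  qed
  then have rn: "r = n" using le[OF inj] by simp
  show "n > 0" using r(1) rn by simp
  show "\<sigma> ^^ i = id \<longleftrightarrow> n dvd i"
  proof
    assume i: "\<sigma> ^^ i = id"
    have "(\<sigma> ^^ (r * (i div r) + i mod r)) a = a" for a using i by simp
    then have "(\<sigma> ^^ (i mod r)) a = a" for a unfolding funpow_add by (simp add: mult_id)
    then have "\<sigma> ^^ (i mod r) = id" by auto
    then have "i mod r = 0" using least[of "i mod r"] r(1) by (metis mod_less_divisor not_gr_zero not_le)
    then show "n dvd i" using rn by auto
  next
    assume "n dvd i"
    then show "\<sigma> ^^ i = id" using mult_id rn by (auto simp: dvd_def)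
  qed
qed

locale cyclic_extension = cyclic_skew_poly \<sigma> n for \<sigma> :: "'l::field \<Rightarrow> 'l" and n +
  fixes K :: "'l set"
  assumes subfield_K: "subfield K ambient_field"
    and fixed_iff: "\<sigma> a = a \<longleftrightarrow> a \<in> K"
    and dimension_K: "ambient.dimension n K UNIV"
begin

lemma funpow_K: "a \<in> K \<Longrightarrow> (\<sigma> ^^ i) a = a"
  by (simp add: funpow_fixed fixed_iff)

text \<open>Applying \<open>\<sigma>\<close> shifts the factors by one. Multiplying by a nonzero
  \<open>a\<close> completes both sides to the same longer product, which avoids reindexing modulo
  \<open>n\<close>.\<close>

lemma \<sigma>_prod_conjugates: "\<sigma> (\<Prod>i<n. (\<sigma> ^^ i) a) = (\<Prod>i<n. (\<sigma> ^^ i) a)"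
proof (cases "a = 0")
  case True
  then show ?thesis using n_pos by (simp add: power_0_left)
next
  case False
  have prod: "\<sigma> (prod g A) = (\<Prod>x\<in>A. \<sigma> (g x))" for g and A :: "nat set"
    by (induction A rule: infinite_finite_induct) (auto simp: \<sigma>_mult \<sigma>_one)
  have "a * \<sigma> (\<Prod>i<n. (\<sigma> ^^ i) a) = (\<Prod>i<Suc n. (\<sigma> ^^ i) a)"
    by (subst prod.lessThan_Suc_shift) (simp add: prod)
  also have "\<dots> = a * (\<Prod>i<n. (\<sigma> ^^ i) a)" by (simp add: funpow_dvd mult.commute del: funpow.simps)
  finally show ?thesis using False by simp
qed

text \<open>The matrix \<open>B\<close> of conjugates of the basis diagonalises multiplication by
  \<open>a\<close>: \<open>B A = C B\<close>, with the conjugates of \<open>a\<close> on the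
  diagonal of \<open>C\<close>.\<close>

lemma det_mult_mat_conjugates:
  assumes bs: "basis_of K UNIV bs" and A: "mult_mat K bs a A"
  shows "det A = (\<Prod>i<n. (\<sigma> ^^ i) a)"
proof -
  have len: "length bs = n"
    using ambient.dimension_is_inj[OF subfield_K _ dimension_K] ambient.dimensionI[OF subfield_K] bs
    unfolding basis_of_def by blast
  have Ac: "A \<in> carrier_mat n n" and AK: "\<And>i j. i < n \<Longrightarrow> j < n \<Longrightarrow> A $$ (i, j) \<in> K"
    and Am: "\<And>j. j < n \<Longrightarrow> a * bs ! j = (\<Sum>i<n. A $$ (i, j) * bs ! i)"
    using A len by (auto simp: mult_mat_def)
  define B where "B = mat n n (\<lambda>(i, j). (\<sigma> ^^ i) (bs ! j))"
  define C where "C = mat n n (\<lambda>(i, j). if i = j then (\<sigma> ^^ i) a else 0)"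
  have Bc: "B \<in> carrier_mat n n" and Cc: "C \<in> carrier_mat n n" by (simp_all add: B_def C_def)
  have "B * A = C * B"
  proof (rule eq_matI)
    fix i j assume "i < dim_row (C * B)" "j < dim_col (C * B)"
    then have ij: "i < n" "j < n" using Bc Cc by auto
    have "(B * A) $$ (i, j) = (\<Sum>k<n. (\<sigma> ^^ i) (bs ! k) * A $$ (k, j))"
      using ij Ac by (simp add: B_def scalar_prod_def atLeast0LessThan)
    also have "\<dots> = (\<sigma> ^^ i) (\<Sum>k<n. A $$ (k, j) * bs ! k)"
      unfolding funpow_sum using ij AK by (intro sum.cong refl) (simp add: funpow_mult' funpow_K mult.commute)
    also have "\<dots> = (\<sigma> ^^ i) a * (\<sigma> ^^ i) (bs ! j)" by (simp flip: Am[OF ij(2)] add: funpow_mult')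
    also have "\<dots> = (\<Sum>k<n. if k = i then (\<sigma> ^^ i) a * (\<sigma> ^^ i) (bs ! j) else 0)"
      using ij by (simp add: sum.delta)
    also have "\<dots> = (\<Sum>k<n. C $$ (i, k) * B $$ (k, j))"
      using ij by (intro sum.cong refl) (auto simp: C_def B_def)
    also have "\<dots> = (C * B) $$ (i, j)"
      using ij Bc Cc by (simp add: scalar_prod_def atLeast0LessThan)
    finally show "(B * A) $$ (i, j) = (C * B) $$ (i, j)" .
  qed (use Ac Bc Cc in auto)
  then have eq: "det B * det A = det B * det C"
    using det_mult[OF Bc Ac] det_mult[OF Cc Bc] by (metis mult.commute)
  have "det B \<noteq> 0"
  proof
    assume "det B = 0"
    then have "det (transpose_mat B) = 0" using det_transpose[OF Bc] by simp
    then obtain v where v: "v \<in> carrier_vec n" "v \<noteq> 0\<^sub>v n" "transpose_mat B *\<^sub>v v = 0\<^sub>v n"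
      using det_0_iff_vec_prod_zero[of "transpose_mat B" n] Bc by auto
    \<comment> \<open>A kernel vector of the transpose is a relation among the powers of
      \<open>\<sigma>\<close> on the basis, and by \<open>K\<close>-linearity on all of
      \<open>L\<close>.\<close>
    have row: "(\<Sum>i<n. (\<sigma> ^^ i) (bs ! j) * v $ i) = 0" if j: "j < n" for j
    proof -
      have "(transpose_mat B *\<^sub>v v) $ j = (\<Sum>i<n. (\<sigma> ^^ i) (bs ! j) * v $ i)"
        using j v(1) by (simp add: B_def scalar_prod_def atLeast0LessThan)
      then show ?thesis using v(3) j by simp
    qed
    have "(\<Sum>i<n. v $ i * (\<sigma> ^^ i) b) = 0" for b
    proof -
      obtain c where c: "\<And>i. i < n \<Longrightarrow> c i \<in> K" "b = (\<Sum>i<n. c i * bs ! i)"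
        using basis_coeffs[OF subfield_K bs UNIV_I, of b] len by metis
      have "(\<sigma> ^^ i) b = (\<Sum>j<n. c j * (\<sigma> ^^ i) (bs ! j))" for i
        unfolding c(2) by (simp add: funpow_sum funpow_mult' funpow_K c(1))
      then have "(\<Sum>i<n. v $ i * (\<sigma> ^^ i) b) = (\<Sum>i<n. \<Sum>j<n. v $ i * (c j * (\<sigma> ^^ i) (bs ! j)))"
        by (simp add: sum_distrib_left)
      also have "\<dots> = (\<Sum>j<n. \<Sum>i<n. v $ i * (c j * (\<sigma> ^^ i) (bs ! j)))" by (rule sum.swap)
      also have "\<dots> = (\<Sum>j<n. c j * (\<Sum>i<n. (\<sigma> ^^ i) (bs ! j) * v $ i))"
        by (simp add: sum_distrib_left mult_ac)
      finally show ?thesis using row by simp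
    qed
    moreover have "inj_on (\<lambda>i. \<sigma> ^^ i) {..<n}"
    proof (rule linorder_inj_onI)
      fix i j :: nat assume ij: "i < j" "i \<in> {..<n}" "j \<in> {..<n}"
      show "\<sigma> ^^ i \<noteq> \<sigma> ^^ j"
      proof
        assume "\<sigma> ^^ i = \<sigma> ^^ j"
        then have "n dvd j - i" using funpow_inj[of i j] order ij by simp
        then show False using ij by (auto dest: dvd_imp_le)
      qed
    qed auto
    ultimately have "v $ i = 0" if "i < n" for i
      using dedekind_independence[of "{..<n}" "\<lambda>i. \<sigma> ^^ i" "\<lambda>i. v $ i" i] that by (simp add: funpow_mult')
    then have "v = 0\<^sub>v n" using v(1) by (intro eq_vecI) auto
    then show False using v(2) by simp
  qed
  moreover have "det C = (\<Prod>i<n. (\<sigma> ^^ i) a)"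
  proof -
    have "upper_triangular C" by (auto simp: C_def intro: upper_triangularI)
    then show ?thesis
      using det_upper_triangular[OF _ Cc] by (simp add: C_def prod_list_diag_prod atLeast0LessThan)
  qed
  moreover have "det A = det C" using eq \<open>det B \<noteq> 0\<close> by simp
  ultimately show ?thesis by simp
qed

section \<open>Norms down to a subfield \<open>K'\<close> of \<open>K\<close>\<close>

context
  fixes K' :: "'l set" and r :: nat
  assumes subfield_K': "subfield K' ambient_field" and K'_sub: "K' \<subseteq> K"
    and dimension_K': "ambient.dimension r K' K"
begin

lemma K_mult_closed: "a \<in> K \<Longrightarrow> b \<in> K \<Longrightarrow> a * b \<in> K"
  by (rule subfield_closed(4)[OF subfield_K])

lemma field_norm_K_mult:
  assumes "a \<in> K" "b \<in> K"
  shows "field_norm K K' (a * b) = field_norm K K' a * field_norm K K' b"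
proof -
  obtain bs where bs: "basis_of K' K bs" using basis_exists[OF subfield_K' dimension_K'] .
  obtain A where A: "mult_mat K' bs a A" using mult_mat_exists[OF subfield_K' bs K_mult_closed[OF assms(1)]] .
  obtain B where B: "mult_mat K' bs b B" using mult_mat_exists[OF subfield_K' bs K_mult_closed[OF assms(2)]] .
  have "field_norm K K' (a * b) = det (A * B)"
    by (rule field_norm_eq[OF subfield_K' bs mult_mat_mult[OF subfield_K' A B]])
  also have "\<dots> = det A * det B" using A B by (intro det_mult) (auto simp: mult_mat_def)
  finally show ?thesis
    using field_norm_eq[OF subfield_K' bs A] field_norm_eq[OF subfield_K' bs B] by simp
qed

lemma field_norm_K_one: "field_norm K K' 1 = 1"
proof -
  obtain bs where bs: "basis_of K' K bs" using basis_exists[OF subfield_K' dimension_K'] .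
  show ?thesis using field_norm_eq[OF subfield_K' bs mult_mat_one[OF subfield_K']] by simp
qed

lemma dimension_pos: "r > 0"
proof (rule ccontr)
  assume "\<not> r > 0"
  then have "ambient.dimension 0 K' K" using dimension_K' by simp
  then have "K = {0}" using ambient.dimension_zero[OF subfield_K'] by simp
  then show False using subfield_closed(2)[OF subfield_K] by simp
qed

text \<open>Transitivity of the norm, with \<open>N_{L/K}\<close> already written as a product of
  conjugates. In a product basis the matrix over \<open>K'\<close> is the blow-up of the matrix over
  \<open>K\<close>.\<close>

lemma field_norm_tower: "field_norm UNIV K' a = field_norm K K' (\<Prod>i<n. (\<sigma> ^^ i) a)"
proof -
  obtain as where as: "basis_of K UNIV as" "length as = n" using basis_exists[OF subfield_K dimension_K] .
  obtain bs where bs: "basis_of K' K bs" "length bs = r" using basis_exists[OF subfield_K' dimension_K'] .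
  \<comment> \<open>The product basis, numbered so that the position splits by \<open>div r\<close>
    and \<open>mod r\<close> just as in \<open>blow_up\<close>.\<close>
  define cs where "cs = map (\<lambda>t. as ! (t div r) * bs ! (t mod r)) [0..<n * r]"
  have len: "length cs = n * r" by (simp add: cs_def)
  have cs_nth: "cs ! (i * r + j) = as ! i * bs ! j" if "i < n" "j < r" for i j
  proof -
    have "i * r + j < Suc i * r" using that by simp
    also have "\<dots> \<le> n * r" using that by (intro mult_le_mono1) simp
    finally show ?thesis using that by (simp add: cs_def)
  qed
  have index: "i * r + j < n * r" if "i < n" "j < r" for i j
  proof -
    have "i * r + j < Suc i * r" using that by simp
    also have "\<dots> \<le> n * r" using that by (intro mult_le_mono1) simp
    finally show ?thesis .
  qed
  have bsK: "bs ! j \<in> K" if "j < r" for j using basis_nth_mem[OF subfield_K' bs(1)] bs(2) that by simp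
  have sum_cs: "(\<Sum>t<n * r. c t * cs ! t) = (\<Sum>i<n. (\<Sum>j<r. c (i * r + j) * bs ! j) * as ! i)" for c
    unfolding sum_blocks by (intro sum.cong refl) (simp add: cs_nth sum_distrib_left mult_ac)
  have basis: "basis_of K' UNIV cs"
  proof (rule basis_ofI[OF subfield_K'], unfold len)
    fix c t assume c: "\<And>t. t < n * r \<Longrightarrow> c t \<in> K'" "(\<Sum>t<n * r. c t * cs ! t) = 0" and t: "t < n * r"
    have memK: "(\<Sum>j<r. c (i * r + j) * bs ! j) \<in> K" if "i < n" for i
      using that c(1) index bsK K'_sub by (intro subfield_sum[OF subfield_K] K_mult_closed) auto
    have "(\<Sum>j<r. c (i * r + j) * bs ! j) = 0" if "i < n" for i
      using basis_unique[OF subfield_K as(1), of "\<lambda>i. \<Sum>j<r. c (i * r + j) * bs ! j" "\<lambda>_. 0" i]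
        memK that c(2) subfield_closed(1)[OF subfield_K] unfolding sum_cs as(2) by simp
    then have "c (i * r + j) = 0" if "i < n" "j < r" for i j
      using basis_unique[OF subfield_K' bs(1), of "\<lambda>j. c (i * r + j)" "\<lambda>_. 0" j] that c(1) index
        subfield_closed(1)[OF subfield_K'] bs(2) by simp
    moreover have "t div r < n" "t mod r < r" using t dimension_pos by (simp_all add: less_mult_imp_div_less)
    ultimately have "c (t div r * r + t mod r) = 0" by blast
    then show "c t = 0" by simp
  next
    fix b
    obtain d where d: "\<And>i. i < n \<Longrightarrow> d i \<in> K" "b = (\<Sum>i<n. d i * as ! i)"
      using basis_coeffs[OF subfield_K as(1) UNIV_I, of b] as(2) by metis
    have "\<forall>i. \<exists>e. i < n \<longrightarrow> (\<forall>j<r. e j \<in> K') \<and> d i = (\<Sum>j<r. e j * bs ! j)"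
      using basis_coeffs[OF subfield_K' bs(1) d(1)] bs(2) by metis
    then obtain e where e: "\<And>i j. i < n \<Longrightarrow> j < r \<Longrightarrow> e i j \<in> K'" "\<And>i. i < n \<Longrightarrow> d i = (\<Sum>j<r. e i j * bs ! j)"
      by metis
    have "b = (\<Sum>t<n * r. e (t div r) (t mod r) * cs ! t)"
      unfolding sum_cs d(2) by (intro sum.cong refl) (simp add: e(2) dimension_pos)
    then show "\<exists>c. (\<forall>i<n * r. c i \<in> K') \<and> b = (\<Sum>i<n * r. c i * cs ! i)"
      using e(1) dimension_pos by (intro exI[of _ "\<lambda>t. e (t div r) (t mod r)"]) (simp add: less_mult_imp_div_less)
  qed
  \<comment> \<open>The choice is harmless: the matrix is unique, and uniqueness is also what makes
    \<open>\<chi>\<close> additive and multiplicative.\<close>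
  define \<chi> where "\<chi> c = (SOME A. mult_mat K' bs c A)" for c
  have \<chi>: "mult_mat K' bs c (\<chi> c)" if c: "c \<in> K" for c
    unfolding \<chi>_def using mult_mat_exists[OF subfield_K' bs(1) K_mult_closed[OF c]] by (metis someI_ex)
  interpret rep: matrix_rep r K \<chi>
  proof unfold_locales
    show "\<chi> c \<in> carrier_mat r r" if "c \<in> K" for c using \<chi>[OF that] bs(2) by (simp add: mult_mat_def)
    show "\<chi> (c + d) = \<chi> c + \<chi> d" if "c \<in> K" "d \<in> K" for c d
      by (rule mult_mat_unique[OF subfield_K' bs(1) \<chi> mult_mat_add[OF subfield_K' \<chi> \<chi>]])
         (use that subfield_closed(3)[OF subfield_K] in auto)
    show "\<chi> (c * d) = \<chi> c * \<chi> d" if "c \<in> K" "d \<in> K" for c d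
      by (rule mult_mat_unique[OF subfield_K' bs(1) \<chi> mult_mat_mult[OF subfield_K' \<chi> \<chi>]])
         (use that K_mult_closed in auto)
    show "\<chi> 1 = 1\<^sub>m r"
      using mult_mat_unique[OF subfield_K' bs(1) \<chi> mult_mat_one[OF subfield_K']]
        subfield_closed(2)[OF subfield_K] bs(2) by simp
  qed (use dimension_pos subfield_closed[OF subfield_K] in auto)
  obtain A where A: "mult_mat K as a A" using mult_mat_exists[OF subfield_K as(1), of a] by blast
  have Ac: "A \<in> carrier_mat n n" and AK: "\<And>i j. i < n \<Longrightarrow> j < n \<Longrightarrow> A $$ (i, j) \<in> K"
    and Am: "\<And>j. j < n \<Longrightarrow> a * as ! j = (\<Sum>i<n. A $$ (i, j) * as ! i)"
    using A as(2) by (auto simp: mult_mat_def)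
  have over: "rep.over_K A" using Ac AK by (auto simp: rep.over_K_def)
  have \<chi>m: "c * bs ! j = (\<Sum>i<r. \<chi> c $$ (i, j) * bs ! i)" "i < r \<Longrightarrow> \<chi> c $$ (i, j) \<in> K'"
    if "c \<in> K" "j < r" for c i j using \<chi>[OF that(1)] that(2) bs(2) by (auto simp: mult_mat_def)
  have "mult_mat K' cs a (blow_up r \<chi> A)"
    unfolding mult_mat_def len
  proof (intro conjI allI impI)
    show "blow_up r \<chi> A \<in> carrier_mat (n * r) (n * r)" by (rule blow_up_carrier[OF Ac])
    fix u assume u: "u < n * r"
    then have ud: "u div r < n" "u mod r < r" using dimension_pos by (simp_all add: less_mult_imp_div_less)
    have "a * cs ! u = a * cs ! (u div r * r + u mod r)" by simp
    also have "\<dots> = (a * as ! (u div r)) * bs ! (u mod r)" unfolding cs_nth[OF ud] by (simp add: mult.assoc)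
    also have "\<dots> = (\<Sum>i<n. A $$ (i, u div r) * bs ! (u mod r) * as ! i)"
      unfolding Am[OF ud(1)] sum_distrib_right by (intro sum.cong refl) (simp add: mult_ac)
    also have "\<dots> = (\<Sum>i<n. (\<Sum>j<r. blow_up r \<chi> A $$ (i * r + j, u) * bs ! j) * as ! i)"
    proof (intro sum.cong refl arg_cong2[of _ _ _ _ "(*)"])
      fix i assume "i \<in> {..<n}"
      then have i: "i < n" by simp
      show "A $$ (i, u div r) * bs ! (u mod r) = (\<Sum>j<r. blow_up r \<chi> A $$ (i * r + j, u) * bs ! j)"
        unfolding \<chi>m(1)[OF AK[OF i ud(1)] ud(2)]
        by (intro sum.cong refl) (use i u index in \<open>simp add: rep.blow_up_entry[OF Ac]\<close>)
    qed
    also have "\<dots> = (\<Sum>t<n * r. blow_up r \<chi> A $$ (t, u) * cs ! t)" by (rule sum_cs[symmetric])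
    finally show "a * cs ! u = (\<Sum>t<n * r. blow_up r \<chi> A $$ (t, u) * cs ! t)" .
    fix t assume t: "t < n * r"
    then have td: "t div r < n" "t mod r < r" using dimension_pos by (simp_all add: less_mult_imp_div_less)
    show "blow_up r \<chi> A $$ (t, u) \<in> K'"
      unfolding rep.blow_up_entry[OF Ac t u] using \<chi>m(2)[OF AK[OF td(1) ud(1)] ud(2) td(2)] .
  qed
  from field_norm_eq[OF subfield_K' basis this]
  have "field_norm UNIV K' a = det (blow_up r \<chi> A)" .
  also have "\<dots> = det (\<chi> (det A))" using rep.det_blow_up[OF Ac over] by simp
  also have "\<dots> = field_norm K K' (det A)"
    using field_norm_eq[OF subfield_K' bs(1) \<chi>] rep.det_blow_up[OF Ac over] by simp
  finally show ?thesis using det_mult_mat_conjugates[OF as(1) A] by simp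
qed

lemma prod_conjugates_mem: "(\<Prod>i<n. (\<sigma> ^^ i) a) \<in> K"
  using \<sigma>_prod_conjugates fixed_iff by simp

lemma field_norm_mult: "field_norm UNIV K' (a * b) = field_norm UNIV K' a * field_norm UNIV K' b"
  unfolding field_norm_tower
  by (subst field_norm_K_mult[symmetric]) (simp_all add: prod_conjugates_mem funpow_mult' prod.distrib)

lemma field_norm_nonzero:
  assumes "a \<noteq> 0"
  shows "field_norm UNIV K' a \<noteq> 0"
proof
  assume "field_norm UNIV K' a = 0"
  then have "field_norm UNIV K' (a * inverse a) = 0" by (simp only: field_norm_mult mult_zero_left)
  moreover have "field_norm UNIV K' (a * inverse a) = field_norm K K' (\<Prod>i<n. 1)"
    using assms unfolding field_norm_tower by simp
  ultimately show False using field_norm_K_one by simp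
qed

lemma dimension_over_K': "ambient.dimension (r * n) K' UNIV"
  by (rule ambient.telescopic_base[OF subfield_K' subfield_K dimension_K' dimension_K])

text \<open>\<open>\<rho>\<close> carries a \<open>K'\<close>-basis of \<open>L\<close> to another
  one. Entries in \<open>K'\<close> are fixed, so one matrix describes \<open>a\<close> in the old
  basis and \<open>\<rho> a\<close> in the new.\<close>

lemma field_norm_automorphism:
  assumes \<rho>: "\<rho> \<in> ring_iso ambient_field ambient_field" and fixes_base: "\<And>a. a \<in> K' \<Longrightarrow> \<rho> a = a"
  shows "field_norm UNIV K' (\<rho> a) = field_norm UNIV K' a"
proof -
  note \<rho>D = ring_iso_ambientD[OF \<rho>]
  obtain bs where bs: "basis_of K' UNIV bs" using basis_exists[OF subfield_K' dimension_over_K'] .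
  obtain A where A: "mult_mat K' bs a A" using mult_mat_exists[OF subfield_K' bs, of a] by blast
  have \<rho>0: "\<rho> 0 = 0" using \<rho>D(1)[of 0 0] by (metis add.right_neutral add_left_imp_eq)
  have \<rho>_sum: "\<rho> (sum g S) = (\<Sum>x\<in>S. \<rho> (g x))" for g and S :: "nat set"
    by (induction S rule: infinite_finite_induct) (auto simp: \<rho>D(1) \<rho>0)
  have lin: "(\<Sum>i<length bs. c i * \<rho> (bs ! i)) = \<rho> (\<Sum>i<length bs. c i * bs ! i)"
    if "\<And>i. i < length bs \<Longrightarrow> c i \<in> K'" for c
    using that by (simp add: \<rho>_sum \<rho>D(2) fixes_base)
  have basis: "basis_of K' UNIV (map \<rho> bs)"
  proof (rule basis_ofI[OF subfield_K'], unfold length_map)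
    fix c i assume c: "\<And>i. i < length bs \<Longrightarrow> c i \<in> K'" "(\<Sum>i<length bs. c i * map \<rho> bs ! i) = 0" and i: "i < length bs"
    have "\<rho> (\<Sum>i<length bs. c i * bs ! i) = \<rho> 0" using c(2) lin[OF c(1)] \<rho>0 by simp
    then have "(\<Sum>i<length bs. c i * bs ! i) = (\<Sum>i<length bs. 0 * bs ! i)"
      using \<rho>D(4) by (simp add: bij_is_inj inj_eq)
    then show "c i = 0"
      using basis_unique[OF subfield_K' bs, of c "\<lambda>_. 0" i] c(1) i subfield_closed(1)[OF subfield_K'] by blast
  next
    fix b
    obtain b' where b': "b = \<rho> b'" using \<rho>D(4) by (metis bij_pointE)
    obtain c where c: "\<And>i. i < length bs \<Longrightarrow> c i \<in> K'" "b' = (\<Sum>i<length bs. c i * bs ! i)"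
      using basis_coeffs[OF subfield_K' bs UNIV_I, of b'] by blast
    then have "b = (\<Sum>i<length bs. c i * map \<rho> bs ! i)" using lin[OF c(1)] b' by simp
    then show "\<exists>c. (\<forall>i<length bs. c i \<in> K') \<and> b = (\<Sum>i<length bs. c i * map \<rho> bs ! i)" using c(1) by blast
  qed
  have "mult_mat K' (map \<rho> bs) (\<rho> a) A"
    unfolding mult_mat_def length_map
  proof (intro conjI allI impI)
    show "A \<in> carrier_mat (length bs) (length bs)" using A by (simp add: mult_mat_def)
    fix j assume j: "j < length bs"
    show AK: "A $$ (i, j) \<in> K'" if "i < length bs" for i using A that j by (simp add: mult_mat_def)
    have "\<rho> a * map \<rho> bs ! j = \<rho> (a * bs ! j)" using j by (simp add: \<rho>D(2))
    also have "\<dots> = \<rho> (\<Sum>i<length bs. A $$ (i, j) * bs ! i)" using A j by (simp add: mult_mat_def)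
    also have "\<dots> = (\<Sum>i<length bs. A $$ (i, j) * map \<rho> bs ! i)" using lin[OF AK] by simp
    finally show "\<rho> a * map \<rho> bs ! j = (\<Sum>i<length bs. A $$ (i, j) * map \<rho> bs ! i)" .
  qed
  then show ?thesis
    using field_norm_eq[OF subfield_K' basis] field_norm_eq[OF subfield_K' bs A] by simp
qed

end
end

lemma cyclic_galois_extension:
  assumes "cyclic_galois K n \<sigma>"
  shows "cyclic_extension \<sigma> n K"
proof -
  have \<sigma>: "\<sigma> \<in> carrier (galois_group K)" and gen: "generate (galois_group K) {\<sigma>} = carrier (galois_group K)"
    and fixes_base: "{a. \<forall>\<tau>\<in>carrier (galois_group K). \<tau> a = a} = K"
    and K: "subfield K ambient_field" and dim: "ambient.dimension n K UNIV"
    using assms by (auto simp: cyclic_galois_def)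
  have iso: "\<sigma> \<in> ring_iso ambient_field ambient_field" "\<And>a. a \<in> K \<Longrightarrow> \<sigma> a = a"
    using \<sigma> by (auto simp: galois_group_def)
  interpret skew_poly \<sigma> by unfold_locales (use ring_iso_ambientD[OF iso(1)] in auto)
  have fixed: "\<sigma> a = a \<longleftrightarrow> a \<in> K" for a
  proof
    assume "\<sigma> a = a"
    then have "\<forall>\<tau>\<in>carrier (galois_group K). \<tau> a = a" using generator_fixed[OF gen \<sigma>] by blast
    then show "a \<in> K" using fixes_base by blast
  qed (rule iso(2))
  show ?thesis
    by (intro cyclic_extension.intro cyclic_skew_poly.intro cyclic_skew_poly_axioms.intro
        cyclic_extension_axioms.intro skew_poly_axioms order_eq_dimension[OF K fixed dim] K fixed dim)
qed

section \<open>The central polynomial and its factors\<close>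

context skew_poly begin

text \<open>In a domain a central product may be rotated cyclically: from \<open>P a = a P\<close>
  the factor \<open>a\<close> cancels. Any inner factor of \<open>P\<close> is thus also a right and
  a left factor.\<close>

lemma skew_factor_two_sided:
  assumes central: "\<And>q. P \<star> q = q \<star> P" and nz: "P \<noteq> 0" and P: "P = (a \<star> h) \<star> b"
  shows "\<exists>u. P = u \<star> h \<and> P = h \<star> u"
proof -
  have a0: "a \<noteq> 0" and h0: "h \<noteq> 0" using nz unfolding P by simp_all
  have "a \<star> (h \<star> (b \<star> a)) = P \<star> a" unfolding P by (simp only: skew_mult_assoc)
  also have "\<dots> = a \<star> P" by (rule central)
  finally have P1: "h \<star> (b \<star> a) = P" by (rule skew_mult_cancel_left[OF a0])
  have "h \<star> ((b \<star> a) \<star> h) = (h \<star> (b \<star> a)) \<star> h" by (rule skew_mult_assoc[symmetric])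
  also have "\<dots> = P \<star> h" by (simp only: P1)
  also have "\<dots> = h \<star> P" by (rule central)
  finally have "(b \<star> a) \<star> h = P" by (rule skew_mult_cancel_left[OF h0])
  then show ?thesis using P1 by metis
qed

lemma degree_foldr_skew_mult:
  assumes "\<And>h. h \<in> set fs \<Longrightarrow> h \<noteq> 0 \<and> degree h = d"
  shows "foldr (skew_mult \<sigma>) fs 1 \<noteq> 0 \<and> degree (foldr (skew_mult \<sigma>) fs 1) = length fs * d"
  using assms
proof (induction fs)
  case (Cons h fs)
  then have "h \<noteq> 0" "degree h = d" "foldr (skew_mult \<sigma>) fs 1 \<noteq> 0"
    "degree (foldr (skew_mult \<sigma>) fs 1) = length fs * d" by simp_all
  then show ?case using degree_skew_mult[of h "foldr (skew_mult \<sigma>) fs 1"] by simp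
qed simp

lemma foldr_skew_mult_append:
  "foldr (skew_mult \<sigma>) (xs @ ys) 1 = foldr (skew_mult \<sigma>) xs 1 \<star> foldr (skew_mult \<sigma>) ys 1"
  by (induction xs) (auto simp: skew_mult_assoc)

end

context skew_simple_module begin

text \<open>As \<open>h u = P\<close> kills \<open>V\<close>, \<open>h\<close> kills a nonzero
  vector of the form \<open>u v\<close>. The annihilator of that vector has a generator of degree
  \<open>degree f\<close>, and it divides the irreducible \<open>h\<close>.\<close>

lemma irreducible_factor_degree:
  assumes h: "skew_irreducible \<sigma> h" and u: "P = u \<star> h" "P = h \<star> u"
  shows "degree h = degree f"
proof -
  have nz: "u \<noteq> 0" "h \<noteq> 0" using u(1) P_nz by auto
  have "degree h > 0" using h nz unfolding skew_irreducible_def Units_skew_poly_ring by simp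
  moreover have "degree P = degree u + degree h" unfolding u(1) by (rule degree_skew_mult[OF nz])
  \<comment> \<open>A nonzero \<open>u\<close> of degree below that of \<open>P\<close> cannot
    annihilate all of \<open>V\<close>.\<close>
  ultimately have "\<not> right_dvd P u" using right_dvd_degree[OF _ nz(1), of P] by linarith
  then obtain v where v: "\<not> right_dvd f (u \<star> v)" using faithful by blast
  obtain g where g: "lead_coeff g = 1" "degree g = degree f"
    "\<And>a. right_dvd f (a \<star> (u \<star> v)) \<longleftrightarrow> right_dvd g a" using annihilator[OF v] by blast
  have "h \<star> (u \<star> v) = (h \<star> u) \<star> v" by (rule skew_mult_assoc[symmetric])
  also have "\<dots> = P \<star> v" by (simp only: u(2))
  also have "\<dots> = v \<star> P" by (rule P_central)
  finally have "h \<star> (u \<star> v) = v \<star> P" .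
  then have "right_dvd g h" using g(3)[of h] right_dvd_mult[OF f_dvd_P, of v] by simp
  then obtain q where q: "h = q \<star> g" by (auto simp: right_dvd_def)
  then have "q \<noteq> 0" "g \<noteq> 0" using nz by auto
  moreover have "q \<noteq> 0 \<and> degree q = 0 \<or> g \<noteq> 0 \<and> degree g = 0"
    using h q unfolding skew_irreducible_def Units_skew_poly_ring by blast
  then have "degree q = 0" using g(2) degree_f_pos by auto
  ultimately show ?thesis using g(2) by (simp add: q degree_skew_mult)
qed

lemma factor_count_degree:
  assumes "irreducible_factor_count \<sigma> P m"
  shows "m * degree f = degree P"
proof -
  obtain fs where fs: "length fs = m" "\<forall>h\<in>set fs. skew_irreducible \<sigma> h" "P = foldr (skew_mult \<sigma>) fs 1"
    using assms by (auto simp: irreducible_factor_count_def)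
  have "h \<noteq> 0 \<and> degree h = degree f" if h: "h \<in> set fs" for h
  proof -
    obtain xs ys where "fs = xs @ h # ys" using h by (meson split_list)
    then have "P = (foldr (skew_mult \<sigma>) xs 1 \<star> h) \<star> foldr (skew_mult \<sigma>) ys 1"
      using fs(3) foldr_skew_mult_append[of xs "h # ys"] by (simp add: skew_mult_assoc)
    then obtain u where "P = u \<star> h" "P = h \<star> u"
      using skew_factor_two_sided[OF P_central P_nz] by blast
    then have "degree h = degree f" using irreducible_factor_degree fs(2) h by blast
    moreover have "h \<noteq> 0" using fs(2) h unfolding skew_irreducible_def by blast
    ultimately show ?thesis by simp
  qed
  then show ?thesis using degree_foldr_skew_mult[of fs "degree f"] fs(1,3) by simp
qed

end

section \<open>Passing between \<open>F(y)\<close> and \<open>F(x^n)\<close>\<close>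

context cyclic_extension begin

lemma coeff_subst_power: "coeff (subst_power n F) k = (if n dvd k then coeff F (k div n) else 0)"
proof -
  have "coeff (subst_power n F) k = (\<Sum>i\<le>degree F. if i = k div n then (if n dvd k then coeff F i else 0) else 0)"
    unfolding subst_power_def coeff_sum using n_pos by (intro sum.cong refl) auto
  then show ?thesis by (auto simp: sum.delta coeff_eq_0)
qed

lemma degree_subst_power: "degree (subst_power n F) = n * degree F"
proof (rule antisym)
  show "degree (subst_power n F) \<le> n * degree F"
    using n_pos by (intro degree_le allI impI)
      (auto simp: coeff_subst_power dvd_def intro!: coeff_eq_0)
  show "n * degree F \<le> degree (subst_power n F)"
    using n_pos by (cases "F = 0") (auto simp: coeff_subst_power intro!: le_degree)
qed

text \<open>On \<open>K[x^n]\<close> this inverts the substitution of \<open>x^n\<close> for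
  \<open>y\<close>. It moves factorizations of \<open>P\<close> in \<open>K[x^n]\<close> to
  factorizations of \<open>F\<close>.\<close>

definition contract :: "'l poly \<Rightarrow> 'l poly" where
  "contract p = (\<Sum>i\<le>degree p. monom (coeff p (n * i)) i)"

lemma coeff_contract: "coeff (contract p) k = coeff p (n * k)"
proof -
  have "coeff (contract p) k = (\<Sum>i\<le>degree p. if i = k then coeff p (n * k) else 0)"
    unfolding contract_def coeff_sum by (intro sum.cong refl) auto
  moreover have "coeff p (n * k) = 0" if "degree p < k"
  proof (rule coeff_eq_0)
    have "1 * k \<le> n * k" using n_pos by (intro mult_le_mono1) simp
    then show "degree p < n * k" using that by linarith
  qed
  ultimately show ?thesis by (auto simp: sum.delta)
qed

lemma contract_subst_power: "contract (subst_power n F) = F"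
  using n_pos by (intro poly_eqI) (simp add: coeff_contract coeff_subst_power)

lemma subst_power_contract: "p \<in> central \<Longrightarrow> subst_power n (contract p) = p"
  using centralD(2)[of p] by (intro poly_eqI) (auto simp: coeff_contract coeff_subst_power)

lemma contract_mult:
  assumes "p \<in> central"
  shows "contract (p * q) = contract p * contract q"
proof (rule poly_eqI)
  fix k
  have "coeff (contract (p * q)) k = (\<Sum>i\<le>n * k. coeff p i * coeff q (n * k - i))"
    by (simp add: coeff_contract coeff_mult)
  also have "\<dots> = (\<Sum>i\<in>(\<lambda>i. n * i) ` {..k}. coeff p i * coeff q (n * k - i))"
  proof (rule sum.mono_neutral_right)
    show "\<forall>i\<in>{..n * k} - (\<lambda>i. n * i) ` {..k}. coeff p i * coeff q (n * k - i) = 0"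
    proof
      fix i assume i: "i \<in> {..n * k} - (\<lambda>i. n * i) ` {..k}"
      have "\<not> n dvd i"
      proof
        assume "n dvd i"
        then obtain j where "i = n * j" by (auto simp: dvd_def)
        then show False using i n_pos by auto
      qed
      then show "coeff p i * coeff q (n * k - i) = 0" using centralD(2)[OF assms, of i] by auto
    qed
  qed auto
  also have "\<dots> = (\<Sum>i\<le>k. coeff p (n * i) * coeff q (n * k - n * i))"
    using n_pos by (subst sum.reindex) (auto simp: inj_on_def)
  also have "\<dots> = coeff (contract p * contract q) k"
    by (simp add: coeff_mult coeff_contract right_diff_distrib')
  finally show "coeff (contract (p * q)) k = coeff (contract p * contract q) k" .
qed

lemma contract_mem: "p \<in> central \<Longrightarrow> contract p \<in> carrier (poly_ring_over K)"
  by (auto simp: poly_ring_over_def coeff_contract centralD fixed_iff[symmetric])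

lemma subst_power_central:
  "F \<in> carrier (poly_ring_over K) \<Longrightarrow> subst_power n F \<in> central"
  using subfield_closed(1)[OF subfield_K]
  by (auto simp: poly_ring_over_def central_def coeff_subst_power fixed_iff range_subsetD split: if_splits)

text \<open>Irreducibility is stated through proper factors: either \<open>A\<close> is one and
  hence a unit, or \<open>F\<close> divides \<open>A\<close> and cancelling \<open>F\<close> makes
  \<open>B\<close> a unit. Units have degree 0.\<close>

lemma poly_ring_over_irreducible_factor:
  assumes F: "ring_irreducible\<^bsub>poly_ring_over K\<^esub> F" and AB: "F = A * B"
    "A \<in> carrier (poly_ring_over K)" "B \<in> carrier (poly_ring_over K)"
  shows "degree A = 0 \<or> degree B = 0"
proof -
  have F0: "F \<noteq> 0" and irr: "Divisibility.irreducible (poly_ring_over K) F"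
    using F by (auto simp: ring_irreducible_def poly_ring_over_def)
  have unit: "degree U = 0" if "U * V = 1" for U V :: "'l poly"
  proof -
    have "U \<noteq> 0" "V \<noteq> 0" using that by auto
    then show ?thesis using degree_mult_eq[of U V] that by simp
  qed
  have div: "A divides\<^bsub>poly_ring_over K\<^esub> F" using AB by (auto simp: factor_def poly_ring_over_def)
  show ?thesis
  proof (cases "F divides\<^bsub>poly_ring_over K\<^esub> A")
    case True
    then obtain C where "A = F * C" by (auto simp: factor_def poly_ring_over_def)
    have "F * (B * C) = (F * C) * B" by (simp only: mult_ac)
    also have "\<dots> = F * 1" using AB(1) \<open>A = F * C\<close> by (metis mult_1_right)
    finally have "F * (B * C) = F * 1" .
    then have "B * C = 1" using F0 mult_left_cancel[of F "B * C" 1] by blast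
    then show ?thesis using unit[of B C] by simp
  next
    case False
    then have "A \<in> Units (poly_ring_over K)"
      using irr div AB(2) unfolding Divisibility.irreducible_def properfactor_def by blast
    then obtain C where "A * C = 1" by (auto simp: Units_def poly_ring_over_def)
    then show ?thesis using unit by blast
  qed
qed

lemma central_irreducible_subst_power:
  assumes FK: "F \<in> carrier (poly_ring_over K)" and monic: "lead_coeff F = 1"
    and irr: "ring_irreducible\<^bsub>poly_ring_over K\<^esub> F"
  shows "central_irreducible (subst_power n F)" "degree F > 0"
proof -
  have closed: "1 \<in> K" "0 \<in> K" using subfield_closed[OF subfield_K] by auto
  show pos: "degree F > 0"
  proof (rule ccontr)
    assume "\<not> degree F > 0"
    then have "F = 1" using monic by (auto elim!: degree_eq_zeroE simp: one_pCons)
    then have "F \<in> Units (poly_ring_over K)"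
      using FK by (auto simp: Units_def poly_ring_over_def intro!: bexI[of _ 1])
    then show False using irr by (simp add: ring_irreducible_def Divisibility.irreducible_def)
  qed
  show "central_irreducible (subst_power n F)"
    unfolding central_irreducible_def
  proof (intro conjI ballI impI)
    show "subst_power n F \<in> central" by (rule subst_power_central[OF FK])
    show "degree (subst_power n F) > 0" using pos n_pos by (simp add: degree_subst_power)
    fix a b assume ab: "a \<in> central" "b \<in> central" "subst_power n F = a * b"
    have "F = contract a * contract b"
      using contract_mult[OF ab(1), of b] contract_subst_power[of F] ab(3) by simp
    then have "degree (contract a) = 0 \<or> degree (contract b) = 0"
      by (rule poly_ring_over_irreducible_factor[OF irr _ contract_mem[OF ab(1)] contract_mem[OF ab(2)]])
    then show "degree a = 0 \<or> degree b = 0"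
      using degree_subst_power[of "contract a"] degree_subst_power[of "contract b"]
        subst_power_contract ab(1,2) by auto
  qed
qed

text \<open>A zero constant coefficient splits off the factor \<open>y\<close>, leaving only
  \<open>F = y\<close>. The nonzero constant term later makes \<open>R/RP\<close> simple and the
  constant terms of all factors of \<open>P\<close> nonzero.\<close>

lemma coeff_0_irreducible:
  assumes FK: "F \<in> carrier (poly_ring_over K)" and monic: "lead_coeff F = 1"
    and irr: "ring_irreducible\<^bsub>poly_ring_over K\<^esub> F" and ne: "F \<noteq> [:0, 1:]"
  shows "coeff F 0 \<noteq> 0"
proof
  assume c0: "coeff F 0 = 0"
  obtain a G where G: "F = pCons a G" by (cases F) auto
  then have a: "a = 0" using c0 by simp
  have "F = [:0, 1:] * G" using G a by simp
  have X: "[:0, 1:] \<in> carrier (poly_ring_over K)"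
    using subfield_closed[OF subfield_K] by (auto simp: poly_ring_over_def coeff_pCons split: nat.splits)
  have "coeff G k \<in> K" for k
  proof -
    have "coeff F (Suc k) \<in> K" using FK by (auto simp: poly_ring_over_def)
    then show ?thesis by (simp add: G)
  qed
  then have "G \<in> carrier (poly_ring_over K)" by (auto simp: poly_ring_over_def)
  from poly_ring_over_irreducible_factor[OF irr \<open>F = [:0, 1:] * G\<close> X this]
  have "degree G = 0" by simp
  then obtain c where "G = [:c:]" by (auto elim: degree_eq_zeroE)
  then show False using G a monic ne by (auto split: if_splits)
qed

text \<open>The annihilator of \<open>R/Rf\<close> is a two-sided ideal that contains
  \<open>P\<close> but not 1, so it lies in \<open>RP\<close> by
  \<open>two_sided_ideal_maximal\<close>.\<close>

lemma simple_module_of_factor: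
  assumes P: "central_irreducible P" "coeff P 0 \<noteq> 0"
    and f: "skew_irreducible \<sigma> f" "skew_factor \<sigma> f P"
  shows "skew_simple_module \<sigma> f P"
proof -
  have Pc: "P \<in> central" and P0: "P \<noteq> 0" using P by (auto simp: central_irreducible_def)
  obtain g h where "P = (g \<star> f) \<star> h" using f(2) by (auto simp: skew_factor_def)
  then obtain u where "P = u \<star> f" using skew_factor_two_sided[OF central_commute[OF Pc] P0] by blast
  then have dvd: "right_dvd f P" by (simp add: right_dvdI)
  have degf: "degree f > 0" "f \<noteq> 0"
    using f(1) Units_skew_poly_ring by (auto simp: skew_irreducible_def)
  show ?thesis
  proof (intro skew_simple_module.intro skew_simple_module_axioms.intro skew_poly_axioms)
    show "right_dvd P u" if u: "\<And>v. right_dvd f (u \<star> v)" for u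
    proof (rule two_sided_ideal_maximal[OF P, of "{u. \<forall>v. right_dvd f (u \<star> v)}"])
      show "1 \<notin> {u. \<forall>v. right_dvd f (u \<star> v)}"
      proof
        assume "1 \<in> {u. \<forall>v. right_dvd f (u \<star> v)}"
        then have "right_dvd f (1 \<star> 1)" by blast
        then show False using right_dvd_degree[of f 1] degf by simp
      qed
      show "P \<in> {u. \<forall>v. right_dvd f (u \<star> v)}"
        using central_commute[OF Pc] right_dvd_mult[OF dvd] by simp
    qed (use u in \<open>auto simp: skew_mult_add_left right_dvd_add skew_mult_assoc right_dvd_mult\<close>)
  qed (use f(1) central_commute[OF Pc] P0 dvd in auto)
qed

end

section \<open>The quotient ring and the matrix representation\<close>

context skew_simple_module begin

abbreviation R where "R \<equiv> skew_poly_ring \<sigma>"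
abbreviation Q where "Q \<equiv> skew_quotient \<sigma> P"
abbreviation coset where "coset \<equiv> skew_coset \<sigma> P"

lemma R_simps [simp]:
  "carrier R = UNIV" "a \<otimes>\<^bsub>R\<^esub> b = a \<star> b" "a \<oplus>\<^bsub>R\<^esub> b = a + b" "\<one>\<^bsub>R\<^esub> = 1" "\<zero>\<^bsub>R\<^esub> = 0"
  by (simp_all add: skew_poly_ring_def)

lemma R_uminus: "\<ominus>\<^bsub>R\<^esub> a = - a"
proof -
  interpret ring R by (rule ring_skew_poly_ring)
  show ?thesis using minus_equality[of "- a" a] by simp
qed

lemma principal_eq: "PIdl\<^bsub>R\<^esub> P = {a. right_dvd P a}"
  by (auto simp: cgenideal_def right_dvd_def)

text \<open>Centrality of \<open>P\<close> turns the left ideal \<open>R P\<close> into a two-sided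
  one.\<close>

lemma ideal_principal: "ideal (PIdl\<^bsub>R\<^esub> P) R"
proof (rule idealI[OF ring_skew_poly_ring])
  interpret R: ring R by (rule ring_skew_poly_ring)
  show "subgroup (PIdl\<^bsub>R\<^esub> P) (add_monoid R)"
    unfolding principal_eq
  proof (rule R.add.subgroupI)
    fix a assume "a \<in> {a. right_dvd P a}"
    then show "\<ominus>\<^bsub>R\<^esub> a \<in> {a. right_dvd P a}" by (simp add: R_uminus right_dvd_minus)
  next
    show "{a. right_dvd P a} \<noteq> {}" using right_dvd_zero by blast
  qed (auto simp: right_dvd_add)
  fix a x assume "a \<in> PIdl\<^bsub>R\<^esub> P"
  then obtain q where q: "a = q \<star> P" by (auto simp: principal_eq right_dvd_def)
  show "x \<otimes>\<^bsub>R\<^esub> a \<in> PIdl\<^bsub>R\<^esub> P" by (simp add: principal_eq q right_dvd_mult right_dvdI)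
  have "a \<star> x = (q \<star> x) \<star> P" by (simp add: q skew_mult_assoc P_central)
  then show "a \<otimes>\<^bsub>R\<^esub> x \<in> PIdl\<^bsub>R\<^esub> P" by (simp add: principal_eq right_dvdI)
qed

lemma coset_eq_set: "coset a = {h + a | h. right_dvd P h}"
  by (auto simp: a_r_coset_def' principal_eq)

lemma coset_eq_iff: "coset a = coset b \<longleftrightarrow> right_dvd P (a - b)"
proof
  assume "coset a = coset b"
  moreover have "a \<in> coset a" unfolding coset_eq_set by (auto intro: exI[of _ 0])
  ultimately obtain h where "a = h + b" "right_dvd P h" unfolding coset_eq_set by blast
  then show "right_dvd P (a - b)" by simp
next
  assume dvd: "right_dvd P (a - b)"
  have "h + a = (h + (a - b)) + b" "h + b = (h - (a - b)) + a" for h by simp_all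
  then show "coset a = coset b"
    unfolding coset_eq_set using dvd by (blast intro: right_dvd_add right_dvd_diff)
qed

lemma carrier_Q: "carrier Q = range coset"
  by (auto simp: FactRing_def A_RCOSETS_def')

lemma ring_Q: "ring Q"
  using ideal.quotient_is_ring[OF ideal_principal] .

lemma Q_simps [simp]:
  "coset a \<otimes>\<^bsub>Q\<^esub> coset b = coset (a \<star> b)" "coset a \<oplus>\<^bsub>Q\<^esub> coset b = coset (a + b)"
  "\<one>\<^bsub>Q\<^esub> = coset 1" "\<zero>\<^bsub>Q\<^esub> = coset 0"
proof -
  interpret I: ideal "PIdl\<^bsub>R\<^esub> P" R by (rule ideal_principal)
  show "coset a \<otimes>\<^bsub>Q\<^esub> coset b = coset (a \<star> b)" using I.rcoset_mult_add[of a b] by (simp add: FactRing_def)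
  show "coset a \<oplus>\<^bsub>Q\<^esub> coset b = coset (a + b)" using I.a_rcos_sum[of a b] by (simp add: FactRing_def)
  show "\<one>\<^bsub>Q\<^esub> = coset 1" by (simp add: FactRing_def)
  show "\<zero>\<^bsub>Q\<^esub> = coset 0" by (simp add: FactRing_def coset_eq_set) (simp add: principal_eq)
qed

definition act :: "'l poly \<Rightarrow> 'l poly \<Rightarrow> 'l poly" where
  "act a = (\<lambda>b\<in>remainders f. rem_f (a \<star> b))"

text \<open>One direction is faithfulness and gives injectivity of the representation; the other
  shows that the action of a coset does not depend on its representative.\<close>

lemma act_eq_iff: "act a = act b \<longleftrightarrow> right_dvd P (a - b)"
proof
  assume eq: "act a = act b"
  show "right_dvd P (a - b)"
  proof (rule faithful)
    fix v
    have "rem_f (a \<star> rem_f v) = rem_f (b \<star> rem_f v)"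
      using fun_cong[OF eq, of "rem_f v"] by (simp add: act_def skew_rmod_remainder)
    then have "right_dvd f (a \<star> v - b \<star> v)" by (simp add: rem_mult_rem_right skew_rmod_eq_iff)
    then show "right_dvd f ((a - b) \<star> v)" by (simp add: skew_mult_distribs)
  qed
next
  assume "right_dvd P (a - b)"
  then obtain q where q: "a - b = q \<star> P" by (auto simp: right_dvd_def)
  have "right_dvd f (a \<star> v - b \<star> v)" for v
  proof -
    have "a \<star> v - b \<star> v = (q \<star> v) \<star> P" by (simp flip: skew_mult_diff_left add: q skew_mult_assoc P_central)
    then show ?thesis by (simp add: right_dvd_mult f_dvd_P)
  qed
  then show "act a = act b" unfolding act_def by (intro restrict_ext rem_cong) simp
qed

lemma coset_map_coset: "coset_map \<sigma> f (coset a) = act a"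
proof -
  have "act b = act a" if "b \<in> coset a" for b
    using that unfolding coset_eq_set act_eq_iff by auto
  moreover have "a \<in> coset a" unfolding coset_eq_set by (auto intro: exI[of _ 0])
  ultimately have "act ` coset a = {act a}" by blast
  then show ?thesis unfolding coset_map_def act_def[symmetric] by simp
qed

lemma act_closed: "act a \<in> carrier (eigen_End \<sigma> f)"
proof -
  have "act a (rem_f (b \<star> c)) = rem_f (act a b \<star> c)" if "b \<in> remainders f" "c \<in> D" for b c
    using that by (simp add: act_def skew_rmod_remainder rem_mult_rem_right rem_mult_rem_left skew_mult_assoc)
  then show ?thesis
    by (auto simp: eigen_End_def act_def skew_rmod_remainder remainders_add skew_mult_add_right skew_rmod_add)
qed

lemma End_comb:
  assumes T: "T \<in> carrier (eigen_End \<sigma> f)" and v: "\<And>i. i < d \<Longrightarrow> v i \<in> remainders f" and c: "\<And>i. i < d \<Longrightarrow> c i \<in> D"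
  shows "T (rem_f (comb d v c)) = rem_f (comb d (\<lambda>i. T (v i)) c)"
  using v c
proof (induction d)
  case 0
  have "T (b + b') = T b + T b'" if "b \<in> remainders f" "b' \<in> remainders f" for b b'
    using T that by (simp add: eigen_End_def)
  from this[OF remainders_zero remainders_zero] have "T 0 = 0"
    by (simp only: add_0 add_cancel_right_right)
  then show ?case by (simp add: comb_def skew_rmod_self)
next
  case (Suc d)
  have "T (rem_f (comb (Suc d) v c)) = T (rem_f (comb d v c) + rem_f (v d \<star> c d))"
    by (simp add: comb_Suc skew_rmod_add)
  also have "\<dots> = T (rem_f (comb d v c)) + T (rem_f (v d \<star> c d))"
    using T by (simp add: eigen_End_def skew_rmod_remainder)
  also have "T (rem_f (v d \<star> c d)) = rem_f (T (v d) \<star> c d)"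
    using T Suc.prems by (simp add: eigen_End_def)
  finally show ?case using Suc by (simp add: comb_Suc skew_rmod_add)
qed

lemma spans_rem_comb:
  assumes "spans d v b" "b \<in> remainders f"
  obtains c where "\<And>i. i < d \<Longrightarrow> c i \<in> D" "b = rem_f (comb d v c)"
proof -
  obtain c where c: "\<forall>i<d. c i \<in> D" "right_dvd f (b - comb d v c)" using assms(1) by (auto simp: spans_def)
  then have "b = rem_f (comb d v c)" using rem_cong[OF c(2)] assms(2) by (simp add: skew_rmod_self)
  then show ?thesis using that c(1) by blast
qed

text \<open>For surjectivity, interpolation finds a polynomial with the values of \<open>T\<close>
  on a basis, and eigenring-linearity extends the agreement to all of \<open>V\<close>.\<close>

lemma coset_map_ring_iso:
  assumes v: "indep m v" "\<forall>i<m. v i \<in> remainders f" "\<forall>b\<in>remainders f. spans m v b"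
  shows "coset_map \<sigma> f \<in> ring_iso Q (eigen_End \<sigma> f)"
  unfolding ring_iso_def
proof (intro CollectI conjI)
  show "coset_map \<sigma> f \<in> Ring.ring_hom Q (eigen_End \<sigma> f)"
  proof (rule ring_hom_memI)
    fix x y assume "x \<in> carrier Q" "y \<in> carrier Q"
    then obtain a b where xy: "x = coset a" "y = coset b" by (auto simp: carrier_Q)
    have "act (a \<star> b) = compose (remainders f) (act a) (act b)"
      by (auto simp: act_def compose_def skew_rmod_remainder rem_mult_rem_right skew_mult_assoc)
    then show "coset_map \<sigma> f (x \<otimes>\<^bsub>Q\<^esub> y) = coset_map \<sigma> f x \<otimes>\<^bsub>eigen_End \<sigma> f\<^esub> coset_map \<sigma> f y"
      by (simp add: xy coset_map_coset) (simp add: eigen_End_def)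
    have "act (a + b) = (\<lambda>c\<in>remainders f. act a c + act b c)"
      by (auto simp: act_def skew_mult_add_left skew_rmod_add)
    then show "coset_map \<sigma> f (x \<oplus>\<^bsub>Q\<^esub> y) = coset_map \<sigma> f x \<oplus>\<^bsub>eigen_End \<sigma> f\<^esub> coset_map \<sigma> f y"
      by (simp add: xy coset_map_coset) (simp add: eigen_End_def)
  next
    show "coset_map \<sigma> f \<one>\<^bsub>Q\<^esub> = \<one>\<^bsub>eigen_End \<sigma> f\<^esub>"
      by (simp add: coset_map_coset) (auto simp: eigen_End_def act_def skew_rmod_self)
  qed (auto simp: carrier_Q coset_map_coset act_closed)
  show "bij_betw (coset_map \<sigma> f) (carrier Q) (carrier (eigen_End \<sigma> f))"
    unfolding bij_betw_def
  proof
    show "inj_on (coset_map \<sigma> f) (carrier Q)"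
      by (auto simp: inj_on_def carrier_Q coset_map_coset act_eq_iff coset_eq_iff)
    show "coset_map \<sigma> f ` carrier Q = carrier (eigen_End \<sigma> f)"
    proof (intro equalityI subsetI)
      fix T assume T: "T \<in> carrier (eigen_End \<sigma> f)"
      obtain u where u: "\<And>i. i < m \<Longrightarrow> right_dvd f (u \<star> v i - T (v i))"
        using interpolation[OF v(1), of "\<lambda>i. T (v i)"] by blast
      have "act u = T"
      proof
        fix b
        show "act u b = T b"
        proof (cases "b \<in> remainders f")
          case True
          then obtain c where c: "\<And>i. i < m \<Longrightarrow> c i \<in> D" "b = rem_f (comb m v c)"
            using spans_rem_comb v(3) by blast
          have "act u b = rem_f (u \<star> comb m v c)"
            using True by (simp add: act_def) (simp add: c(2) rem_mult_rem_right)
          also have "\<dots> = rem_f (comb m (\<lambda>i. T (v i)) c)"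
          proof (rule rem_cong)
            have "u \<star> comb m v c - comb m (\<lambda>i. T (v i)) c = (\<Sum>i<m. (u \<star> v i - T (v i)) \<star> c i)"
              by (simp add: comb_def skew_mult_sum_right skew_mult_diff_left sum_subtractf skew_mult_assoc)
            also have "right_dvd f \<dots>" using u c(1) by (intro right_dvd_sum right_dvd_mult_D) auto
            finally show "right_dvd f (u \<star> comb m v c - comb m (\<lambda>i. T (v i)) c)" .
          qed
          also have "\<dots> = T b" using End_comb[OF T, of m v c] v(2) c by simp
          finally show ?thesis .
        next
          case False
          then show ?thesis using T by (auto simp: act_def eigen_End_def PiE_def extensional_def)
        qed
      qed
      then show "T \<in> coset_map \<sigma> f ` carrier Q"
        unfolding carrier_Q using coset_map_coset[of u] by (metis image_eqI rangeI)
    qed (auto simp: carrier_Q coset_map_coset act_closed)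
  qed
qed

lemma coset_map_image: "coset_map \<sigma> f (coset a) ` remainders f = image_of a"
  unfolding coset_map_coset act_def image_of_def by auto

lemma coset_rank_eq: "eigen_dim \<sigma> f (image_of a) d \<Longrightarrow> coset_rank \<sigma> f (coset a) = d"
  unfolding coset_rank_def coset_map_image using eigen_dim_unique by blast

lemma indep_mono: "indep d v \<Longrightarrow> e \<le> d \<Longrightarrow> indep e v"
  by (induction d) (auto simp: le_Suc_eq dest: indep_Suc_imp)

lemma annihilates_mono: "annihilates d v u \<Longrightarrow> e \<le> d \<Longrightarrow> annihilates e v u"
  by (auto simp: annihilates_def)

end

section \<open>Dimensions over the scalar field\<close>

text \<open>Dimension is generated by adding one line at a time, and injectivity keeps each new
  vector outside the previous image. Separate maps for vectors and scalars allow both a change of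
  ring and maps such as \<open>encode\<close> that are not ring homomorphisms.\<close>

lemma dimension_transport:
  assumes A: "ring A" and B: "ring B" and K: "subfield K A" and dim: "ring.dimension A n K E"
    and closed: "\<And>x. x \<in> E \<Longrightarrow> \<phi> x \<in> carrier B"
    and add: "\<And>x y. x \<in> E \<Longrightarrow> y \<in> E \<Longrightarrow> \<phi> (x \<oplus>\<^bsub>A\<^esub> y) = \<phi> x \<oplus>\<^bsub>B\<^esub> \<phi> y"
    and smult: "\<And>k x. k \<in> K \<Longrightarrow> x \<in> E \<Longrightarrow> \<phi> (k \<otimes>\<^bsub>A\<^esub> x) = \<psi> k \<otimes>\<^bsub>B\<^esub> \<phi> x"
    and inj: "inj_on \<phi> E"
  shows "ring.dimension B n (\<psi> ` K) (\<phi> ` E)"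
proof -
  interpret A: ring A by (rule A)
  interpret B: ring B by (rule B)
  show ?thesis
    using dim closed add smult inj
  proof (induction n arbitrary: E)
    case 0
    then have E: "E = {\<zero>\<^bsub>A\<^esub>}" using A.dimension_zero[OF K] by blast
    \<comment> \<open>Additivity makes the image of zero idempotent under addition, hence
      zero.\<close>
    let ?z = "\<phi> \<zero>\<^bsub>A\<^esub>"
    have z: "?z \<in> carrier B" using "0.prems"(2)[of "\<zero>\<^bsub>A\<^esub>"] E by simp
    have "?z \<oplus>\<^bsub>B\<^esub> ?z = ?z" using "0.prems"(3)[of "\<zero>\<^bsub>A\<^esub>" "\<zero>\<^bsub>A\<^esub>", symmetric] E by simp
    then have "?z = \<zero>\<^bsub>B\<^esub>" using B.add.l_cancel_one[OF z z] by blast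
    then show ?case using E by simp
  next
    case (Suc n)
    obtain v E' where v: "v \<in> carrier A" "A.dimension n K E'" "v \<notin> E'" "E = A.line_extension K v E'"
      using A.dimension_backwards[OF K Suc.prems(1)] by blast
    note sub = A.space_subgroup_props[OF K v(2)]
    note Kc = subringE[OF subfieldE(1)[OF K]]
    have E'E: "x \<in> E" if "x \<in> E'" for x
    proof -
      have "x \<in> carrier A" using sub(1) that by (rule subsetD)
      then have "\<zero>\<^bsub>A\<^esub> \<otimes>\<^bsub>A\<^esub> v \<oplus>\<^bsub>A\<^esub> x = x" using v(1) by simp
      then show ?thesis unfolding v(4) A.line_extension_mem_iff using Kc(2) that by metis
    qed
    have kvE: "k \<otimes>\<^bsub>A\<^esub> v \<in> E" if "k \<in> K" for k
    proof -
      have "k \<in> carrier A" using Kc(1) that by (rule subsetD)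
      then have "k \<otimes>\<^bsub>A\<^esub> v \<oplus>\<^bsub>A\<^esub> \<zero>\<^bsub>A\<^esub> = k \<otimes>\<^bsub>A\<^esub> v" using v(1) by simp
      then show ?thesis unfolding v(4) A.line_extension_mem_iff using that sub(2) by metis
    qed
    have vE: "v \<in> E" using kvE[OF Kc(3)] v(1) by simp
    have "B.dimension n (\<psi> ` K) (\<phi> ` E')"
      by (intro Suc.IH v(2) Suc.prems(2-4) inj_on_subset[OF Suc.prems(5)] subsetI E'E)
    moreover have "\<phi> v \<notin> \<phi> ` E'"
    proof
      assume "\<phi> v \<in> \<phi> ` E'"
      then obtain x where x: "x \<in> E'" "\<phi> v = \<phi> x" by blast
      then have "v = x" using inj_onD[OF Suc.prems(5) x(2) vE E'E[OF x(1)]] by simp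
      then show False using x(1) v(3) by simp
    qed
    ultimately have "B.dimension (Suc n) (\<psi> ` K) (B.line_extension (\<psi> ` K) (\<phi> v) (\<phi> ` E'))"
      using Suc.prems(2)[OF vE] by (intro B.Suc_dim)
    moreover have "B.line_extension (\<psi> ` K) (\<phi> v) (\<phi> ` E') = \<phi> ` E"
    proof -
      have eq: "\<phi> (k \<otimes>\<^bsub>A\<^esub> v \<oplus>\<^bsub>A\<^esub> x) = \<psi> k \<otimes>\<^bsub>B\<^esub> \<phi> v \<oplus>\<^bsub>B\<^esub> \<phi> x" if "k \<in> K" "x \<in> E'" for k x
        using Suc.prems(3)[OF kvE[OF that(1)] E'E[OF that(2)]] Suc.prems(4)[OF that(1) vE] by simp
      show ?thesis
      proof (intro equalityI subsetI)
        fix y assume "y \<in> B.line_extension (\<psi> ` K) (\<phi> v) (\<phi> ` E')"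
        then obtain k x where kx: "k \<in> K" "x \<in> E'" "y = \<psi> k \<otimes>\<^bsub>B\<^esub> \<phi> v \<oplus>\<^bsub>B\<^esub> \<phi> x"
          unfolding B.line_extension_mem_iff by blast
        then have "y = \<phi> (k \<otimes>\<^bsub>A\<^esub> v \<oplus>\<^bsub>A\<^esub> x)" using eq[OF kx(1,2)] by simp
        moreover have "k \<otimes>\<^bsub>A\<^esub> v \<oplus>\<^bsub>A\<^esub> x \<in> E" unfolding v(4) A.line_extension_mem_iff using kx by blast
        ultimately show "y \<in> \<phi> ` E" by blast
      next
        fix y assume "y \<in> \<phi> ` E"
        then obtain z where z: "z \<in> E" "y = \<phi> z" by blast
        obtain k x where kx: "k \<in> K" "x \<in> E'" "z = k \<otimes>\<^bsub>A\<^esub> v \<oplus>\<^bsub>A\<^esub> x"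
          using z(1) unfolding v(4) A.line_extension_mem_iff by blast
        have "y = \<psi> k \<otimes>\<^bsub>B\<^esub> \<phi> v \<oplus>\<^bsub>B\<^esub> \<phi> x" using eq[OF kx(1,2)] z(2) kx(3) by simp
        then show "y \<in> B.line_extension (\<psi> ` K) (\<phi> v) (\<phi> ` E')"
          unfolding B.line_extension_mem_iff using kx(1,2) by blast
      qed
    qed
    ultimately show ?case by simp
  qed
qed

context skew_simple_module begin

lemma ring_eigenring: "ring (eigenring \<sigma> f)"
proof (rule ringI)
  have simps: "x \<otimes>\<^bsub>eigenring \<sigma> f\<^esub> y = rem_f (x \<star> y)" "x \<oplus>\<^bsub>eigenring \<sigma> f\<^esub> y = x + y"
    "\<one>\<^bsub>eigenring \<sigma> f\<^esub> = 1" "\<zero>\<^bsub>eigenring \<sigma> f\<^esub> = 0" for x y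
    by (simp_all add: eigenring_def)
  show "abelian_group (eigenring \<sigma> f)"
  proof (rule abelian_groupI, unfold simps)
    fix x assume "x \<in> D"
    then show "\<exists>y\<in>D. y + x = 0" by (intro bexI[of _ "- x"]) (auto simp: eigen_minus)
  qed (auto simp: eigen_add algebra_simps)
  show "Group.monoid (eigenring \<sigma> f)"
    by (rule monoidI, unfold simps)
       (auto simp: eigen_mult eigen_one rem_mult_rem_left rem_mult_rem_right skew_mult_assoc
          skew_rmod_self eigen_remainder)
qed (auto simp: eigenring_def skew_mult_distribs skew_rmod_add)

definition polys_below :: "nat \<Rightarrow> 'l poly set" where
  "polys_below t = {p. \<forall>k\<ge>t. coeff p k = 0}"

lemma remainders_eq_polys_below: "remainders f = polys_below (degree f)"
  using remainders_coeff[OF f_nz] by (auto simp: polys_below_def)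

context
  fixes K' :: "'l set" and q :: nat
  assumes K': "subfield K' ambient_field" and K'_fixed: "\<And>c. c \<in> K' \<Longrightarrow> \<sigma> c = c"
    and dim_q: "ambient.dimension q K' UNIV"
begin

abbreviation scalars where "scalars \<equiv> (\<lambda>c. [:c:]) ` K'"

lemma subfield_consts: "subfield scalars R"
proof -
  have "(\<lambda>c. [:c:]) \<in> Ring.ring_hom ambient_field R"
    by (rule ring_hom_memI) (auto simp: const_skew_mult one_pCons)
  then interpret h: ring_hom_ring ambient_field R "\<lambda>c. [:c:]"
    by (intro ring_hom_ringI2 ring_from_type_algebra ring_skew_poly_ring)
  show ?thesis by (rule h.img_is_subfield(2)[OF K']) simp
qed

text \<open>Each further degree contributes one copy of \<open>L\<close>, of dimension
  \<open>q\<close> over the scalars.\<close>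

lemma dimension_polys_below: "ring.dimension R (t * q) scalars (polys_below t)"
proof (induction t)
  interpret R: ring R by (rule ring_skew_poly_ring)
  case 0
  have "polys_below 0 = {0}" by (auto simp: polys_below_def intro: poly_eqI)
  then show ?case using R.zero_dim[of scalars] by simp
next
  interpret R: ring R by (rule ring_skew_poly_ring)
  case (Suc t)
  have "R.dimension q ((\<lambda>c. [:c:]) ` K') ((\<lambda>a. monom a t) ` UNIV)"
    by (rule dimension_transport[OF ring_from_type_algebra ring_skew_poly_ring K' dim_q])
       (auto simp: add_monom const_skew_mult smult_monom inj_on_def)
  moreover have "polys_below t \<inter> range (\<lambda>a. monom a t) = {\<zero>\<^bsub>R\<^esub>}"
    by (auto simp: polys_below_def)
  ultimately have "R.dimension (t * q + q) scalars (polys_below t <+>\<^bsub>R\<^esub> range (\<lambda>a. monom a t))"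
    using R.dimension_direct_sum_space[OF subfield_consts Suc] by blast
  moreover have "polys_below t <+>\<^bsub>R\<^esub> range (\<lambda>a. monom a t) = polys_below (Suc t)"
  proof (intro equalityI subsetI)
    fix p assume p: "p \<in> polys_below (Suc t)"
    have "coeff (p - monom (coeff p t) t) k = 0" if "t \<le> k" for k
    proof (cases "k = t")
      case False
      then have "Suc t \<le> k" using that by simp
      then have "coeff p k = 0" using p unfolding polys_below_def by blast
      then show ?thesis using False by simp
    qed simp
    then have "p - monom (coeff p t) t \<in> polys_below t" unfolding polys_below_def by blast
    moreover have "p = (p - monom (coeff p t) t) \<oplus>\<^bsub>R\<^esub> monom (coeff p t) t" by simp
    ultimately show "p \<in> polys_below t <+>\<^bsub>R\<^esub> range (\<lambda>a. monom a t)"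
      unfolding set_add_def' by blast
  qed (auto simp: set_add_def' polys_below_def)
  ultimately show ?case by (simp add: add.commute)
qed

text \<open>Constants fixed by \<open>\<sigma>\<close> commute with \<open>x\<close>, so left
  scalars are compatible with right multiplication by the eigenring.\<close>

lemma const_commute: "c \<in> K' \<Longrightarrow> [:c:] \<star> p = p \<star> [:c:]"
proof -
  assume "c \<in> K'"
  then have "(\<sigma> ^^ i) c = c" for i by (induction i) (auto simp: K'_fixed)
  then have "coeff (p \<star> [:c:]) k = coeff p k * c" for k
    using skew_mult_monom[of p c 0 k] unfolding monom_0 by simp
  then have "coeff ([:c:] \<star> p) k = coeff (p \<star> [:c:]) k" for k
    unfolding const_skew_mult coeff_smult by (simp only: mult.commute)
  then show ?thesis by (rule poly_eqI)
qed

lemma mult_const_mult: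
  assumes "c \<in> K'"
  shows "a \<star> ([:c:] \<star> b) = smult c (a \<star> b)"
proof -
  have "a \<star> ([:c:] \<star> b) = (a \<star> [:c:]) \<star> b" by (rule skew_mult_assoc[symmetric])
  also have "\<dots> = ([:c:] \<star> a) \<star> b" by (simp only: const_commute[OF assms, of a])
  also have "\<dots> = smult c (a \<star> b)" by (simp only: const_skew_mult smult_skew_mult)
  finally show ?thesis .
qed

text \<open>The eigenring is a scalar subspace of the remainders. Only finiteness is asserted; the
  value follows from counting \<open>V\<close>.\<close>

lemma finite_dimension_eigenring:
  obtains e where "ring.dimension R e scalars D"
proof -
  interpret R: ring R by (rule ring_skew_poly_ring)
  have "subalgebra scalars D R"
  proof (intro subalgebra.intro subalgebra_axioms.intro R.add.subgroupI)
    fix a assume "a \<in> D"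
    then show "\<ominus>\<^bsub>R\<^esub> a \<in> D" using R_uminus[of a] eigen_minus[of a] by simp
  next
    show "D \<noteq> {}" using eigen_zero by blast
  next
    fix k v assume kv: "k \<in> scalars" "v \<in> D"
    then obtain c where c: "k = [:c:]" "c \<in> K'" by blast
    have "right_dvd f (f \<star> ([:c:] \<star> v))"
      using mult_const_mult[OF c(2), of f v] right_dvd_mult[of f "f \<star> v" "[:c:]"] kv(2)
      by (simp add: eigen_iff const_skew_mult)
    then show "k \<otimes>\<^bsub>R\<^esub> v \<in> D"
      using kv(2) by (simp add: eigen_iff c(1) const_skew_mult remainders_smult)
  qed (auto simp: eigen_add)
  moreover have "D \<subseteq> polys_below (degree f)" using eigen_remainder remainders_eq_polys_below by blast
  moreover have "R.finite_dimension scalars (polys_below (degree f))"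
    by (rule R.finite_dimensionI[OF dimension_polys_below])
  ultimately have "R.finite_dimension scalars D"
    using R.subalbegra_incl_imp_finite_dimension[OF subfield_consts] by blast
  then show ?thesis using that unfolding R.finite_dimension_def by blast
qed

text \<open>The span is the direct sum of the spaces \<open>v_i D\<close>, each a copy of the
  eigenring.\<close>

lemma dimension_eigen_span:
  assumes e: "ring.dimension R e scalars D" and v: "indep d v"
  shows "ring.dimension R (d * e) scalars {rem_f (comb d v c) | c. \<forall>i<d. c i \<in> D}"
  using v
proof (induction d)
  interpret R: ring R by (rule ring_skew_poly_ring)
  case 0
  have "{rem_f (comb 0 v c) | c. \<forall>i<0. c i \<in> D} = {0}" by (simp add: comb_def skew_rmod_self)
  then show ?case using R.zero_dim[of scalars] by simp
next
  interpret R: ring R by (rule ring_skew_poly_ring)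
  case (Suc d)
  let ?S = "{rem_f (comb d v c) | c. \<forall>i<d. c i \<in> D}"
  let ?\<phi> = "\<lambda>c. rem_f (v d \<star> c)"
  \<comment> \<open>Independence is used in one form for two purposes: the sum is direct, and
    \<open>c \<mapsto> v d c\<close> is injective on the eigenring.\<close>
  have zero: "c = 0 \<and> rem_f (comb d v c') = 0"
    if c: "c \<in> D" "\<forall>i<d. c' i \<in> D" and eq: "rem_f (v d \<star> c) = rem_f (comb d v c')" for c c'
  proof -
    let ?c = "\<lambda>i. if i = d then - c else c' i"
    have comb: "comb (Suc d) v ?c = comb d v c' - v d \<star> c"
      by (simp add: comb_Suc skew_mult_minus) (auto intro: comb_cong)
    have "right_dvd f (comb d v c' - v d \<star> c)"
      using eq[symmetric] by (simp add: skew_rmod_eq_iff)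
    moreover have "?c i \<in> D" if "i < Suc d" for i
      using that c by (cases "i = d") (auto simp: eigen_minus)
    ultimately have *: "?c i = 0" if "i < Suc d" for i
      using indepD[OF Suc.prems, of ?c i] that unfolding comb by blast
    have "c' i = 0" if "i < d" for i using *[of i] that by simp
    then have "comb d v c' = 0" unfolding comb_def by (intro sum.neutral) simp
    then show ?thesis using *[of d] skew_rmod_self[of 0 f] by simp
  qed
  have "R.dimension e ((\<lambda>k. k) ` scalars) (?\<phi> ` D)"
  proof (rule dimension_transport[OF ring_skew_poly_ring ring_skew_poly_ring subfield_consts e])
    fix k x assume k: "k \<in> scalars" "x \<in> D"
    then obtain c where c: "k = [:c:]" "c \<in> K'" by blast
    have "v d \<star> (k \<star> x) = smult c (v d \<star> x)" unfolding c(1) by (rule mult_const_mult[OF c(2)])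
    then show "?\<phi> (k \<otimes>\<^bsub>R\<^esub> x) = k \<otimes>\<^bsub>R\<^esub> ?\<phi> x" by (simp add: skew_rmod_smult) (simp add: c(1) const_skew_mult)
  next
    show "inj_on ?\<phi> D"
    proof (rule inj_onI)
      fix x y assume xy: "x \<in> D" "y \<in> D" "?\<phi> x = ?\<phi> y"
      then have "rem_f (v d \<star> (x - y)) = rem_f (comb d v (\<lambda>_. 0))"
        by (simp add: skew_rmod_eq_iff skew_mult_diff_right comb_def)
      then have "x - y = 0" using zero[of "x - y" "\<lambda>_. 0"] eigen_add[OF xy(1) eigen_minus[OF xy(2)]] by simp
      then show "x = y" by simp
    qed
  qed (auto simp: skew_mult_add_right skew_rmod_add)
  then have "R.dimension e scalars (?\<phi> ` D)" by simp
  moreover have "?S \<inter> ?\<phi> ` D = {\<zero>\<^bsub>R\<^esub>}"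
  proof -
    have "0 \<in> ?S" by (intro CollectI exI[of _ "\<lambda>_. 0"]) (simp add: comb_def skew_rmod_self)
    moreover have "0 \<in> ?\<phi> ` D" using eigen_zero by (intro image_eqI[of _ _ 0]) (simp_all add: skew_rmod_self)
    moreover have "x = 0" if x: "x \<in> ?S" "x \<in> ?\<phi> ` D" for x
    proof -
      obtain c where c: "c \<in> D" "x = rem_f (v d \<star> c)" using x(2) by blast
      obtain c' where c': "\<forall>i<d. c' i \<in> D" "x = rem_f (comb d v c')" using x(1) by blast
      show ?thesis using zero[OF c(1) c'(1)] c(2) c'(2) by metis
    qed
    ultimately show ?thesis by auto
  qed
  ultimately have "R.dimension (d * e + e) scalars (?S <+>\<^bsub>R\<^esub> ?\<phi> ` D)"
    using R.dimension_direct_sum_space[OF subfield_consts Suc.IH[OF indep_Suc_imp[OF Suc.prems]]] by blast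
  moreover have "?S <+>\<^bsub>R\<^esub> ?\<phi> ` D = {rem_f (comb (Suc d) v c) | c. \<forall>i<Suc d. c i \<in> D}"
  proof (intro equalityI subsetI)
    fix x assume "x \<in> ?S <+>\<^bsub>R\<^esub> ?\<phi> ` D"
    then obtain c c' where c: "\<forall>i<d. c i \<in> D" "c' \<in> D" "x = rem_f (comb d v c) + rem_f (v d \<star> c')"
      unfolding set_add_def' by auto
    have "comb (Suc d) v (\<lambda>i. if i = d then c' else c i) = comb d v c + v d \<star> c'"
      by (simp add: comb_Suc) (auto intro: comb_cong)
    then have "x = rem_f (comb (Suc d) v (\<lambda>i. if i = d then c' else c i))"
      using c(3) by (simp add: skew_rmod_add)
    then show "x \<in> {rem_f (comb (Suc d) v c) | c. \<forall>i<Suc d. c i \<in> D}"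
      using c(1,2) by (intro CollectI exI[of _ "\<lambda>i. if i = d then c' else c i"]) auto
  next
    fix x assume "x \<in> {rem_f (comb (Suc d) v c) | c. \<forall>i<Suc d. c i \<in> D}"
    then obtain c where c: "\<forall>i<Suc d. c i \<in> D" "x = rem_f (comb (Suc d) v c)" by blast
    have "x = rem_f (comb d v c) \<oplus>\<^bsub>R\<^esub> rem_f (v d \<star> c d)" using c(2) by (simp add: comb_Suc skew_rmod_add)
    moreover have "rem_f (comb d v c) \<in> ?S" "rem_f (v d \<star> c d) \<in> ?\<phi> ` D" using c(1) by auto
    ultimately show "x \<in> ?S <+>\<^bsub>R\<^esub> ?\<phi> ` D" unfolding set_add_def' by blast
  qed
  ultimately show ?case by (simp add: add.commute)
qed

text \<open>\<open>V\<close> consists of \<open>m\<close> copies of the eigenring and, as the space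
  of remainders, of \<open>degree f\<close> copies of \<open>L\<close>. The resulting equation is
  all that the Singleton bound requires of \<open>e\<close>.\<close>

lemma eigenring_dimension:
  assumes v: "indep m v" "\<forall>b\<in>remainders f. spans m v b"
  obtains e where "ring.dimension (eigenring \<sigma> f) e scalars D" "m * e = degree f * q"
proof -
  interpret R: ring R by (rule ring_skew_poly_ring)
  obtain e where e: "R.dimension e scalars D" using finite_dimension_eigenring .
  have "{rem_f (comb m v c) | c. \<forall>i<m. c i \<in> D} = remainders f"
  proof (intro equalityI subsetI)
    fix b assume b: "b \<in> remainders f"
    then obtain c where "\<And>i. i < m \<Longrightarrow> c i \<in> D" "b = rem_f (comb m v c)" using spans_rem_comb v(2) by blast
    then show "b \<in> {rem_f (comb m v c) | c. \<forall>i<m. c i \<in> D}" by blast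
  qed (auto simp: skew_rmod_remainder)
  then have "R.dimension (m * e) scalars (polys_below (degree f))"
    using dimension_eigen_span[OF e v(1)] remainders_eq_polys_below by simp
  then have "m * e = degree f * q"
    using R.dimension_is_inj[OF subfield_consts] dimension_polys_below by blast
  moreover have "ring.dimension (eigenring \<sigma> f) e ((\<lambda>k. k) ` scalars) ((\<lambda>x. x) ` D)"
  proof (rule dimension_transport[OF ring_skew_poly_ring ring_eigenring subfield_consts e])
    fix k x assume "k \<in> scalars" "x \<in> D"
    then show "k \<otimes>\<^bsub>R\<^esub> x = k \<otimes>\<^bsub>eigenring \<sigma> f\<^esub> x"
      by (auto simp: eigenring_def const_skew_mult skew_rmod_self remainders_smult remainders_def)
  qed (auto simp: eigenring_def)
  ultimately show ?thesis using that by simp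
qed

end
end

section \<open>The codes\<close>

locale skew_code_setup =
  cyclic_extension \<sigma> n K + skew_simple_module \<sigma> f P
  for \<sigma> :: "'l::field \<Rightarrow> 'l" and n K f P +
  fixes \<rho> :: "'l \<Rightarrow> 'l" and K' :: "'l set" and r m k t :: nat and \<eta> :: 'l
  assumes P_irred: "central_irreducible P" and P_monic: "lead_coeff P = 1" and P_0: "coeff P 0 \<noteq> 0"
    and f_monic: "lead_coeff f = 1"
    and m_degree: "m * degree f = degree P"
    and rho: "\<rho> \<in> ring_iso ambient_field ambient_field"
    and K'_def: "K' = {a. \<rho> a = a} \<inter> K"
    and dimension_K': "ambient.dimension r K' K"
    and k: "0 < k" "k < m"
    and t: "t = k * degree f"
    and eta: "field_norm UNIV K' \<eta> *
        field_norm K K' ((-1) ^ (t * (n - 1)) * coeff P 0 ^ (k * (n div m))) \<noteq> 1"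
begin

lemmas rhoD = ring_iso_ambientD[OF rho]

lemma rho_zero: "\<rho> 0 = 0"
  using rhoD(1)[of 0 0] by (metis add.right_neutral add_left_imp_eq)

lemma rho_minus: "\<rho> (- a) = - \<rho> a"
proof -
  have "\<rho> a + \<rho> (- a) = 0" using rhoD(1)[of a "- a"] rho_zero by simp
  then show ?thesis by (metis add_eq_0_iff)
qed

lemma rho_inverse: "\<rho> (inverse a) = inverse (\<rho> a)"
proof (cases "a = 0")
  case False
  then have "\<rho> a * \<rho> (inverse a) = 1" using rhoD(2)[of a "inverse a"] rhoD(3) by simp
  then show ?thesis by (metis inverse_unique)
qed (simp add: rho_zero)

lemma K'_sub: "K' \<subseteq> K"
  by (auto simp: K'_def)

lemma rho_fixed: "c \<in> K' \<Longrightarrow> \<rho> c = c"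
  by (simp add: K'_def)

lemma subfield_K': "subfield K' ambient_field"
  by (rule subfieldI_closed)
     (auto simp: K'_def rhoD rho_minus rho_inverse intro: subfield_closed[OF subfield_K])

lemma m_pos: "m > 0"
  using k by simp

text \<open>Comparing degrees, with \<open>degree P = m * degree f\<close>, identifies the exponent
  left open in \<open>right_factor_norm\<close>.\<close>

lemma factor_norm:
  assumes g: "lead_coeff g = 1" "right_dvd g P" "degree g = d * degree f"
  shows "(\<Prod>i<n. (\<sigma> ^^ i) (coeff g 0)) = (- 1) ^ ((n - 1) * degree g) * coeff P 0 ^ (d * (n div m))"
    and "d * n = m * (d * (n div m))"
proof -
  \<comment> \<open>The divisor \<open>f\<close> itself shows that \<open>m\<close> divides
    \<open>n\<close>, so \<open>n div m\<close> is an exact quotient.\<close>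
  have "\<exists>j. n = m * j"
  proof -
    obtain j where j: "degree f * n = degree P * j"
      using right_factor_norm[OF P_irred P_monic f_monic f_dvd_P] by blast
    then have "degree f * n = degree f * (m * j)" by (simp add: m_degree[symmetric] mult_ac)
    then have "n = m * j" using degree_f_pos by simp
    then show ?thesis ..
  qed
  then have n: "m * (n div m) = n" using m_pos by auto
  show "d * n = m * (d * (n div m))" using n by (simp add: mult.left_commute)
  obtain j where j: "degree g * n = degree P * j"
    "(\<Prod>i<n. (\<sigma> ^^ i) (coeff g 0)) = (- 1) ^ ((n - 1) * degree g) * coeff P 0 ^ j"
    using right_factor_norm[OF P_irred P_monic g(1,2)] by blast
  have "degree f * (d * n) = degree f * (m * j)"
    using j(1) g(3) by (simp add: m_degree[symmetric] mult_ac)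
  then have "d * n = m * j" using degree_f_pos by simp
  then have "m * (d * (n div m)) = m * j" using n by (simp add: mult.left_commute)
  then have "j = d * (n div m)" using m_pos by simp
  then show "(\<Prod>i<n. (\<sigma> ^^ i) (coeff g 0)) = (- 1) ^ ((n - 1) * degree g) * coeff P 0 ^ (d * (n div m))"
    using j(2) by simp
qed

lemma basis_card:
  assumes "indep d v" "\<forall>b\<in>remainders f. spans d v b"
  shows "d = m"
proof -
  have "d * degree f = m * degree f" by (simp only: basis_degree[OF assms] m_degree)
  then show ?thesis using degree_f_pos by simp
qed

lemma basis:
  obtains v where "indep m v" "\<forall>i<m. v i \<in> remainders f" "\<forall>b\<in>remainders f. spans m v b"
proof -
  have "indep 0 (\<lambda>_. 0)" by (simp add: indep_def)
  then obtain d v where v: "indep d v" "\<forall>i<d. v i \<in> remainders f" "\<forall>b\<in>remainders f. spans d v b"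
    using exists_basis_extending[of 0 "\<lambda>_. 0" "remainders f"] by auto
  then show ?thesis using that basis_card[OF v(1,3)] by blast
qed

lemma kernel_basis:
  assumes "indep d0 v0" "\<And>i. i < d0 \<Longrightarrow> v0 i \<in> remainders f" "annihilates d0 v0 u"
  obtains d v where "d0 \<le> d" "d \<le> m" "indep d v" "annihilates d v u" "eigen_dim \<sigma> f (image_of u) (m - d)"
proof (rule rank_nullity[OF _ assms])
  show "d = m" if "indep d v" "\<forall>b\<in>remainders f. spans d v b" for d v using that by (rule basis_card)
qed (assumption | rule that)+

lemma eigen_dim_remainders: "eigen_dim \<sigma> f (remainders f) m"
proof -
  obtain v where v: "indep m v" "\<forall>i<m. v i \<in> remainders f" "\<forall>b\<in>remainders f. spans m v b" using basis .
  have "remainders f = {rem_f (comb m v c) | c. \<forall>i<m. c i \<in> D}"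
  proof (intro equalityI subsetI)
    fix b assume b: "b \<in> remainders f"
    then obtain c where "\<And>i. i < m \<Longrightarrow> c i \<in> D" "b = rem_f (comb m v c)" using spans_rem_comb v(3) by blast
    then show "b \<in> {rem_f (comb m v c) | c. \<forall>i<m. c i \<in> D}" by blast
  qed (auto simp: skew_rmod_remainder)
  then show ?thesis using v(1,2) by (intro eigen_dimI[of _ v]) auto
qed

lemma t_pos: "t > 0"
  using k degree_f_pos by (simp add: t)

lemma t_less: "t < degree P"
  using k degree_f_pos unfolding t m_degree[symmetric] by simp

text \<open>The code becomes the image of the polynomials of degree below \<open>t\<close> under an
  additive map, which is linear over \<open>K'\<close> because \<open>\<rho>\<close> fixes
  \<open>K'\<close>.\<close>

definition encode :: "'l poly \<Rightarrow> 'l poly" where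
  "encode p = p + monom (\<eta> * \<rho> (coeff p 0)) t"

lemma code_eq: "skew_code \<sigma> P t \<eta> \<rho> = (\<lambda>p. coset (encode p)) ` polys_below t"
proof (intro equalityI subsetI)
  fix A assume "A \<in> skew_code \<sigma> P t \<eta> \<rho>"
  then obtain a where A: "A = coset ((\<Sum>i<t. monom (a i) i) + monom (\<eta> * \<rho> (a 0)) t)"
    by (auto simp: skew_code_def)
  have c: "coeff (\<Sum>i<t. monom (a i) i) j = (if j < t then a j else 0)" for j
  proof -
    have "coeff (\<Sum>i<t. monom (a i) i) j = (\<Sum>i<t. if i = j then a j else 0)"
      unfolding coeff_sum by (intro sum.cong refl) auto
    then show ?thesis by (simp add: sum.delta)
  qed
  have "A = coset (encode (\<Sum>i<t. monom (a i) i))" using A t_pos by (simp add: encode_def c)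
  moreover have "(\<Sum>i<t. monom (a i) i) \<in> polys_below t" by (simp add: polys_below_def c)
  ultimately show "A \<in> (\<lambda>p. coset (encode p)) ` polys_below t" by blast
next
  fix A assume "A \<in> (\<lambda>p. coset (encode p)) ` polys_below t"
  then obtain p where p: "p \<in> polys_below t" "A = coset (encode p)" by blast
  have "(\<Sum>i<t. monom (coeff p i) i) = p"
  proof (rule poly_eqI)
    fix j
    have "coeff (\<Sum>i<t. monom (coeff p i) i) j = (\<Sum>i<t. if i = j then coeff p j else 0)"
      unfolding coeff_sum by (intro sum.cong refl) auto
    also have "\<dots> = coeff p j" using p(1) by (auto simp: sum.delta polys_below_def)
    finally show "coeff (\<Sum>i<t. monom (coeff p i) i) j = coeff p j" .
  qed
  then have "A = coset ((\<Sum>i<t. monom (coeff p i) i) + monom (\<eta> * \<rho> (coeff p 0)) t)"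
    by (simp add: p(2) encode_def)
  then show "A \<in> skew_code \<sigma> P t \<eta> \<rho>" unfolding skew_code_def by blast
qed

lemma coeff_encode:
  "p \<in> polys_below t \<Longrightarrow> coeff (encode p) j =
    (if j < t then coeff p j else if j = t then \<eta> * \<rho> (coeff p 0) else 0)"
  by (auto simp: encode_def polys_below_def)

lemma degree_encode: "p \<in> polys_below t \<Longrightarrow> degree (encode p) \<le> t"
  by (intro degree_le allI impI) (simp add: coeff_encode)

text \<open>Codewords have degree at most \<open>t\<close>, below \<open>degree P\<close>, so no
  information is lost modulo \<open>P\<close>.\<close>

lemma coset_zero_iff:
  assumes "degree a \<le> t"
  shows "coset a = coset 0 \<longleftrightarrow> a = 0"
  using right_dvd_degree[of P a] t_less assms by (auto simp: coset_eq_iff)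

lemma encode_add: "encode (p + q) = encode p + encode q"
  by (simp add: encode_def rhoD(1) distrib_left flip: add_monom)

lemma encode_diff: "encode (p - q) = encode p - encode q"
  using encode_add[of "p - q" q] by simp

lemma encode_eq_0_iff: "p \<in> polys_below t \<Longrightarrow> encode p = 0 \<longleftrightarrow> p = 0"
proof
  assume p: "p \<in> polys_below t" and "encode p = 0"
  then have "coeff p j = 0" if "j < t" for j using coeff_encode[OF p, of j] that by simp
  moreover have "coeff p j = 0" if "t \<le> j" for j using p that unfolding polys_below_def by blast
  ultimately have "coeff p j = coeff 0 j" for j unfolding coeff_0 by (cases "j < t") (blast, simp)
  then show "p = 0" by (rule poly_eqI)
qed (simp add: encode_def rho_zero)

lemma polys_below_diff: "p \<in> polys_below j \<Longrightarrow> q \<in> polys_below j \<Longrightarrow> p - q \<in> polys_below j"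
  by (simp add: polys_below_def)

lemma K'_\<sigma>_fixed: "c \<in> K' \<Longrightarrow> \<sigma> c = c"
  using K'_sub fixed_iff by blast

lemma dimension_L: "ambient.dimension (r * n) K' UNIV"
  by (rule dimension_over_K'[OF subfield_K' K'_sub dimension_K'])

lemma dimension_polys_below_K': "ring.dimension R (j * (r * n)) ((\<lambda>c. [:c:]) ` K') (polys_below j)"
  by (rule dimension_polys_below[OF subfield_K' _ dimension_L]) (rule K'_\<sigma>_fixed)

lemma subfield_scalars_K': "subfield ((\<lambda>c. [:c:]) ` K') R"
  by (rule subfield_consts[OF subfield_K' _ dimension_L]) (rule K'_\<sigma>_fixed)

lemma field_norm_rho: "field_norm UNIV K' (\<rho> a) = field_norm UNIV K' a"
  by (rule field_norm_automorphism[OF subfield_K' K'_sub dimension_K' rho]) (rule rho_fixed)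

lemma dimension_code:
  "ring.dimension Q (t * (r * n)) ((\<lambda>c. coset [:c:]) ` K') (skew_code \<sigma> P t \<eta> \<rho>)"
proof -
  have "ring.dimension Q (t * (r * n)) (coset ` ((\<lambda>c. [:c:]) ` K')) ((\<lambda>p. coset (encode p)) ` polys_below t)"
  proof (rule dimension_transport[OF ring_skew_poly_ring ring_Q subfield_scalars_K'
        dimension_polys_below_K'])
    fix c p assume "c \<in> (\<lambda>c. [:c:]) ` K'" "p \<in> polys_below t"
    then obtain a where a: "c = [:a:]" "a \<in> K'" by blast
    have "encode (smult a p) = smult a (encode p)"
      by (simp add: encode_def smult_add_right smult_monom rhoD(2) rho_fixed[OF a(2)] mult.left_commute)
    then show "coset (encode (c \<otimes>\<^bsub>R\<^esub> p)) = coset c \<otimes>\<^bsub>Q\<^esub> coset (encode p)"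
      by (simp add: a(1) const_skew_mult)
  next
    show "inj_on (\<lambda>p. coset (encode p)) (polys_below t)"
    proof (rule inj_onI)
      fix p q assume pq: "p \<in> polys_below t" "q \<in> polys_below t" "coset (encode p) = coset (encode q)"
      have d: "p - q \<in> polys_below t" using pq(1,2) by (rule polys_below_diff)
      have "coset (encode (p - q)) = coset 0" using pq(3) by (simp add: coset_eq_iff encode_diff)
      then have "encode (p - q) = 0" using coset_zero_iff[OF degree_encode[OF d]] by blast
      then show "p = q" using encode_eq_0_iff[OF d] by simp
    qed
  qed (auto simp: carrier_Q encode_add)
  then show ?thesis unfolding code_eq image_image .
qed

lemma linear_code: "linear_code \<sigma> P K' (skew_code \<sigma> P t \<eta> \<rho>)"
proof -
  interpret Q: ring Q by (rule ring_Q)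
  interpret h: ring_hom_ring R Q coset
    by (rule ideal.rcos_ring_hom_ring[OF ideal_principal])
  \<comment> \<open>The scalars remain a field in the quotient only if 1 does not collapse to
    0.\<close>
  have "coset 1 \<noteq> coset 0" using coset_zero_iff[of 1] by simp
  then have "subfield (coset ` ((\<lambda>c. [:c:]) ` K')) Q"
    using h.img_is_subfield(2)[OF subfield_scalars_K'] by simp
  then have "subfield ((\<lambda>c. coset [:c:]) ` K') Q" unfolding image_image .
  from Q.finite_dimension_imp_subalgebra[OF this Q.finite_dimensionI[OF dimension_code]]
  have sub: "subalgebra ((\<lambda>c. coset [:c:]) ` K') (skew_code \<sigma> P t \<eta> \<rho>) Q" .
  show ?thesis
    unfolding linear_code_def
  proof (intro conjI ballI)
    show "subgroup (skew_code \<sigma> P t \<eta> \<rho>) (add_monoid Q)" by (rule subalgebra.axioms(1)[OF sub])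
    fix c A assume "c \<in> K'" "A \<in> skew_code \<sigma> P t \<eta> \<rho>"
    then show "coset [:c:] \<otimes>\<^bsub>Q\<^esub> A \<in> skew_code \<sigma> P t \<eta> \<rho>"
      by (intro subalgebra.smult_closed[OF sub]) (rule imageI)
  qed
qed

text \<open>
  A codeword killing \<open>k\<close> independent vectors is a multiple of a right divisor of \<open>P\<close> of its own
  degree \<open>t\<close>, hence a constant multiple; taking norms of the constant coefficients contradicts the
  hypothesis on \<open>\<eta>\<close>.
\<close>
lemma codeword_annihilates_less:
  assumes p: "p \<in> polys_below t" "encode p \<noteq> 0" and v: "indep d v" "annihilates d v (encode p)"
  shows "d < k"
proof (rule ccontr)
  assume "\<not> d < k"
  then have "indep k v" "annihilates k v (encode p)"
    using indep_mono[OF v(1)] annihilates_mono[OF v(2)] by simp_all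
  obtain g where g: "lead_coeff g = 1" "degree g = k * degree f"
    "\<And>u. annihilates k v u \<longleftrightarrow> right_dvd g u" using annihilator_generator[OF \<open>indep k v\<close>] by blast
  have "annihilates k v P" by (simp add: annihilates_def P_central right_dvd_mult f_dvd_P)
  then have gP: "right_dvd g P" using g(3) by simp
  obtain q where q: "encode p = q \<star> g"
    using g(3)[of "encode p"] \<open>annihilates k v (encode p)\<close> by (auto simp: right_dvd_def)
  have nz: "q \<noteq> 0" "g \<noteq> 0" using p(2) q by auto
  have "degree q + t \<le> t"
    using degree_encode[OF p(1)] degree_skew_mult[OF nz] g(2) t q by simp
  then have "degree q = 0" by simp
  then obtain c where c: "q = [:c:]" by (auto elim: degree_eq_zeroE)
  have enc: "encode p = smult c g" using q c by (simp add: const_skew_mult)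
  have "coeff (encode p) t = c" using enc g(1,2) t by simp
  then have c_eq: "c = \<eta> * \<rho> (coeff p 0)" using coeff_encode[OF p(1), of t] by simp
  have p0: "coeff p 0 = c * coeff g 0" using coeff_encode[OF p(1), of 0] t_pos enc by simp
  have "c \<noteq> 0" using c nz(1) by auto
  have "coeff g 0 \<noteq> 0"
  proof -
    obtain q' where "P = q' \<star> g" using gP by (auto simp: right_dvd_def)
    then show ?thesis using P_0 by (auto simp: coeff_skew_mult_0)
  qed
  then have p0nz: "coeff p 0 \<noteq> 0" using p0 \<open>c \<noteq> 0\<close> by simp
  note norm = subfield_K' K'_sub dimension_K'
  \<comment> \<open>Here \<open>p_0 = \<eta> \<rho>(p_0) g_0\<close>. The norm of \<open>p_0\<close>
    occurs on both sides and is nonzero, so it cancels and leaves \<open>\<eta> g_0\<close> with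
    norm 1.\<close>
  have "field_norm UNIV K' (coeff p 0) = field_norm UNIV K' (\<eta> * \<rho> (coeff p 0) * coeff g 0)"
    using p0 c_eq by simp
  also have "\<dots> = field_norm UNIV K' \<eta> * field_norm UNIV K' (coeff p 0) * field_norm UNIV K' (coeff g 0)"
    unfolding field_norm_mult[OF norm] field_norm_rho ..
  finally have "field_norm UNIV K' (coeff p 0) * 1 =
      field_norm UNIV K' (coeff p 0) * (field_norm UNIV K' \<eta> * field_norm UNIV K' (coeff g 0))"
    by (simp add: mult_ac)
  then have "field_norm UNIV K' \<eta> * field_norm UNIV K' (coeff g 0) = 1"
    using field_norm_nonzero[OF norm p0nz] mult_left_cancel by metis
  moreover have "field_norm UNIV K' (coeff g 0) =
      field_norm K K' ((-1) ^ (t * (n - 1)) * coeff P 0 ^ (k * (n div m)))"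
    unfolding field_norm_tower[OF norm] factor_norm(1)[OF g(1) gP g(2)] by (simp add: g(2) t mult.commute)
  ultimately show False using eta by simp
qed

lemma rank_codeword:
  assumes "A \<in> skew_code \<sigma> P t \<eta> \<rho>" "A \<noteq> coset 0"
  shows "m - k + 1 \<le> coset_rank \<sigma> f A"
proof -
  obtain p where p: "p \<in> polys_below t" "A = coset (encode p)" using assms(1) unfolding code_eq by blast
  have enc: "encode p \<noteq> 0" using assms(2) unfolding p(2) by metis
  \<comment> \<open>With the empty family prescribed, rank-nullity returns an independent family
    whose size \<open>d\<close> is the full nullity.\<close>
  have "indep 0 (\<lambda>_. 0)" "annihilates 0 (\<lambda>_. 0) (encode p)" by (simp_all add: indep_def annihilates_def)
  then obtain d v where dv: "d \<le> m" "indep d v" "annihilates d v (encode p)"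
    "eigen_dim \<sigma> f (image_of (encode p)) (m - d)"
    using kernel_basis[of 0 "\<lambda>_. 0" "encode p"] by blast
  have "d < k" by (rule codeword_annihilates_less[OF p(1) enc dv(2,3)])
  moreover have "coset_rank \<sigma> f A = m - d" using coset_rank_eq[OF dv(4)] p(2) by simp
  ultimately show ?thesis using k by simp
qed

text \<open>
  If \<open>g\<close> generates the annihilator of \<open>k - 1\<close> independent vectors, then \<open>(1 + b x\<^sup>j) g\<close> with
  \<open>j = deg f\<close> is a codeword for a suitable \<open>b\<close>.
\<close>
lemma exists_codeword_of_small_rank:
  "\<exists>A\<in>skew_code \<sigma> P t \<eta> \<rho>. A \<noteq> coset 0 \<and> coset_rank \<sigma> f A \<le> m - k + 1"
proof -
  obtain v where v: "indep m v" "\<forall>i<m. v i \<in> remainders f" "\<forall>b\<in>remainders f. spans m v b" using basis .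
  have ind: "indep (k - 1) v" using indep_mono[OF v(1)] k by simp
  obtain g where g: "lead_coeff g = 1" "degree g = (k - 1) * degree f"
    "\<And>u. annihilates (k - 1) v u \<longleftrightarrow> right_dvd g u" using annihilator_generator[OF ind] by blast
  define j where "j = degree f"
  have deg: "degree g + j = t" using g(2) k by (cases k) (simp_all add: t j_def)
  have j: "j > 0" "j \<le> t" using degree_f_pos deg by (simp_all add: j_def)
  have tj: "t - j = degree g" using deg by simp
  \<comment> \<open>The constant term 1 of \<open>h\<close> keeps the constant coefficient of
    \<open>g\<close>, and as \<open>g\<close> is monic the coefficient of \<open>a\<close> at
    \<open>t\<close> is \<open>b\<close>. So this value of \<open>b\<close> is the one the code
    prescribes.\<close>
  define b where "b = \<eta> * \<rho> (coeff g 0)"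
  define h where "h = 1 + monom b j"
  define a where "a = h \<star> g"
  have ca: "coeff a i = coeff g i + (if j \<le> i then b * (\<sigma> ^^ j) (coeff g (i - j)) else 0)" for i
    by (simp add: a_def h_def skew_mult_distribs monom_skew_mult)
  have a0: "coeff a 0 = coeff g 0" using j by (simp add: ca)
  have at: "coeff a t = b" using j g(1) deg by (simp add: ca tj coeff_eq_0)
  have above: "coeff a i = 0" if "i > t" for i
    using that deg j by (simp add: ca coeff_eq_0)
  define p where "p = a - monom b t"
  have p: "p \<in> polys_below t" using at above unfolding p_def polys_below_def
    by (intro CollectI allI impI) (metis coeff_diff coeff_monom diff_self diff_zero le_neq_implies_less)
  have "coeff p 0 = coeff g 0" using a0 t_pos by (simp add: p_def)
  then have enc: "encode p = a" by (simp add: encode_def p_def b_def)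
  have "coeff h 0 = 1" using j(1) by (simp add: h_def)
  then have "h \<noteq> 0" by auto
  moreover have "g \<noteq> 0" using g(1) by auto
  ultimately have anz: "a \<noteq> 0" by (simp add: a_def)
  have "annihilates (k - 1) v a" using g(3) by (simp add: a_def right_dvdI)
  moreover have "v i \<in> remainders f" if "i < k - 1" for i using v(2) that k by simp
  ultimately obtain d w where dw: "k - 1 \<le> d" "d \<le> m" "eigen_dim \<sigma> f (image_of a) (m - d)"
    using kernel_basis[OF ind, of a] by blast
  have "coset_rank \<sigma> f (coset a) \<le> m - k + 1" using coset_rank_eq[OF dw(3)] dw(1) k by simp
  moreover have "coset a \<noteq> coset 0" using coset_zero_iff[of a] degree_encode[OF p] anz enc by simp
  moreover have "coset a \<in> skew_code \<sigma> P t \<eta> \<rho>" unfolding code_eq using p enc by blast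
  ultimately show ?thesis by blast
qed

lemma min_distance_code: "min_distance \<sigma> f P (skew_code \<sigma> P t \<eta> \<rho>) = m - k + 1"
  unfolding min_distance_def Q_simps
proof (rule cInf_eq_minimum)
  obtain A where A: "A \<in> skew_code \<sigma> P t \<eta> \<rho>" "A \<noteq> coset 0" "coset_rank \<sigma> f A \<le> m - k + 1"
    using exists_codeword_of_small_rank by blast
  then have "coset_rank \<sigma> f A = m - k + 1" using rank_codeword[OF A(1,2)] by simp
  then show "m - k + 1 \<in> coset_rank \<sigma> f ` (skew_code \<sigma> P t \<eta> \<rho> - {coset 0})"
    using A(1,2) by (intro image_eqI[of _ _ A]) auto
  fix x assume "x \<in> coset_rank \<sigma> f ` (skew_code \<sigma> P t \<eta> \<rho> - {coset 0})"
  then show "m - k + 1 \<le> x" using rank_codeword by blast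
qed

lemma mrd: "mrd_code \<sigma> f P m K' (skew_code \<sigma> P t \<eta> \<rho>)"
proof -
  obtain v where v: "indep m v" "\<forall>i<m. v i \<in> remainders f" "\<forall>b\<in>remainders f. spans m v b" using basis .
  obtain e where e: "ring.dimension (eigenring \<sigma> f) e ((\<lambda>c. [:c:]) ` K') D" "m * e = degree f * (r * n)"
    by (rule eigenring_dimension[OF subfield_K' _ dimension_L v(1,3)]) (rule K'_\<sigma>_fixed)
  \<comment> \<open>The factor \<open>m - d + 1\<close> of the bound equals \<open>k\<close> at
    minimum distance \<open>d = m - k + 1\<close>; natural subtraction is exact since
    \<open>k < m\<close>.\<close>
  have "t * (r * n) = k * (m * e)" unfolding e(2) t by (rule mult.assoc)
  also have "\<dots> = m * (m - min_distance \<sigma> f P (skew_code \<sigma> P t \<eta> \<rho>) + 1) * e"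
    using k by (simp add: min_distance_code)
  finally show ?thesis
    unfolding mrd_code_def
    by (intro conjI linear_code exI[of _ "t * (r * n)"] exI[of _ e] dimension_code e(1))
qed

lemma coset_map_iso: "coset_map \<sigma> f \<in> ring_iso Q (eigen_End \<sigma> f)"
proof -
  obtain v where "indep m v" "\<forall>i<m. v i \<in> remainders f" "\<forall>b\<in>remainders f. spans m v b" using basis .
  then show ?thesis by (rule coset_map_ring_iso)
qed

end

theorem mainTheorem9:
  fixes K K' :: "'l::field set"
    and \<sigma> \<rho> :: "'l \<Rightarrow> 'l"
    and F f P :: "'l poly"
    and n s m l k :: nat
    and \<eta> :: 'l
  assumes n: "n \<ge> 2"
    and gal: "cyclic_galois K n \<sigma>"
    and F_coeffs: "F \<in> carrier (poly_ring_over K)"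
    and F_monic: "lead_coeff F = 1"
    and F_irreducible: "ring_irreducible\<^bsub>poly_ring_over K\<^esub> F"
    and F_degree: "degree F = s"
    and F_ne: "F \<noteq> [:0, 1:]"
    and P: "P = subst_power n F"
    and m: "irreducible_factor_count \<sigma> P m"
    and l: "l = n div m"
    and f_monic: "lead_coeff f = 1"
    and f_irreducible: "skew_irreducible \<sigma> f"
    and f_factor: "skew_factor \<sigma> f P"
    and f_noncentral: "f \<notin> skew_center \<sigma>"
    and rho: "\<rho> \<in> ring_iso ambient_field ambient_field"
    and K': "K' = {a. \<rho> a = a} \<inter> K"
    and K'_finite: "ring.finite_dimension ambient_field K' K"
    and k: "0 < k" "k < m"
    and eta: "field_norm UNIV K' \<eta> *
        field_norm K K' ((-1) ^ (s * k * l * (n - 1)) * coeff P 0 ^ (k * l)) \<noteq> 1"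
  shows "eigen_dim \<sigma> f (remainders f) m \<and>
    coset_map \<sigma> f \<in> ring_iso (skew_quotient \<sigma> P) (eigen_End \<sigma> f) \<and>
    mrd_code \<sigma> f P m K' (skew_code \<sigma> P (s * k * l) \<eta> \<rho>) \<and>
    min_distance \<sigma> f P (skew_code \<sigma> P (s * k * l) \<eta> \<rho>) = m - k + 1"
proof -
  interpret cyclic_extension \<sigma> n K by (rule cyclic_galois_extension[OF gal])
  have irr: "central_irreducible P"
    unfolding P by (rule central_irreducible_subst_power[OF F_coeffs F_monic F_irreducible])
  have P0: "coeff P 0 \<noteq> 0"
    using coeff_0_irreducible[OF F_coeffs F_monic F_irreducible F_ne] by (simp add: P coeff_subst_power)
  have degP: "degree P = n * s" by (simp add: P degree_subst_power F_degree)
  have P_monic: "lead_coeff P = 1"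
    using F_monic F_degree n_pos unfolding degP by (simp add: P coeff_subst_power)
  interpret skew_simple_module \<sigma> f P by (rule simple_module_of_factor[OF irr P0 f_irreducible f_factor])
  have mdeg: "m * degree f = degree P" by (rule factor_count_degree[OF m])
  \<comment> \<open>Applied to \<open>f\<close> itself, the norm argument shows that
    \<open>m\<close> divides \<open>n\<close>. Hence \<open>l\<close> is the exact quotient and
    \<open>degree f = s * l\<close>, which matches the code length \<open>s * k * l\<close> with
    \<open>k * degree f\<close>.\<close>
  obtain j where "degree f * n = degree P * j"
    using right_factor_norm[OF irr P_monic f_monic f_dvd_P] by blast
  then have "degree f * n = degree f * (m * j)" by (simp add: mdeg[symmetric] mult_ac)
  then have nj: "n = m * j" using degree_f_pos by simp
  have "m > 0" using k by simp
  then have lj: "l = j" using nj by (simp add: l)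
  have "m * degree f = m * (s * l)" using mdeg degP nj lj by (simp add: mult_ac)
  then have degf: "degree f = s * l" using \<open>m > 0\<close> by simp
  then have t: "s * k * l = k * degree f" by (simp add: mult_ac)
  obtain r where r: "ambient.dimension r K' K" using K'_finite unfolding ambient.finite_dimension_def by blast
  have eta': "field_norm UNIV K' \<eta> *
      field_norm K K' ((-1) ^ (s * k * l * (n - 1)) * coeff P 0 ^ (k * (n div m))) \<noteq> 1"
    unfolding l[symmetric] by (fact eta)
  interpret skew_code_setup \<sigma> n K f P \<rho> K' r m k "s * k * l" \<eta>
    by unfold_locales (fact irr P_monic P0 f_monic mdeg rho K' r k t eta')+
  show ?thesis
    using eigen_dim_remainders coset_map_iso mrd min_distance_code by blast
qed

end
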